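(* Let $\sigma>0$, $f\in\mathcal{S}(\mathbb{R}^n)$, $L(x,k)\in\mathcal{S}'(\mathbb{R}^{2n})$, and let $L$ be the operator with Weyl symbol $L(x,k)$, i.e. $Lf(x)=\int_{y,k\in\mathbb{R}^n}e^{2\pi i k(x-y)}L\left(\frac{x+y}{2},k\right)f(y)\,dk\,dy$. Let $\Phi$ be the smoothing operator $$\Phi: f(x)\mapsto \mathcal{F}^{-1}_{X\to x}\left[e^{-\frac{\pi}{2}\sigma^2X^2}\,\mathcal{F}_{a\to X}[f(a)]\right]$$ and let $w=\Phi f$. Then the operator $\tilde L=\Phi L\Phi^{-1}$ can be expressed as $$\tilde L w(x)=2^n\int_{k,u\in\mathbb{R}^n}e^{2\pi(ix-\sigma^2k)u+2\pi i kx}\,\hat w(k-u)\,\hat L_1(2u,k)\,du\,dk,$$ where $\hat L_1(u,k)=\mathcal{F}_{x\to u}[L(x,k)]$. Another, equivalent formulation is $$\tilde L w(x)=\int_{y,k\in\mathbb{R}^n}e^{2\pi i(x-y)k-2\pi\sigma^2k^2}\,L\left(\frac{x+y}{2},k\right)w(y-i\sigma^2k)\,dy\,dk.$$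
   Context: Fourier transform: $\hat f(k)=\mathcal{F}_{x\to k}[f(x)]=\int_{\mathbb{R}^n}e^{-2\pi i k\cdot x}f(x)\,dx$, with inverse $\mathcal{F}^{-1}_{k\to x}[g(k)]=\int_{\mathbb{R}^n}e^{2\pi i k\cdot x}g(k)\,dk$; both extended to tempered distributions. Products such as $kx$ and $k^2$ denote $k\cdot x$ and $k\cdot k$. Integrals involving the distribution $L(x,k)$ or $\hat L_1$ are understood, for each fixed $x$ where applicable, as duality pairings of a tempered distribution on $\mathbb{R}^{2n}$ with a Schwartz function. $\Phi$ is injective, with inverse the Fourier multiplier $e^{\frac{\pi}{2}\sigma^2X^2}$ on its range; $\tilde L=\Phi L\Phi^{-1}$ means that $\tilde L(\Phi f)=\Phi(Lf)$ for all $f\in\mathcal{S}(\mathbb{R}^n)$. The function $w=\Phi f$ extends to an entire function on $\mathbb{C}^n$, and $w(y-i\sigma^2k)$ denotes the value of that extension. *)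

theory Defs
  imports "HOL-Analysis.Analysis"
begin

section \<open>Schwartz functions and tempered distributions\<close>

text \<open>Iterated partial derivatives along a list of coordinate directions; with
  entries from \<^term>\<open>Basis\<close> these are the partial derivatives of all orders.\<close>

primrec pderivs :: "'a list \<Rightarrow> ('a::euclidean_space \<Rightarrow> complex) \<Rightarrow> 'a \<Rightarrow> complex" where
  "pderivs [] f = f"
| "pderivs (b # bs) f = (\<lambda>x. frechet_derivative (pderivs bs f) (at x) b)"

definition smooth :: "('a::euclidean_space \<Rightarrow> complex) \<Rightarrow> bool" where
  "smooth f \<longleftrightarrow> (\<forall>bs\<in>lists Basis. \<forall>x. pderivs bs f differentiable (at x))"

definition schwartz :: "('a::euclidean_space \<Rightarrow> complex) \<Rightarrow> bool" where
  "schwartz f \<longleftrightarrow> smooth f \<and>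
     (\<forall>N. \<forall>bs\<in>lists Basis. \<exists>C. \<forall>x. (1 + norm x) ^ N * norm (pderivs bs f x) \<le> C)"

definition schwartz_seminorm :: "nat \<Rightarrow> ('a::euclidean_space \<Rightarrow> complex) \<Rightarrow> real" where
  "schwartz_seminorm N f =
     (SUP (bs, x) \<in> {bs \<in> lists Basis. length bs \<le> N} \<times> UNIV.
        (1 + norm x) ^ N * norm (pderivs bs f x))"

text \<open>A tempered distribution is represented by a functional on all functions, of which
  only the values at Schwartz functions are meaningful; \<open>T \<phi>\<close> is the (bilinear) duality
  pairing.  The seminorms above increase with \<open>N\<close> and generate the Schwartz topology, so
  the last clause is continuity.\<close>

definition tempered_distribution :: "(('a::euclidean_space \<Rightarrow> complex) \<Rightarrow> complex) \<Rightarrow> bool" where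
  "tempered_distribution T \<longleftrightarrow>
     (\<forall>\<phi> \<psi>. schwartz \<phi> \<longrightarrow> schwartz \<psi> \<longrightarrow> T (\<lambda>x. \<phi> x + \<psi> x) = T \<phi> + T \<psi>) \<and>
     (\<forall>c \<phi>. schwartz \<phi> \<longrightarrow> T (\<lambda>x. c * \<phi> x) = c * T \<phi>) \<and>
     (\<exists>C N. \<forall>\<phi>. schwartz \<phi> \<longrightarrow> norm (T \<phi>) \<le> C * schwartz_seminorm N \<phi>)"

text \<open>The tempered distribution \<open>T\<close> is (integration against) the function \<open>h\<close>.\<close>

definition represented_by ::
    "(('a::euclidean_space \<Rightarrow> complex) \<Rightarrow> complex) \<Rightarrow> ('a \<Rightarrow> complex) \<Rightarrow> bool" where
  "represented_by T h \<longleftrightarrow> (\<forall>\<phi>. schwartz \<phi> \<longrightarrow>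
     integrable lborel (\<lambda>x. h x * \<phi> x) \<and> T \<phi> = (LINT x|lborel. h x * \<phi> x))"

section \<open>Fourier transforms\<close>

definition fourier :: "('a::euclidean_space \<Rightarrow> complex) \<Rightarrow> 'a \<Rightarrow> complex" where
  "fourier f k = (LINT x|lborel. exp (- 2 * pi * \<i> * of_real (k \<bullet> x)) * f x)"

definition inv_fourier :: "('a::euclidean_space \<Rightarrow> complex) \<Rightarrow> 'a \<Rightarrow> complex" where
  "inv_fourier g x = (LINT k|lborel. exp (2 * pi * \<i> * of_real (k \<bullet> x)) * g k)"

definition fourier_dist ::
    "(('a::euclidean_space \<Rightarrow> complex) \<Rightarrow> complex) \<Rightarrow> ('a \<Rightarrow> complex) \<Rightarrow> complex" where
  "fourier_dist T \<phi> = T (fourier \<phi>)"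

definition inv_fourier_dist ::
    "(('a::euclidean_space \<Rightarrow> complex) \<Rightarrow> complex) \<Rightarrow> ('a \<Rightarrow> complex) \<Rightarrow> complex" where
  "inv_fourier_dist T \<phi> = T (inv_fourier \<phi>)"

definition mult_dist ::
    "('a \<Rightarrow> complex) \<Rightarrow> (('a::euclidean_space \<Rightarrow> complex) \<Rightarrow> complex) \<Rightarrow> ('a \<Rightarrow> complex) \<Rightarrow> complex" where
  "mult_dist m T \<phi> = T (\<lambda>x. m x * \<phi> x)"

text \<open>Fourier transform of a distribution in the first variable only.\<close>

definition fourier_fst_dist ::
    "(('a::euclidean_space \<times> 'a \<Rightarrow> complex) \<Rightarrow> complex) \<Rightarrow> ('a \<times> 'a \<Rightarrow> complex) \<Rightarrow> complex" where
  "fourier_fst_dist T \<phi> = T (\<lambda>(x, k). fourier (\<lambda>u. \<phi> (u, k)) x)"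

text \<open>The distribution \<open>T (c y + b, k)\<close> in the variables \<open>(y, k)\<close>, for \<open>c \<noteq> 0\<close>.  Formally
  \<open>\<integral>\<integral> T (c y + b, k) \<phi> (y, k) dy dk = \<bar>c\<bar>\<^sup>-\<^sup>n \<integral>\<integral> T (m, k) \<phi> ((m - b) / c, k) dm dk\<close>.\<close>

definition affine_fst_dist ::
    "real \<Rightarrow> 'a \<Rightarrow> (('a::euclidean_space \<times> 'a \<Rightarrow> complex) \<Rightarrow> complex) \<Rightarrow>
      ('a \<times> 'a \<Rightarrow> complex) \<Rightarrow> complex" where
  "affine_fst_dist c b T \<phi> =
     T (\<lambda>(m, k). \<phi> ((1 / c) *\<^sub>R (m - b), k)) / of_real (\<bar>c\<bar> ^ DIM('a))"

section \<open>The operators\<close>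

text \<open>For a distributional Weyl symbol \<open>L\<close>, \<open>L f\<close> is a tempered distribution.  Pairing
  \<open>\<integral>\<integral> e\<^bsup>2\<pi>ik(x-y)\<^esup> L((x+y)/2, k) f(y) dk dy\<close> with \<open>g(x)\<close> and substituting \<open>x = m + z/2\<close>,
  \<open>y = m - z/2\<close> (unit Jacobian) gives the pairing of \<open>L\<close> with the Schwartz function below.\<close>

definition weyl_op ::
    "(('a::euclidean_space \<times> 'a \<Rightarrow> complex) \<Rightarrow> complex) \<Rightarrow>
      ('a \<Rightarrow> complex) \<Rightarrow> ('a \<Rightarrow> complex) \<Rightarrow> complex" where
  "weyl_op L f g = L (\<lambda>(m, k). LINT z|lborel.
     exp (2 * pi * \<i> * of_real (k \<bullet> z)) * f (m - (1/2) *\<^sub>R z) * g (m + (1/2) *\<^sub>R z))"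

definition gauss_mult :: "real \<Rightarrow> 'a::euclidean_space \<Rightarrow> complex" where
  "gauss_mult \<sigma> X = of_real (exp (- (pi / 2) * \<sigma>\<^sup>2 * (X \<bullet> X)))"

definition Phi :: "real \<Rightarrow> ('a::euclidean_space \<Rightarrow> complex) \<Rightarrow> 'a \<Rightarrow> complex" where
  "Phi \<sigma> f = inv_fourier (\<lambda>X. gauss_mult \<sigma> X * fourier f X)"

definition Phi_dist ::
    "real \<Rightarrow> (('a::euclidean_space \<Rightarrow> complex) \<Rightarrow> complex) \<Rightarrow> ('a \<Rightarrow> complex) \<Rightarrow> complex" where
  "Phi_dist \<sigma> T = inv_fourier_dist (mult_dist (gauss_mult \<sigma>) (fourier_dist T))"

text \<open>\<open>\<Phi> L \<Phi>\<^sup>-\<^sup>1\<close>, defined on the range of \<open>\<Phi>\<close> on Schwartz functions.\<close>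

definition smoothed_op ::
    "real \<Rightarrow> (('a::euclidean_space \<times> 'a \<Rightarrow> complex) \<Rightarrow> complex) \<Rightarrow>
      ('a \<Rightarrow> complex) \<Rightarrow> ('a \<Rightarrow> complex) \<Rightarrow> complex" where
  "smoothed_op \<sigma> L w = Phi_dist \<sigma> (weyl_op L (inv_into (Collect schwartz) (Phi \<sigma>) w))"

section \<open>Entire functions of several complex variables\<close>

definition entire :: "(complex ^ 'n \<Rightarrow> complex) \<Rightarrow> bool" where
  "entire F \<longleftrightarrow> (\<forall>z. \<exists>D. (F has_derivative D) (at z) \<and> (\<forall>c v. D (c *s v) = c * D v))"

definition entire_extension :: "(complex ^ 'n \<Rightarrow> complex) \<Rightarrow> (real ^ 'n \<Rightarrow> complex) \<Rightarrow> bool" where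
  "entire_extension W w \<longleftrightarrow> entire W \<and> (\<forall>x. W (\<chi> j. of_real (x $ j)) = w x)"

end

theory Submission
  imports Defs
    "HOL-Probability.Sinc_Integral"
    "HOL-Probability.Characteristic_Functions"
    "HOL-Complex_Analysis.Conformal_Mappings"
begin

text \<open>
  Write \<open>e(t) = exp (2 \<pi> \<i> t)\<close>, \<open>G(X) = exp (- (\<pi> / 2) \<sigma>\<^sup>2 X\<^sup>2)\<close>, so that \<open>\<Phi>\<close> is the Fourier multiplier \<open>G\<close>, and
  let \<open>F\<close> be the Fourier transform of \<open>f\<close>.  The conjugated operator and both integral formulas turn
  out to be the pairing of the symbol \<open>L(m, k)\<close> with one and the same Schwartz function (called
  \<open>weyl_kernel\<close> below), the Fourier transform from \<open>u\<close> to \<open>m\<close> of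
    \<open>e(x \<bullet> (k + u/2)) G(k + u/2) F(k - u/2)\<close>.
  The function \<open>h\<close> of the theorem is this pairing as a function of \<open>x\<close>.

  \<^item> The operator.  Paired with a test function \<open>g\<close>, a Weyl operator pairs its symbol with a Wigner
    transform, and this is a partial Fourier transform of a product of two functions of \<open>k + u/2\<close> and
    \<open>k - u/2\<close> (\<open>wigner_fourier\<close>).  For the conjugated operator the two functions are \<open>G\<close> times the
    inverse transform of \<open>g\<close>, and \<open>F\<close> (\<open>smoothed_op_Phi\<close>).  The inverse transform of \<open>g\<close> is the
    superposition of the waves \<open>e(x \<bullet> a)\<close> with the coefficients \<open>g(x)\<close>; taking the integral over \<open>x\<close>
    out of the pairing leaves the integral of \<open>h g\<close> (\<open>smoothed_op_represented\<close>).
  \<^item> The Fourier side.  The transform of \<open>w = \<Phi> f\<close> is \<open>G F\<close>, and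
    \<open>exp (- 2 \<pi> \<sigma>\<^sup>2 k \<bullet> u) G(k - u) = G(k + u)\<close> (\<open>fourier_side\<close>).
  \<^item> The space side.  The integral of \<open>e(p \<bullet> z) G(p) F(p)\<close> over \<open>p\<close> extends \<open>w\<close> to an entire function, and
    there is no other extension.  At \<open>z = y - \<i> \<sigma>\<^sup>2 k\<close> the Gaussian factors form a complete square, and
    \<open>p = k - u/2\<close> gives the above function (\<open>space_side\<close>).

  The exchange of the pairing with the integral over \<open>x\<close> is the analytic core
  (\<open>tempered_distribution_integral\<close>).  A tempered distribution is bounded by a single seminorm; Riemann
  sums converge in this seminorm since one choice of nodes works for all functions with a common
  Lipschitz constant and a common decay rate (\<open>uniform_quadrature\<close>).

  The remaining foundation is a small calculus of Schwartz functions.  Operators such as changes of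
  variables, tensor products, multiplications and partial Fourier transforms are shown to be continuous
  by \<open>scont_family\<close>: it suffices to bound the operators of a family that is stable under
  differentiation.  Fourier inversion is proved by Gaussian regularization.
\<close>

section \<open>Directional derivatives and smooth functions\<close>

definition pdir :: "'a::euclidean_space \<Rightarrow> ('a \<Rightarrow> complex) \<Rightarrow> 'a \<Rightarrow> complex" where
  "pdir b f = (\<lambda>x. frechet_derivative f (at x) b)"

lemma pderivs_Cons_pdir: "pderivs (b # bs) f = pdir b (pderivs bs f)"
  by (simp add: pdir_def)

lemma pderivs_append: "pderivs (as @ bs) f = pderivs as (pderivs bs f)"
  by (induction as) simp_all

lemma pderivs_snoc: "pderivs (bs @ [b]) f = pderivs bs (pdir b f)"
  by (simp add: pderivs_append pdir_def)

lemma pdir_eqI: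
  assumes "\<And>x. (f has_derivative F x) (at x)"
  shows "pdir b f = (\<lambda>x. F x b)"
  unfolding pdir_def using frechet_derivative_at[OF assms] by metis

lemma has_derivative_pdir_Basis:
  assumes "f differentiable (at x)"
  shows "(f has_derivative (\<lambda>v. \<Sum>b\<in>Basis. (v \<bullet> b) *\<^sub>R pdir b f x)) (at x)"
proof -
  let ?D = "frechet_derivative f (at x)"
  have D: "(f has_derivative ?D) (at x)" using assms frechet_derivative_works by blast
  then have lin: "linear ?D" by (rule has_derivative_linear)
  have "?D v = (\<Sum>b\<in>Basis. (v \<bullet> b) *\<^sub>R pdir b f x)" for v
  proof -
    have "?D v = ?D (\<Sum>b\<in>Basis. (v \<bullet> b) *\<^sub>R b)" by (simp add: euclidean_representation)
    also have "\<dots> = (\<Sum>b\<in>Basis. (v \<bullet> b) *\<^sub>R ?D b)"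
      by (simp add: linear_sum[OF lin] linear_cmul[OF lin])
    finally show ?thesis by (simp add: pdir_def)
  qed
  then show ?thesis using D by (metis (no_types, lifting) ext)
qed

lemma pdir_add:
  assumes "\<And>x. f differentiable (at x)" "\<And>x. g differentiable (at x)"
  shows "pdir b (\<lambda>x. f x + g x) = (\<lambda>x. pdir b f x + pdir b g x)"
proof -
  have "((\<lambda>x. f x + g x) has_derivative
     (\<lambda>v. frechet_derivative f (at x) v + frechet_derivative g (at x) v)) (at x)" for x
    using assms frechet_derivative_works by (intro has_derivative_add) blast+
  from pdir_eqI[OF this] show ?thesis by (simp add: pdir_def)
qed

lemma pdir_cmult:
  assumes "\<And>x. f differentiable (at x)"
  shows "pdir b (\<lambda>x. c * f x) = (\<lambda>x. c * pdir b f x)"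
proof -
  have "((\<lambda>x. c * f x) has_derivative (\<lambda>v. c * frechet_derivative f (at x) v)) (at x)" for x
    using assms frechet_derivative_works by (intro has_derivative_mult_right) blast
  from pdir_eqI[OF this] show ?thesis by (simp add: pdir_def)
qed

lemma pdir_mult:
  assumes "\<And>x. f differentiable (at x)" "\<And>x. g differentiable (at x)"
  shows "pdir b (\<lambda>x. f x * g x) = (\<lambda>x. pdir b f x * g x + f x * pdir b g x)"
proof -
  have "((\<lambda>x. f x * g x) has_derivative
     (\<lambda>v. f x * frechet_derivative g (at x) v + frechet_derivative f (at x) v * g x)) (at x)" for x
    using assms frechet_derivative_works by (intro has_derivative_mult) blast+
  from pdir_eqI[OF this] show ?thesis by (simp add: pdir_def add.commute)
qed

lemma pdir_const: "pdir b (\<lambda>x. c) = (\<lambda>x. 0)"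
  by (rule pdir_eqI[where F = "\<lambda>x v. 0", simplified]) auto

lemma smooth_differentiable: "smooth f \<Longrightarrow> f differentiable (at x)"
  unfolding smooth_def by (metis lists.Nil pderivs.simps(1))

lemma smooth_pderivs: "smooth f \<Longrightarrow> bs \<in> lists Basis \<Longrightarrow> smooth (pderivs bs f)"
  unfolding smooth_def by (metis append_in_lists_conv pderivs_append)

lemma smooth_pdir: "smooth f \<Longrightarrow> b \<in> Basis \<Longrightarrow> smooth (pdir b f)"
  using smooth_pderivs[of f "[b]"] by (simp add: pdir_def)

lemma smoothI:
  assumes "\<And>bs x. bs \<in> lists Basis \<Longrightarrow> pderivs bs f differentiable (at x)"
  shows "smooth f"
  using assms unfolding smooth_def by blast

lemma pderivs_add:
  assumes "smooth f" "smooth g" "bs \<in> lists Basis"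
  shows "pderivs bs (\<lambda>x. f x + g x) = (\<lambda>x. pderivs bs f x + pderivs bs g x)"
  using assms(3)
proof (induction bs)
  case (Cons b bs)
  then have "bs \<in> lists Basis" by auto
  with Cons show ?case
    unfolding pderivs_Cons_pdir
    by (simp add: pdir_add smooth_differentiable[OF smooth_pderivs] assms)
qed simp

lemma pderivs_cmult:
  assumes "smooth f" "bs \<in> lists Basis"
  shows "pderivs bs (\<lambda>x. c * f x) = (\<lambda>x. c * pderivs bs f x)"
  using assms(2)
proof (induction bs)
  case (Cons b bs)
  then have "bs \<in> lists Basis" by auto
  with Cons show ?case
    unfolding pderivs_Cons_pdir
    by (simp add: pdir_cmult smooth_differentiable[OF smooth_pderivs] assms)
qed simp

lemma smooth_add: "smooth f \<Longrightarrow> smooth g \<Longrightarrow> smooth (\<lambda>x. f x + g x)"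
  by (rule smoothI) (simp add: pderivs_add smooth_differentiable[OF smooth_pderivs])

lemma smooth_cmult: "smooth f \<Longrightarrow> smooth (\<lambda>x. c * f x)"
  by (rule smoothI) (simp add: pderivs_cmult smooth_differentiable[OF smooth_pderivs])

lemma pderivs_const: "pderivs bs (\<lambda>x. c) = (\<lambda>x. if bs = [] then c else 0)"
proof (induction bs)
  case (Cons b bs)
  then show ?case unfolding pderivs_Cons_pdir by (cases bs) (simp_all add: pdir_const)
qed simp

lemma smooth_const: "smooth (\<lambda>x. c)"
  by (rule smoothI) (simp add: pderivs_const)

text \<open>Smoothness by coinduction: the derivatives of order \<open>n + 1\<close> of a member are sums of derivatives of
order \<open>n\<close> of two members.  Differentiability and additivity of the iterated derivatives have to be
proved in the same induction, because peeling off the innermost derivative produces a sum, and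
differentiating that sum termwise needs differentiability of the two parts.\<close>

lemma smooth_family:
  assumes "f \<in> \<S>"
    and diff: "\<And>g x. g \<in> \<S> \<Longrightarrow> g differentiable (at x)"
    and step: "\<And>g b. g \<in> \<S> \<Longrightarrow> b \<in> Basis \<Longrightarrow> \<exists>g1\<in>\<S>. \<exists>g2\<in>\<S>. pdir b g = (\<lambda>x. g1 x + g2 x)"
  shows "smooth f"
proof -
  have 1: "pderivs bs f differentiable (at x) \<and>
      (\<forall>g\<in>\<S>. pderivs bs (\<lambda>x. f x + g x) = (\<lambda>x. pderivs bs f x + pderivs bs g x))"
    if "bs \<in> lists Basis" "f \<in> \<S>" for bs f x
    using that
  proof (induction "length bs" arbitrary: bs f x rule: less_induct)
    case less
    have diffbs: "pderivs cs f differentiable (at x)"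
      if cs: "cs \<in> lists Basis" "length cs \<le> length bs" "f \<in> \<S>" for cs f x
    proof (cases cs rule: rev_cases)
      case Nil then show ?thesis using diff that by simp
    next
      case (snoc ds b)
      then have ds: "ds \<in> lists Basis" "b \<in> Basis" "length ds < length bs" using cs by auto
      obtain g1 g2 where g: "g1 \<in> \<S>" "g2 \<in> \<S>" "pdir b f = (\<lambda>x. g1 x + g2 x)"
        using step[OF cs(3) ds(2)] by blast
      have "pderivs cs f = (\<lambda>x. pderivs ds g1 x + pderivs ds g2 x)"
        using less.hyps[OF ds(3) ds(1) g(1)] g by (simp add: snoc pderivs_snoc)
      moreover have "(\<lambda>x. pderivs ds g1 x + pderivs ds g2 x) differentiable at x"
        using less.hyps[OF ds(3) ds(1)] g by (intro differentiable_add) auto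
      ultimately show ?thesis by simp
    qed
    show ?case
    proof (intro conjI ballI)
      show "pderivs bs f differentiable at x" using diffbs less.prems by blast
    next
      fix g assume g: "g \<in> \<S>"
      show "pderivs bs (\<lambda>x. f x + g x) = (\<lambda>x. pderivs bs f x + pderivs bs g x)"
      proof (cases bs)
        case (Cons b cs)
        then have cs: "cs \<in> lists Basis" "length cs < length bs" using less.prems by auto
        have "pderivs cs (\<lambda>x. f x + g x) = (\<lambda>x. pderivs cs f x + pderivs cs g x)"
          using less.hyps[OF cs(2) cs(1) less.prems(2)] g by blast
        then show ?thesis
          unfolding Cons pderivs_Cons_pdir using cs less.prems g
          by (simp add: pdir_add diffbs)
      qed simp
    qed
  qed
  show ?thesis using 1 assms(1) by (intro smoothI) blast
qed

section \<open>Schwartz functions and their seminorms\<close>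

lemma schwartz_smooth: "schwartz f \<Longrightarrow> smooth f"
  by (simp add: schwartz_def)

lemma schwartz_differentiable: "schwartz f \<Longrightarrow> f differentiable (at x)"
  by (simp add: schwartz_smooth smooth_differentiable)

lemma schwartz_continuous: "schwartz f \<Longrightarrow> continuous_on S f"
  by (meson continuous_at_imp_continuous_on differentiable_imp_continuous_within
      schwartz_differentiable)

lemma schwartz_pderivs: "schwartz f \<Longrightarrow> bs \<in> lists Basis \<Longrightarrow> schwartz (pderivs bs f)"
  unfolding schwartz_def by (metis append_in_lists_conv pderivs_append smooth_pderivs)

lemma schwartz_pdir: "schwartz f \<Longrightarrow> b \<in> Basis \<Longrightarrow> schwartz (pdir b f)"
  using schwartz_pderivs[of f "[b]"] by (simp add: pdir_def)

lemma schwartz_decay: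
  assumes "schwartz f"
  obtains C where "C \<ge> 0" "\<And>x. (1 + norm x) ^ N * norm (f x) \<le> C"
proof -
  obtain C where "\<And>x. (1 + norm x) ^ N * norm (pderivs [] f x) \<le> C"
    using assms unfolding schwartz_def by (metis lists.Nil)
  then show ?thesis
    by (intro that[of "\<bar>C\<bar>"]) (auto intro: order_trans[OF _ abs_ge_self])
qed

lemma schwartz_add: "schwartz f \<Longrightarrow> schwartz g \<Longrightarrow> schwartz (\<lambda>x. f x + g x)"
  unfolding schwartz_def
proof (intro conjI allI ballI)
  fix N bs
  assume f: "smooth f \<and> (\<forall>N. \<forall>bs\<in>lists Basis. \<exists>C. \<forall>x. (1 + norm x) ^ N * norm (pderivs bs f x) \<le> C)"
    and g: "smooth g \<and> (\<forall>N. \<forall>bs\<in>lists Basis. \<exists>C. \<forall>x. (1 + norm x) ^ N * norm (pderivs bs g x) \<le> C)"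
    and bs: "bs \<in> lists (Basis :: 'a set)"
  obtain C D where C: "\<And>x. (1 + norm x) ^ N * norm (pderivs bs f x) \<le> C"
    and D: "\<And>x. (1 + norm x) ^ N * norm (pderivs bs g x) \<le> D" using f g bs by metis
  have "(1 + norm x) ^ N * norm (pderivs bs (\<lambda>x. f x + g x) x) \<le> C + D" for x
  proof -
    have "(1 + norm x) ^ N * norm (pderivs bs f x + pderivs bs g x)
        \<le> (1 + norm x) ^ N * (norm (pderivs bs f x) + norm (pderivs bs g x))"
      by (intro mult_left_mono norm_triangle_ineq) auto
    with C[of x] D[of x] f g bs show ?thesis by (simp add: pderivs_add algebra_simps)
  qed
  then show "\<exists>C. \<forall>x. (1 + norm x) ^ N * norm (pderivs bs (\<lambda>x. f x + g x) x) \<le> C" by blast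
qed (auto intro: smooth_add)

lemma schwartz_cmult: "schwartz f \<Longrightarrow> schwartz (\<lambda>x. c * f x)"
  unfolding schwartz_def
proof (intro conjI allI ballI)
  fix N bs
  assume f: "smooth f \<and> (\<forall>N. \<forall>bs\<in>lists Basis. \<exists>C. \<forall>x. (1 + norm x) ^ N * norm (pderivs bs f x) \<le> C)"
    and bs: "bs \<in> lists (Basis :: 'a set)"
  obtain C where C: "\<And>x. (1 + norm x) ^ N * norm (pderivs bs f x) \<le> C"
    using f bs by metis
  have "(1 + norm x) ^ N * norm (pderivs bs (\<lambda>x. c * f x) x) \<le> norm c * C" for x
    using mult_left_mono[OF C[of x], of "norm c"] f bs
    by (simp add: pderivs_cmult norm_mult algebra_simps)
  then show "\<exists>C. \<forall>x. (1 + norm x) ^ N * norm (pderivs bs (\<lambda>x. c * f x) x) \<le> C" by blast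
qed (auto intro: smooth_cmult)

lemma schwartz_zero: "schwartz (\<lambda>x. 0)"
  unfolding schwartz_def by (auto simp: smooth_const pderivs_const)

lemma schwartz_sum: "(\<And>i. i \<in> I \<Longrightarrow> schwartz (f i)) \<Longrightarrow> schwartz (\<lambda>x. \<Sum>i\<in>I. f i x)"
  by (induction I rule: infinite_finite_induct) (simp_all add: schwartz_zero schwartz_add)

lemma schwartz_diff: "schwartz f \<Longrightarrow> schwartz g \<Longrightarrow> schwartz (\<lambda>x. f x - g x)"
  using schwartz_add[of f "\<lambda>x. -1 * g x"] schwartz_cmult[of g "-1"] by simp

lemma finite_short_lists: "finite {bs \<in> lists (Basis :: 'a::euclidean_space set). length bs \<le> N}"
  using finite_lists_length_le[of "Basis :: 'a set" N] by (simp add: lists_eq_set conj_commute)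

text \<open>The supremum that defines the seminorm is finite since there are only finitely many lists of basis
vectors of bounded length, and for each of them the Schwartz condition gives a bound.\<close>

lemma schwartz_seminorm_upper:
  assumes "schwartz f" "bs \<in> lists Basis" "length bs \<le> N"
  shows "(1 + norm x) ^ N * norm (pderivs bs f x) \<le> schwartz_seminorm N f"
proof -
  let ?A = "{bs \<in> lists (Basis :: 'a set). length bs \<le> N}"
  let ?g = "\<lambda>(bs, x). (1 + norm x) ^ N * norm (pderivs bs f x)"
  have "\<forall>bs\<in>?A. \<exists>C. \<forall>x. (1 + norm x) ^ N * norm (pderivs bs f x) \<le> C"
    using assms(1) unfolding schwartz_def by blast
  from bchoice[OF this] obtain C
    where C: "\<And>bs x. bs \<in> ?A \<Longrightarrow> (1 + norm x) ^ N * norm (pderivs bs f x) \<le> C bs" by blast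
  have "bdd_above (?g ` (?A \<times> UNIV))"
  proof (rule bdd_aboveI2)
    fix p :: "'a list \<times> 'a" assume "p \<in> ?A \<times> UNIV"
    then obtain bs x where p: "p = (bs, x)" and bs: "bs \<in> ?A" by auto
    have "?g p \<le> C bs" using C[OF bs] p by simp
    also have "\<dots> \<le> \<bar>C bs\<bar>" by simp
    also have "\<dots> \<le> (\<Sum>cs\<in>?A. \<bar>C cs\<bar>)"
      by (rule member_le_sum[OF bs]) (auto simp: finite_short_lists)
    finally show "?g p \<le> (\<Sum>cs\<in>?A. \<bar>C cs\<bar>)" .
  qed
  moreover have "(bs, x) \<in> ?A \<times> UNIV" using assms by simp
  ultimately have "?g (bs, x) \<le> (SUP p\<in>?A \<times> UNIV. ?g p)" by (rule cSUP_upper[rotated])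
  then show ?thesis by (simp add: schwartz_seminorm_def)
qed

lemma schwartz_seminorm_least:
  fixes f :: "'a::euclidean_space \<Rightarrow> complex"
  assumes "\<And>bs x. bs \<in> lists Basis \<Longrightarrow> length bs \<le> N \<Longrightarrow>
    (1 + norm x) ^ N * norm (pderivs bs f x) \<le> C"
  shows "schwartz_seminorm N f \<le> C"
  unfolding schwartz_seminorm_def
proof (rule cSUP_least)
  show "{bs \<in> lists (Basis :: 'a set). length bs \<le> N} \<times> (UNIV :: 'a set) \<noteq> {}"
    using lists.Nil by fastforce
qed (use assms in auto)

lemma schwartz_seminorm_nonneg: "schwartz f \<Longrightarrow> 0 \<le> schwartz_seminorm N f"
  using schwartz_seminorm_upper[of f "[]" N 0] by (simp add: order_trans[OF norm_ge_zero])

lemma schwartz_seminorm_mono: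
  assumes "schwartz f" "M \<le> N"
  shows "schwartz_seminorm M f \<le> schwartz_seminorm N f"
proof (rule schwartz_seminorm_least)
  fix bs :: "'a list" and x :: 'a assume bs: "bs \<in> lists Basis" "length bs \<le> M"
  have "(1 + norm x) ^ M * norm (pderivs bs f x) \<le> (1 + norm x) ^ N * norm (pderivs bs f x)"
    by (intro mult_right_mono power_increasing assms) auto
  also have "\<dots> \<le> schwartz_seminorm N f"
    using assms bs by (intro schwartz_seminorm_upper) auto
  finally show "(1 + norm x) ^ M * norm (pderivs bs f x) \<le> schwartz_seminorm N f" .
qed

section \<open>Continuous operators on Schwartz space\<close>

abbreviation seminorm_bounded ::
    "('b \<Rightarrow> real) \<Rightarrow> (('a::euclidean_space \<Rightarrow> complex) \<Rightarrow> 'b \<Rightarrow> complex) \<Rightarrow> bool" where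
  "seminorm_bounded r F \<equiv> \<exists>C K. \<forall>\<phi>. schwartz \<phi> \<longrightarrow> (\<forall>x. r x * norm (F \<phi> x) \<le> C * schwartz_seminorm K \<phi>)"

text \<open>Continuity of an operator between Schwartz spaces, in the form in which it is verified and used:
every weighted derivative of \<open>A \<phi>\<close> is bounded by one seminorm of \<open>\<phi>\<close>.  Smoothness of \<open>A \<phi>\<close> has to
be required separately, because \<open>pderivs\<close> has values for every function.\<close>

definition scont ::
    "(('a::euclidean_space \<Rightarrow> complex) \<Rightarrow> ('b::euclidean_space \<Rightarrow> complex)) \<Rightarrow> bool" where
  "scont A \<longleftrightarrow> (\<forall>\<phi>. schwartz \<phi> \<longrightarrow> smooth (A \<phi>)) \<and>
     (\<forall>bs\<in>lists Basis. \<forall>M. seminorm_bounded (\<lambda>x. (1 + norm x) ^ M) (\<lambda>\<phi> x. pderivs bs (A \<phi>) x))"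

lemma scont_schwartz: "scont A \<Longrightarrow> schwartz \<phi> \<Longrightarrow> schwartz (A \<phi>)"
  unfolding scont_def schwartz_def by metis

text \<open>A seminorm involves finitely many derivatives, so the constants of the individual bounds add up.\<close>

lemma scont_seminorm:
  assumes "scont (A :: ('a::euclidean_space \<Rightarrow> complex) \<Rightarrow> ('b::euclidean_space \<Rightarrow> complex))"
  obtains C K where "C \<ge> 0"
    "\<And>\<phi>. schwartz \<phi> \<Longrightarrow> schwartz_seminorm N (A \<phi>) \<le> C * schwartz_seminorm K \<phi>"
proof -
  let ?F = "{bs \<in> lists (Basis :: 'b set). length bs \<le> N}"
  have "\<forall>bs\<in>?F. seminorm_bounded (\<lambda>x. (1 + norm x) ^ N) (\<lambda>(\<phi> :: 'a \<Rightarrow> complex) x. pderivs bs (A \<phi>) x)"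
    using assms unfolding scont_def by blast
  from bchoice[OF this] obtain C where "\<forall>bs\<in>?F. \<exists>K. \<forall>\<phi>. schwartz \<phi> \<longrightarrow>
        (\<forall>x. (1 + norm x) ^ N * norm (pderivs bs (A \<phi>) x) \<le> C bs * schwartz_seminorm K \<phi>)" by blast
  from bchoice[OF this] obtain K where CK: "\<And>bs \<phi> x. bs \<in> ?F \<Longrightarrow> schwartz \<phi> \<Longrightarrow>
        (1 + norm x) ^ N * norm (pderivs bs (A \<phi>) x) \<le> C bs * schwartz_seminorm (K bs) \<phi>"
    by blast
  let ?C = "\<Sum>bs\<in>?F. \<bar>C bs\<bar>" and ?K = "\<Sum>bs\<in>?F. K bs"
  show ?thesis
  proof (rule that[of ?C ?K])
    show "0 \<le> ?C" by (rule sum_nonneg) auto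
  next
    fix \<phi> :: "'a \<Rightarrow> complex" assume s: "schwartz \<phi>"
    show "schwartz_seminorm N (A \<phi>) \<le> ?C * schwartz_seminorm ?K \<phi>"
    proof (rule schwartz_seminorm_least)
      fix bs :: "'b list" and x :: 'b assume "bs \<in> lists Basis" "length bs \<le> N"
      then have bs: "bs \<in> ?F" by simp
      have K: "K bs \<le> ?K" by (rule member_le_sum[OF bs]) (auto simp: finite_short_lists)
      have C: "\<bar>C bs\<bar> \<le> ?C" by (rule member_le_sum[OF bs]) (auto simp: finite_short_lists)
      have "(1 + norm x) ^ N * norm (pderivs bs (A \<phi>) x) \<le> C bs * schwartz_seminorm (K bs) \<phi>"
        by (rule CK[OF bs s])
      also have "\<dots> \<le> \<bar>C bs\<bar> * schwartz_seminorm (K bs) \<phi>"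
        by (intro mult_right_mono schwartz_seminorm_nonneg s) simp
      also have "\<dots> \<le> ?C * schwartz_seminorm ?K \<phi>"
        by (intro mult_mono C schwartz_seminorm_mono s K schwartz_seminorm_nonneg) (auto intro: sum_nonneg)
      finally show "(1 + norm x) ^ N * norm (pderivs bs (A \<phi>) x) \<le> ?C * schwartz_seminorm ?K \<phi>" .
    qed
  qed
qed

lemma scontI:
  fixes A :: "('a::euclidean_space \<Rightarrow> complex) \<Rightarrow> ('b::euclidean_space \<Rightarrow> complex)"
  assumes "\<And>\<phi>. schwartz \<phi> \<Longrightarrow> smooth (A \<phi>)"
    and "\<And>bs M. bs \<in> lists Basis \<Longrightarrow> seminorm_bounded (\<lambda>x. (1 + norm x) ^ M) (\<lambda>\<phi> x. pderivs bs (A \<phi>) x)"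
  shows "scont A"
  using assms unfolding scont_def by blast

lemma scont_id: "scont (\<lambda>\<phi>. \<phi>)"
proof (rule scontI)
  fix bs M assume bs: "bs \<in> lists (Basis :: 'a set)"
  have "(1 + norm x) ^ M * norm (pderivs bs \<phi> x) \<le> 1 * schwartz_seminorm (M + length bs) \<phi>"
    if "schwartz \<phi>" for \<phi> :: "'a \<Rightarrow> complex" and x
  proof -
    have "(1 + norm x) ^ M * norm (pderivs bs \<phi> x) \<le> (1 + norm x) ^ (M + length bs) * norm (pderivs bs \<phi> x)"
      by (intro mult_right_mono power_increasing) auto
    also have "\<dots> \<le> schwartz_seminorm (M + length bs) \<phi>"
      using that bs by (intro schwartz_seminorm_upper) auto
    finally show ?thesis by simp
  qed
  then show "seminorm_bounded (\<lambda>x. (1 + norm x) ^ M) (\<lambda>\<phi> x. pderivs bs \<phi> x)" by blast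
qed (rule schwartz_smooth)

lemma scont_zero: "scont (\<lambda>\<phi> x. 0)"
  by (rule scontI) (auto simp: smooth_const pderivs_const intro!: exI[of _ 0])

lemma seminorm_bound_compose:
  assumes F: "seminorm_bounded r F"
    and B: "scont B"
  shows "seminorm_bounded r (\<lambda>\<phi> x. F (B \<phi>) x)"
proof -
  obtain C K where C: "\<And>\<phi> x. schwartz \<phi> \<Longrightarrow> r x * norm (F \<phi> x) \<le> C * schwartz_seminorm K \<phi>"
    using F by metis
  obtain D J where D: "D \<ge> 0" "\<And>\<phi>. schwartz \<phi> \<Longrightarrow> schwartz_seminorm K (B \<phi>) \<le> D * schwartz_seminorm J \<phi>"
    using scont_seminorm[OF B] by metis
  have "r x * norm (F (B \<phi>) x) \<le> (\<bar>C\<bar> * D) * schwartz_seminorm J \<phi>" if s: "schwartz \<phi>" for \<phi> x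
  proof -
    note sB = scont_schwartz[OF B s]
    have "r x * norm (F (B \<phi>) x) \<le> C * schwartz_seminorm K (B \<phi>)" by (rule C[OF sB])
    also have "\<dots> \<le> \<bar>C\<bar> * schwartz_seminorm K (B \<phi>)"
      by (intro mult_right_mono schwartz_seminorm_nonneg sB) simp
    also have "\<dots> \<le> \<bar>C\<bar> * (D * schwartz_seminorm J \<phi>)"
      by (intro mult_left_mono D s) simp
    finally show ?thesis by (simp add: mult.assoc)
  qed
  then show ?thesis by blast
qed

lemma scont_compose:
  assumes "scont A" "scont B"
  shows "scont (\<lambda>\<phi>. A (B \<phi>))"
proof (rule scontI)
  show "smooth (A (B \<phi>))" if "schwartz \<phi>" for \<phi>
    by (rule schwartz_smooth[OF scont_schwartz[OF assms(1) scont_schwartz[OF assms(2) that]]])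
next
  fix bs :: "'b list" and M assume bs: "bs \<in> lists Basis"
  have A: "seminorm_bounded (\<lambda>x. (1 + norm x) ^ M) (\<lambda>\<phi> x. pderivs bs (A \<phi>) x)"
    using assms(1) bs unfolding scont_def by blast
  show "seminorm_bounded (\<lambda>x. (1 + norm x) ^ M) (\<lambda>\<phi> x. pderivs bs (A (B \<phi>)) x)"
    using seminorm_bound_compose[OF A assms(2)] .
qed

lemma seminorm_bound_add:
  assumes 1: "seminorm_bounded r F"
    and 2: "seminorm_bounded r G"
    and r: "\<And>x. 0 \<le> r x"
  shows "seminorm_bounded r (\<lambda>\<phi> x. F \<phi> x + G \<phi> x :: complex)"
proof -
  obtain C K where C: "\<And>\<phi> x. schwartz \<phi> \<Longrightarrow> r x * norm (F \<phi> x) \<le> C * schwartz_seminorm K \<phi>"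
    using 1 by metis
  obtain D J where D: "\<And>\<phi> x. schwartz \<phi> \<Longrightarrow> r x * norm (G \<phi> x) \<le> D * schwartz_seminorm J \<phi>"
    using 2 by metis
  have "r x * norm (F \<phi> x + G \<phi> x) \<le> (\<bar>C\<bar> + \<bar>D\<bar>) * schwartz_seminorm (K + J) \<phi>"
    if s: "schwartz \<phi>" for \<phi> x
  proof -
    have "r x * norm (F \<phi> x + G \<phi> x) \<le> r x * norm (F \<phi> x) + r x * norm (G \<phi> x)"
      using mult_left_mono[OF norm_triangle_ineq[of "F \<phi> x" "G \<phi> x"] r[of x]] by (simp add: algebra_simps)
    also have "\<dots> \<le> \<bar>C\<bar> * schwartz_seminorm (K + J) \<phi> + \<bar>D\<bar> * schwartz_seminorm (K + J) \<phi>"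
    proof (intro add_mono)
      have "r x * norm (F \<phi> x) \<le> C * schwartz_seminorm K \<phi>" by (rule C[OF s])
      also have "\<dots> \<le> \<bar>C\<bar> * schwartz_seminorm (K + J) \<phi>"
        by (intro mult_mono schwartz_seminorm_mono s schwartz_seminorm_nonneg) auto
      finally show "r x * norm (F \<phi> x) \<le> \<bar>C\<bar> * schwartz_seminorm (K + J) \<phi>" .
      have "r x * norm (G \<phi> x) \<le> D * schwartz_seminorm J \<phi>" by (rule D[OF s])
      also have "\<dots> \<le> \<bar>D\<bar> * schwartz_seminorm (K + J) \<phi>"
        by (intro mult_mono schwartz_seminorm_mono s schwartz_seminorm_nonneg) auto
      finally show "r x * norm (G \<phi> x) \<le> \<bar>D\<bar> * schwartz_seminorm (K + J) \<phi>" .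
    qed
    finally show ?thesis by (simp add: algebra_simps)
  qed
  then show ?thesis by blast
qed

lemma scont_add:
  assumes "scont A" "scont B"
  shows "scont (\<lambda>\<phi> x. A \<phi> x + B \<phi> x)"
proof (rule scontI)
  show "smooth (\<lambda>x. A \<phi> x + B \<phi> x)" if "schwartz \<phi>" for \<phi>
    using assms that unfolding scont_def by (blast intro: smooth_add)
next
  fix bs :: "'b list" and M assume bs: "bs \<in> lists Basis"
  have "seminorm_bounded (\<lambda>x. (1 + norm x) ^ M) (\<lambda>\<phi> x. pderivs bs (A \<phi>) x + pderivs bs (B \<phi>) x)"
    using assms bs unfolding scont_def by (intro seminorm_bound_add) auto
  moreover have "pderivs bs (\<lambda>x. A \<phi> x + B \<phi> x) = (\<lambda>x. pderivs bs (A \<phi>) x + pderivs bs (B \<phi>) x)"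
    if "schwartz \<phi>" for \<phi>
    using assms bs that unfolding scont_def by (intro pderivs_add) auto
  ultimately show "seminorm_bounded (\<lambda>x. (1 + norm x) ^ M) (\<lambda>\<phi> x. pderivs bs (\<lambda>x. A \<phi> x + B \<phi> x) x)"
    by (simp cong: conj_cong imp_cong)
qed

lemma scont_cmult_id: "scont (\<lambda>\<phi> x. c * \<phi> x)"
proof (rule scontI)
  fix bs :: "'a list" and M assume bs: "bs \<in> lists Basis"
  obtain C K where CK: "\<And>\<phi> x. schwartz \<phi> \<Longrightarrow>
        (1 + norm x) ^ M * norm (pderivs bs \<phi> x) \<le> C * schwartz_seminorm K \<phi>"
    using scont_id bs unfolding scont_def by metis
  have "(1 + norm x) ^ M * norm (pderivs bs (\<lambda>x. c * \<phi> x) x) \<le> (norm c * C) * schwartz_seminorm K \<phi>"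
    if s: "schwartz \<phi>" for \<phi> x
    using mult_left_mono[OF CK[OF s, of x], of "norm c"] s bs
    by (simp add: pderivs_cmult schwartz_smooth norm_mult algebra_simps)
  then show "seminorm_bounded (\<lambda>x. (1 + norm x) ^ M) (\<lambda>\<phi> x. pderivs bs (\<lambda>x. c * \<phi> x) x)"
    by blast
qed (auto intro: smooth_cmult schwartz_smooth)

lemma scont_cmult: "scont A \<Longrightarrow> scont (\<lambda>\<phi> x. c * A \<phi> x)"
  using scont_compose[OF scont_cmult_id] .

lemma scont_sum: "(\<And>i. i \<in> I \<Longrightarrow> scont (A i)) \<Longrightarrow> scont (\<lambda>\<phi> x. \<Sum>i\<in>I. A i \<phi> x)"
  by (induction I rule: infinite_finite_induct) (simp_all add: scont_zero scont_add)

lemma scont_pdir: "b \<in> Basis \<Longrightarrow> scont (pdir b)"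
proof (rule scontI)
  fix bs :: "'a list" and M assume bs: "bs \<in> lists Basis" and b: "b \<in> Basis"
  then have "bs @ [b] \<in> lists Basis" by auto
  then show "seminorm_bounded (\<lambda>x. (1 + norm x) ^ M) (\<lambda>\<phi> x. pderivs bs (pdir b \<phi>) x)"
    using scont_id unfolding scont_def pderivs_snoc[symmetric] by metis
qed (auto intro: smooth_pdir schwartz_smooth)

text \<open>The main tool for continuity on Schwartz space.  If differentiating \<open>A \<phi>\<close> leads to members of the
same family applied to continuous images of \<open>\<phi>\<close>, only weighted bounds for the functions \<open>A \<phi>\<close>
themselves are left to show: peeling off the innermost derivative turns a bound of order \<open>n + 1\<close> into
two bounds of order \<open>n\<close>.  Two summands suffice for the product rule.\<close>

lemma scont_family:
  fixes \<A> :: "(('a::euclidean_space \<Rightarrow> complex) \<Rightarrow> ('b::euclidean_space \<Rightarrow> complex)) set"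
  assumes "A \<in> \<A>"
    and bound: "\<And>A M. A \<in> \<A> \<Longrightarrow> seminorm_bounded (\<lambda>x. (1 + norm x) ^ M) A"
    and diff: "\<And>A \<phi> x. A \<in> \<A> \<Longrightarrow> schwartz \<phi> \<Longrightarrow> A \<phi> differentiable (at x)"
    and step: "\<And>A b. A \<in> \<A> \<Longrightarrow> b \<in> Basis \<Longrightarrow> \<exists>A1\<in>\<A>. \<exists>A2\<in>\<A>. \<exists>B1 B2. scont B1 \<and> scont B2 \<and>
        (\<forall>\<phi>. schwartz \<phi> \<longrightarrow> pdir b (A \<phi>) = (\<lambda>x. A1 (B1 \<phi>) x + A2 (B2 \<phi>) x))"
  shows "scont A"
proof -
  let ?\<S> = "{A \<phi> | A \<phi>. A \<in> \<A> \<and> schwartz \<phi>}"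
  have sm: "smooth (A \<phi>)" if "A \<in> \<A>" "schwartz \<phi>" for A \<phi>
  proof (rule smooth_family[where \<S> = "?\<S>"])
    show "A \<phi> \<in> ?\<S>" using that by blast
  next
    fix g x assume "g \<in> ?\<S>"
    then show "g differentiable at x" using diff by blast
  next
    fix g and b :: 'b assume "g \<in> ?\<S>" and b: "b \<in> Basis"
    then obtain A \<phi> where g: "g = A \<phi>" "A \<in> \<A>" "schwartz \<phi>" by blast
    obtain A1 A2 B1 B2 where A: "A1 \<in> \<A>" "A2 \<in> \<A>" "scont B1" "scont B2"
      "pdir b (A \<phi>) = (\<lambda>x. A1 (B1 \<phi>) x + A2 (B2 \<phi>) x)" using step[OF g(2) b] g(3) by blast
    with g(3) show "\<exists>g1\<in>?\<S>. \<exists>g2\<in>?\<S>.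
        pdir b g = (\<lambda>x. g1 x + g2 x)"
      unfolding g(1) using scont_schwartz by blast
  qed
  have 2: "seminorm_bounded (\<lambda>x. (1 + norm x) ^ M) (\<lambda>\<phi> x. pderivs bs (A \<phi>) x)"
    if "bs \<in> lists (Basis :: 'b set)" "A \<in> \<A>" for bs A M
    using that
  proof (induction bs arbitrary: A rule: rev_induct)
    case Nil
    then show ?case using bound by simp
  next
    case (snoc b bs)
    then have bs: "bs \<in> lists Basis" "b \<in> Basis" by auto
    obtain A1 A2 B1 B2 where A: "A1 \<in> \<A>" "A2 \<in> \<A>" "scont B1" "scont B2"
      and e: "\<And>\<phi>. schwartz \<phi> \<Longrightarrow> pdir b (A \<phi>) = (\<lambda>x. A1 (B1 \<phi>) x + A2 (B2 \<phi>) x)"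
      using step[OF snoc.prems(2) bs(2)] by blast
    have *: "seminorm_bounded (\<lambda>x. (1 + norm x) ^ M) (\<lambda>\<phi> x. pderivs bs (A (B \<phi>)) x)"
      if A: "A \<in> \<A>" and B: "scont B" for A and B :: "('a \<Rightarrow> complex) \<Rightarrow> ('a \<Rightarrow> complex)"
      using seminorm_bound_compose[OF snoc.IH[OF bs(1) A] B] .
    have "seminorm_bounded (\<lambda>x. (1 + norm x) ^ M) (\<lambda>\<phi> x. pderivs bs (A1 (B1 \<phi>)) x + pderivs bs (A2 (B2 \<phi>)) x)"
      using A by (intro seminorm_bound_add *) auto
    moreover have "pderivs (bs @ [b]) (A \<phi>) = (\<lambda>x. pderivs bs (A1 (B1 \<phi>)) x + pderivs bs (A2 (B2 \<phi>)) x)"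
      if "schwartz \<phi>" for \<phi>
      using pderivs_add[OF sm sm bs(1), of A1 "B1 \<phi>" A2 "B2 \<phi>"] A that
      by (simp add: pderivs_snoc e scont_schwartz)
    ultimately show ?case by (simp cong: imp_cong)
  qed
  show ?thesis using sm 2 assms(1) by (intro scontI) auto
qed

text \<open>The transpose of a continuous operator preserves tempered distributions.  Linearity is required only
on Schwartz functions, as for tempered distributions.\<close>

lemma tempered_distribution_compose:
  assumes T: "tempered_distribution T" and A: "scont A"
    and add: "\<And>\<phi> \<psi>. schwartz \<phi> \<Longrightarrow> schwartz \<psi> \<Longrightarrow> A (\<lambda>x. \<phi> x + \<psi> x) = (\<lambda>x. A \<phi> x + A \<psi> x)"
    and cm: "\<And>c \<phi>. schwartz \<phi> \<Longrightarrow> A (\<lambda>x. c * \<phi> x) = (\<lambda>x. c * A \<phi> x)"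
  shows "tempered_distribution (\<lambda>\<phi>. T (A \<phi>))"
proof -
  obtain C N where CN: "\<And>\<phi>. schwartz \<phi> \<Longrightarrow> norm (T \<phi>) \<le> C * schwartz_seminorm N \<phi>"
    using T unfolding tempered_distribution_def by blast
  obtain D J where D: "D \<ge> 0" "\<And>\<phi>. schwartz \<phi> \<Longrightarrow> schwartz_seminorm N (A \<phi>) \<le> D * schwartz_seminorm J \<phi>"
    using scont_seminorm[OF A] by metis
  have "norm (T (A \<phi>)) \<le> (\<bar>C\<bar> * D) * schwartz_seminorm J \<phi>" if s: "schwartz \<phi>" for \<phi>
  proof -
    note sA = scont_schwartz[OF A s]
    have "norm (T (A \<phi>)) \<le> C * schwartz_seminorm N (A \<phi>)" by (rule CN[OF sA])
    also have "\<dots> \<le> \<bar>C\<bar> * schwartz_seminorm N (A \<phi>)"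
      by (intro mult_right_mono schwartz_seminorm_nonneg sA) simp
    also have "\<dots> \<le> \<bar>C\<bar> * (D * schwartz_seminorm J \<phi>)"
      by (intro mult_left_mono D s) simp
    finally show ?thesis by (simp add: mult.assoc)
  qed
  moreover have "T (A (\<lambda>x. \<phi> x + \<psi> x)) = T (A \<phi>) + T (A \<psi>)" if "schwartz \<phi>" "schwartz \<psi>" for \<phi> \<psi>
    using T that unfolding tempered_distribution_def by (simp add: add scont_schwartz[OF A])
  moreover have "T (A (\<lambda>x. c * \<phi> x)) = c * T (A \<phi>)" if "schwartz \<phi>" for c \<phi>
    using T that unfolding tempered_distribution_def by (simp add: cm scont_schwartz[OF A])
  ultimately show ?thesis unfolding tempered_distribution_def by blast
qed

lemma scont_cong:
  assumes "scont A" "\<And>\<phi>. schwartz \<phi> \<Longrightarrow> A \<phi> = B \<phi>"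
  shows "scont B"
  using assms unfolding scont_def by (simp cong: imp_cong)

lemma pdir_expand:
  assumes "\<And>x. f differentiable (at x)"
  shows "pdir v f = (\<lambda>x. \<Sum>b\<in>Basis. of_real (v \<bullet> b) * pdir b f x)"
  using pdir_eqI[OF has_derivative_pdir_Basis[OF assms], of v] by (simp only: scaleR_conv_of_real)

lemma scont_pdir_any: "scont (pdir v)"
proof (rule scont_cong)
  show "scont (\<lambda>\<phi> x. \<Sum>b\<in>Basis. of_real (v \<bullet> b) * pdir b \<phi> x)"
    by (intro scont_sum scont_cmult scont_pdir)
qed (rule pdir_expand[symmetric], rule schwartz_differentiable)

lemma schwartz_pdir_any: "schwartz f \<Longrightarrow> schwartz (pdir v f)"
  by (rule scont_schwartz[OF scont_pdir_any])

lemma pdir_affine: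
  assumes f: "\<And>x. f differentiable (at x)" and l: "bounded_linear l"
  shows "pdir b (\<lambda>x. f (l x + c)) = (\<lambda>x. pdir (l b) f (l x + c))"
proof -
  have "((\<lambda>x. f (l x + c)) has_derivative (\<lambda>v. frechet_derivative f (at (l x + c)) (l v))) (at x)" for x
  proof (rule has_derivative_compose[of "\<lambda>x. l x + c" l])
    show "((\<lambda>x. l x + c) has_derivative l) (at x)"
      using has_derivative_add[OF bounded_linear_imp_has_derivative[OF l] has_derivative_const] by simp
    show "(f has_derivative frechet_derivative f (at (l x + c))) (at (l x + c))"
      using f frechet_derivative_works by blast
  qed
  from pdir_eqI[OF this, of b] show ?thesis unfolding pdir_def .
qed

lemma differentiable_affine:
  assumes f: "\<And>x. f differentiable (at x)" and l: "bounded_linear l"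
  shows "(\<lambda>x. f (l x + c)) differentiable (at x)"
  using l f by (intro differentiable_compose[of f "\<lambda>x. l x + c"] differentiable_add)
    (auto intro: bounded_linear_imp_differentiable)

lemma schwartz_seminorm_bound: "schwartz \<phi> \<Longrightarrow> (1 + norm x) ^ M * norm (\<phi> x) \<le> schwartz_seminorm M \<phi>"
  using schwartz_seminorm_upper[of \<phi> "[]" M x] by simp

text \<open>The case of a family with one member and one summand; the zero operator fills the second place.\<close>

lemma scont_single:
  fixes A :: "('a::euclidean_space \<Rightarrow> complex) \<Rightarrow> ('b::euclidean_space \<Rightarrow> complex)"
  assumes bound: "\<And>M. seminorm_bounded (\<lambda>x. (1 + norm x) ^ M) A"
    and diff: "\<And>\<phi> x. schwartz \<phi> \<Longrightarrow> A \<phi> differentiable (at x)"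
    and step: "\<And>b. b \<in> Basis \<Longrightarrow> \<exists>B. scont B \<and> (\<forall>\<phi>. schwartz \<phi> \<longrightarrow> pdir b (A \<phi>) = A (B \<phi>))"
  shows "scont A"
proof (rule scont_family[where \<A> = "{A, \<lambda>\<phi> x. 0}"])
  show "seminorm_bounded (\<lambda>x. (1 + norm x) ^ M) A'"
    if "A' \<in> {A, \<lambda>\<phi> x. 0}" for A' M
  proof (cases "A' = A")
    case True then show ?thesis using bound[of M] by simp
  next
    case False then show ?thesis using that by (auto intro!: exI[of _ 0])
  qed
  show "A' \<phi> differentiable (at x)" if "A' \<in> {A, \<lambda>\<phi> x. 0}" "schwartz \<phi>" for A' \<phi> x
    using that diff by auto
next
  fix A' and b :: 'b assume A': "A' \<in> {A, \<lambda>\<phi> x. 0}" and b: "b \<in> Basis"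
  obtain B where B: "scont B" "\<And>\<phi>. schwartz \<phi> \<Longrightarrow> pdir b (A \<phi>) = A (B \<phi>)"
    using step[OF b] by blast
  have "\<exists>A1\<in>{A, \<lambda>\<phi> x. 0}. \<forall>\<phi>. schwartz \<phi> \<longrightarrow> pdir b (A' \<phi>) = (\<lambda>x. A1 (B \<phi>) x + 0)"
    using A' B by (auto simp: pdir_const)
  then show "\<exists>A1\<in>{A, \<lambda>\<phi> x. 0}. \<exists>A2\<in>{A, \<lambda>\<phi> x. 0}. \<exists>B1 B2. scont B1 \<and> scont B2 \<and>
      (\<forall>\<phi>. schwartz \<phi> \<longrightarrow> pdir b (A' \<phi>) = (\<lambda>x. A1 (B1 \<phi>) x + A2 (B2 \<phi>) x))"
    using B(1) by fastforce
qed simp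

text \<open>An affine change of variables is continuous as soon as its linear part has a linear left inverse: then
the weight at \<open>x\<close> is controlled by the weight at \<open>l x + c\<close>.  Not only invertible maps but also
restrictions to affine subspaces are of this kind.\<close>

lemma scont_affine:
  fixes l :: "'b::euclidean_space \<Rightarrow> 'a::euclidean_space"
  assumes l: "bounded_linear l" and l': "bounded_linear l'" and inv: "\<And>x. l' (l x) = x"
  shows "scont (\<lambda>\<phi> x. \<phi> (l x + c))"
proof (rule scont_single)
  fix M
  obtain K where K: "K \<ge> 0" "\<And>x. norm (l' x) \<le> norm x * K"
    using bounded_linear.nonneg_bounded[OF l'] by blast
  define D where "D = 1 + K * (1 + norm c)"
  have D: "1 + norm x \<le> D * (1 + norm (l x + c))" for x
  proof -
    have "norm x \<le> norm (l x) * K" using K(2)[of "l x"] inv by simp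
    also have "\<dots> \<le> (norm (l x + c) + norm c) * K"
      using norm_triangle_ineq[of "l x + c" "- c"] K by (intro mult_right_mono) auto
    also have "\<dots> \<le> K * (1 + norm c) * (1 + norm (l x + c))"
    proof -
      have "0 \<le> K * (1 + norm c * norm (l x + c))" using K by simp
      then show ?thesis by (simp add: algebra_simps)
    qed
    finally show ?thesis unfolding D_def using norm_ge_zero[of "l x + c"]
      by (simp only: distrib_right mult_1_left)
  qed
  have "(1 + norm x) ^ M * norm (\<phi> (l x + c)) \<le> D ^ M * schwartz_seminorm M \<phi>"
    if "schwartz \<phi>" for \<phi> :: "'a \<Rightarrow> complex" and x
  proof -
    have "(1 + norm x) ^ M \<le> D ^ M * (1 + norm (l x + c)) ^ M"
      unfolding power_mult_distrib[symmetric] using D by (intro power_mono) auto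
    then have "(1 + norm x) ^ M * norm (\<phi> (l x + c)) \<le> (D ^ M * (1 + norm (l x + c)) ^ M) * norm (\<phi> (l x + c))"
      by (intro mult_right_mono) auto
    also have "\<dots> = D ^ M * ((1 + norm (l x + c)) ^ M * norm (\<phi> (l x + c)))" by simp
    also have "\<dots> \<le> D ^ M * schwartz_seminorm M \<phi>"
      using K by (intro mult_left_mono schwartz_seminorm_bound that) (simp add: D_def)
    finally show ?thesis .
  qed
  then show "seminorm_bounded (\<lambda>x. (1 + norm x) ^ M) (\<lambda>(\<phi> :: 'a \<Rightarrow> complex) x. \<phi> (l x + c))" by blast
next
  show "(\<lambda>x. \<phi> (l x + c)) differentiable at x" if "schwartz \<phi>" for \<phi> :: "'a \<Rightarrow> complex" and x
    using that l by (intro differentiable_affine schwartz_differentiable)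
next
  fix b :: 'b
  show "\<exists>B. scont B \<and> (\<forall>\<phi> :: 'a \<Rightarrow> complex. schwartz \<phi> \<longrightarrow>
      pdir b (\<lambda>x. \<phi> (l x + c)) = (\<lambda>x. B \<phi> (l x + c)))"
    using scont_pdir_any[of "l b"] pdir_affine[OF schwartz_differentiable l] by blast
qed

lemma scont_slice: "scont (\<lambda>\<Theta> a. \<Theta> (x, a))"
  using scont_affine[of "\<lambda>a. (0, a)" snd "(x, 0)"]
  by (simp add: bounded_linear_Pair bounded_linear_zero bounded_linear_ident bounded_linear_snd)

lemma pderivs_slice:
  assumes "schwartz \<Theta>" "bs \<in> lists Basis"
  shows "pderivs bs (\<lambda>a. \<Theta> (x, a)) = (\<lambda>a. pderivs (map (Pair 0) bs) \<Theta> (x, a))"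
  using assms(2)
proof (induction bs)
  case (Cons b bs)
  then have bs: "map (Pair 0) bs \<in> lists (Basis :: ('a \<times> 'b) set)" by (auto simp: Basis_prod_def)
  have "pdir b (\<lambda>a. pderivs (map (Pair 0) bs) \<Theta> ((0, a) + (x, 0)))
     = (\<lambda>a. pdir (0, b) (pderivs (map (Pair 0) bs) \<Theta>) ((0, a) + (x, 0)))"
    using assms(1) bs by (intro pdir_affine schwartz_differentiable schwartz_pderivs
       bounded_linear_Pair bounded_linear_zero bounded_linear_ident)
  with Cons show ?case unfolding list.map pderivs_Cons_pdir by simp
qed simp

section \<open>Slowly increasing multipliers\<close>

text \<open>The smooth functions of polynomial growth with all derivatives, also known as slowly increasing
functions: they are the multipliers of Schwartz space.\<close>

definition slow :: "('a::euclidean_space \<Rightarrow> complex) \<Rightarrow> bool" where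
  "slow m \<longleftrightarrow> smooth m \<and>
     (\<forall>bs\<in>lists Basis. \<exists>C N. \<forall>x. norm (pderivs bs m x) \<le> C * (1 + norm x) ^ N)"

lemma slow_smooth: "slow m \<Longrightarrow> smooth m"
  by (simp add: slow_def)

lemma slow_differentiable: "slow m \<Longrightarrow> m differentiable (at x)"
  by (simp add: slow_smooth smooth_differentiable)

lemma slow_pderivs: "slow m \<Longrightarrow> bs \<in> lists Basis \<Longrightarrow> slow (pderivs bs m)"
  unfolding slow_def by (metis append_in_lists_conv pderivs_append smooth_pderivs)

lemma slow_pdir: "slow m \<Longrightarrow> b \<in> Basis \<Longrightarrow> slow (pdir b m)"
  using slow_pderivs[of m "[b]"] by (simp add: pdir_def)

lemma slow_bound:
  assumes "slow m"
  obtains C N where "C \<ge> 0" "\<And>x. norm (m x) \<le> C * (1 + norm x) ^ N"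
proof -
  obtain C N where C: "\<And>x. norm (pderivs [] m x) \<le> C * (1 + norm x) ^ N"
    using assms unfolding slow_def by (metis lists.Nil)
  have "norm (m x) \<le> \<bar>C\<bar> * (1 + norm x) ^ N" for x
    using C[of x] by (simp add: order_trans[OF _ mult_right_mono[OF abs_ge_self]])
  then show ?thesis by (rule that[rotated]) simp
qed

lemma poly_bound_add:
  assumes "\<exists>C N. \<forall>x. norm (f x) \<le> C * (1 + norm x) ^ N" "\<exists>C N. \<forall>x. norm (g x) \<le> C * (1 + norm x) ^ N"
  shows "\<exists>C N. \<forall>x. norm (f x + g x :: complex) \<le> C * (1 + norm x) ^ N"
proof -
  obtain C N where C: "\<And>x. norm (f x) \<le> C * (1 + norm x) ^ N" using assms by blast
  obtain D M where D: "\<And>x. norm (g x) \<le> D * (1 + norm x) ^ M" using assms by blast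
  have "norm (f x + g x) \<le> (\<bar>C\<bar> + \<bar>D\<bar>) * (1 + norm x) ^ (N + M)" for x
  proof -
    have "norm (f x) \<le> C * (1 + norm x) ^ N" by (rule C)
    also have "\<dots> \<le> \<bar>C\<bar> * (1 + norm x) ^ (N + M)"
      by (intro mult_mono power_increasing) auto
    finally have 1: "norm (f x) \<le> \<bar>C\<bar> * (1 + norm x) ^ (N + M)" .
    have "norm (g x) \<le> D * (1 + norm x) ^ M" by (rule D)
    also have "\<dots> \<le> \<bar>D\<bar> * (1 + norm x) ^ (N + M)"
      by (intro mult_mono power_increasing) auto
    finally have 2: "norm (g x) \<le> \<bar>D\<bar> * (1 + norm x) ^ (N + M)" .
    from norm_triangle_ineq[of "f x" "g x"] 1 2 show ?thesis by (simp add: algebra_simps)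
  qed
  then show ?thesis by blast
qed

lemma slow_add: "slow f \<Longrightarrow> slow g \<Longrightarrow> slow (\<lambda>x. f x + g x)"
  unfolding slow_def by (simp add: pderivs_add smooth_add poly_bound_add)

lemma slow_const: "slow (\<lambda>x. c)"
proof -
  have "norm (pderivs bs (\<lambda>x. c) x) \<le> norm c * (1 + norm x) ^ 0" for bs and x :: 'a
    by (simp add: pderivs_const)
  then show ?thesis unfolding slow_def using smooth_const by blast
qed

lemma smooth_mult:
  fixes f g :: "'a::euclidean_space \<Rightarrow> complex"
  assumes "smooth f" "smooth g"
  shows "smooth (\<lambda>x. f x * g x)"
proof -
  let ?\<S> = "{\<lambda>x :: 'a. f x * g x | f g :: 'a \<Rightarrow> complex. smooth f \<and> smooth g}"
  show ?thesis
  proof (rule smooth_family[where \<S> = "?\<S>"])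
    fix h x assume "h \<in> ?\<S>"
    then show "h differentiable at x"
      by (auto intro!: differentiable_mult dest: smooth_differentiable)
  next
    fix h :: "'a \<Rightarrow> complex" and b :: 'a
    assume "h \<in> ?\<S>" and b: "b \<in> Basis"
    then obtain f g where h: "h = (\<lambda>x. f x * g x)" "smooth f" "smooth g" by blast
    have "(\<lambda>x. pdir b f x * g x) \<in> ?\<S>"
      "(\<lambda>x. f x * pdir b g x) \<in> ?\<S>"
      using smooth_pdir[OF h(2) b] smooth_pdir[OF h(3) b] h by blast+
    moreover have "pdir b h = (\<lambda>x. pdir b f x * g x + f x * pdir b g x)"
      unfolding h(1) by (intro pdir_mult smooth_differentiable h)
    ultimately show "\<exists>g1\<in>?\<S>.
        \<exists>g2\<in>?\<S>. pdir b h = (\<lambda>x. g1 x + g2 x)"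
      by (intro bexI[of _ "\<lambda>x. pdir b f x * g x"] bexI[of _ "\<lambda>x. f x * pdir b g x"])
  next
    show "(\<lambda>x. f x * g x) \<in> ?\<S>" using assms by blast
  qed
qed

lemma slow_mult:
  assumes "slow f" "slow g"
  shows "slow (\<lambda>x. f x * g x)"
proof -
  have "\<exists>C N. \<forall>x. norm (pderivs bs (\<lambda>x. f x * g x) x) \<le> C * (1 + norm x) ^ N"
    if "bs \<in> lists Basis" "slow f" "slow g" for bs and f g :: "'a \<Rightarrow> complex"
    using that
  proof (induction bs arbitrary: f g rule: rev_induct)
    case Nil
    obtain C N where C: "C \<ge> 0" "\<And>x. norm (f x) \<le> C * (1 + norm x) ^ N"
      using slow_bound[OF Nil(2)] by blast
    obtain D M where D: "D \<ge> 0" "\<And>x. norm (g x) \<le> D * (1 + norm x) ^ M"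
      using slow_bound[OF Nil(3)] by blast
    have "norm (f x * g x) \<le> (C * D) * (1 + norm x) ^ (N + M)" for x
    proof -
      have "norm (f x) * norm (g x) \<le> (C * (1 + norm x) ^ N) * (D * (1 + norm x) ^ M)"
        using C D by (intro mult_mono) auto
      then show ?thesis by (simp add: norm_mult power_add algebra_simps)
    qed
    then show ?case by auto
  next
    case (snoc b bs)
    then have bs: "bs \<in> lists Basis" "b \<in> Basis" by auto
    have "pderivs (bs @ [b]) (\<lambda>x. f x * g x)
        = (\<lambda>x. pderivs bs (\<lambda>x. pdir b f x * g x) x + pderivs bs (\<lambda>x. f x * pdir b g x) x)"
      using snoc.prems bs unfolding pderivs_snoc
      by (simp add: pdir_mult slow_differentiable pderivs_add smooth_mult slow_smooth smooth_pdir)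
    then show ?case
      using snoc.IH[OF bs(1) slow_pdir[OF snoc.prems(2) bs(2)] snoc.prems(3)]
        snoc.IH[OF bs(1) snoc.prems(2) slow_pdir[OF snoc.prems(3) bs(2)]]
      by (simp only:) (rule poly_bound_add)
  qed
  then show ?thesis using assms unfolding slow_def[of "\<lambda>x. f x * g x"]
    by (auto intro: smooth_mult slow_smooth)
qed

lemma slow_inner: "slow (\<lambda>x. of_real (x \<bullet> c))"
proof -
  have d: "((\<lambda>x. complex_of_real (x \<bullet> c)) has_derivative (\<lambda>v. of_real (v \<bullet> c))) (at x)" for x
    by (auto intro!: derivative_eq_intros)
  have p: "pderivs (b # bs) (\<lambda>x. complex_of_real (x \<bullet> c)) =
      (\<lambda>x. if bs = [] then of_real (b \<bullet> c) else 0)" for b bs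
  proof (induction bs arbitrary: b)
    case Nil show ?case unfolding pderivs_Cons_pdir using pdir_eqI[OF d] by simp
  next
    case (Cons b' bs)
    show ?case unfolding pderivs_Cons_pdir[of b] Cons by (auto simp: pdir_const)
  qed
  show ?thesis unfolding slow_def smooth_def
  proof (intro conjI ballI allI)
    show "pderivs bs (\<lambda>x. complex_of_real (x \<bullet> c)) differentiable at x" for bs x
      using d by (cases bs) (auto simp: p differentiable_def simp del: pderivs.simps(2))
  next
    fix bs :: "'a list"
    have "norm (pderivs bs (\<lambda>x. complex_of_real (x \<bullet> c)) x) \<le> (norm c + norm (hd bs \<bullet> c)) * (1 + norm x) ^ 1" for x
    proof (cases bs)
      case Nil
      have "\<bar>x \<bullet> c\<bar> \<le> norm x * norm c" by (rule Cauchy_Schwarz_ineq2)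
      also have "\<dots> \<le> (norm c + norm (hd bs \<bullet> c)) * (1 + norm x)"
        by (simp add: algebra_simps)
      finally show ?thesis using Nil by simp
    next
      case (Cons b cs)
      have "norm (b \<bullet> c) \<le> (norm c + norm (b \<bullet> c)) * (1 + norm x)" by (simp add: algebra_simps)
      then show ?thesis by (simp add: Cons p del: pderivs.simps(2))
    qed
    then show "\<exists>C N. \<forall>x. norm (pderivs bs (\<lambda>x. complex_of_real (x \<bullet> c)) x) \<le> C * (1 + norm x) ^ N" by blast
  qed
qed

lemma slow_cmult: "slow f \<Longrightarrow> slow (\<lambda>x. c * f x)"
  by (intro slow_mult slow_const)

lemma schwartz_slow: "schwartz f \<Longrightarrow> slow f"
  unfolding schwartz_def slow_def by (metis mult.right_neutral power_0 mult.left_neutral)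

lemma scont_mult_slow:
  assumes "slow m"
  shows "scont (\<lambda>\<phi> x :: 'a::euclidean_space. m x * \<phi> x)"
proof -
  let ?\<S> = "{\<lambda>(\<phi> :: 'a \<Rightarrow> complex) x. m x * \<phi> x | m. slow m}"
  show ?thesis
  proof (rule scont_family[where \<A> = "?\<S>"])
    fix A :: "('a \<Rightarrow> complex) \<Rightarrow> 'a \<Rightarrow> complex" and M
    assume "A \<in> ?\<S>"
    then obtain m where m: "slow m" "A = (\<lambda>\<phi> x. m x * \<phi> x)" by blast
    obtain C N where C: "C \<ge> 0" "\<And>x. norm (m x) \<le> C * (1 + norm x) ^ N"
      using slow_bound[OF m(1)] by blast
    have "(1 + norm x) ^ M * norm (m x * \<phi> x) \<le> C * schwartz_seminorm (N + M) \<phi>"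
      if "schwartz \<phi>" for \<phi> and x :: 'a
    proof -
      have "norm (m x) * ((1 + norm x) ^ M * norm (\<phi> x)) \<le> C * (1 + norm x) ^ N * ((1 + norm x) ^ M * norm (\<phi> x))"
        by (intro mult_right_mono C) auto
      also have "\<dots> = C * ((1 + norm x) ^ (N + M) * norm (\<phi> x))" by (simp add: power_add)
      also have "\<dots> \<le> C * schwartz_seminorm (N + M) \<phi>"
        by (intro mult_left_mono schwartz_seminorm_bound that C)
      finally show ?thesis by (simp add: norm_mult algebra_simps)
    qed
    then show "seminorm_bounded (\<lambda>x. (1 + norm x) ^ M) A"
      unfolding m(2) by blast
  next
    fix A and \<phi> :: "'a \<Rightarrow> complex" and x :: 'a assume "A \<in> ?\<S>" "schwartz \<phi>"
    then show "A \<phi> differentiable at x"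
      by clarsimp (intro differentiable_mult; blast intro: schwartz_differentiable slow_differentiable)
  next
    fix A and b :: 'a assume A: "A \<in> ?\<S>" and b: "b \<in> Basis"
    then obtain m where m: "slow m" "A = (\<lambda>\<phi> x. m x * \<phi> x)" by blast
    have "(\<lambda>\<phi> x. pdir b m x * \<phi> x) \<in> ?\<S>"
      using slow_pdir[OF m(1) b] by blast
    moreover have "pdir b (A \<phi>) = (\<lambda>x. pdir b m x * \<phi> x + A (pdir b \<phi>) x)" if "schwartz \<phi>" for \<phi>
      using that m by (simp add: pdir_mult schwartz_differentiable slow_differentiable)
    ultimately show "\<exists>A1\<in>?\<S>.
        \<exists>A2\<in>?\<S>. \<exists>B1 B2. scont B1 \<and> scont B2 \<and>
          (\<forall>\<phi>. schwartz \<phi> \<longrightarrow> pdir b (A \<phi>) = (\<lambda>x. A1 (B1 \<phi>) x + A2 (B2 \<phi>) x))"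
      using scont_id scont_pdir[OF b]
      by (intro bexI[OF _ A] bexI[of _ "\<lambda>\<phi> x. pdir b m x * \<phi> x"] exI[of _ "\<lambda>\<phi>. \<phi>"] exI[of _ "pdir b"]) auto
  qed (use assms in blast)
qed

lemma schwartz_mult_slow: "slow m \<Longrightarrow> schwartz f \<Longrightarrow> schwartz (\<lambda>x. m x * f x)"
  by (rule scont_schwartz[OF scont_mult_slow])

text \<open>Functions such as \<open>exp (\<i> q)\<close> and \<open>exp (- q)\<close> with a quadratic form \<open>q\<close>: each derivative is again a
multiple of the function by a slowly increasing factor.  Hence their growth or decay is that of the
function itself.\<close>

lemma pderivs_exponential_type:
  assumes E: "\<And>x. E differentiable (at x)"
    and s: "\<And>b. b \<in> Basis \<Longrightarrow> slow (s b) \<and> pdir b E = (\<lambda>x. s b x * E x)"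
    and bs: "bs \<in> lists Basis"
  shows "\<exists>r. slow r \<and> pderivs bs E = (\<lambda>x. r x * E x)"
  using bs
proof (induction bs)
  case Nil
  then show ?case by (intro exI[of _ "\<lambda>x. 1"]) (simp add: slow_const)
next
  case (Cons b bs)
  then obtain r where r: "slow r" "pderivs bs E = (\<lambda>x. r x * E x)" and b: "b \<in> Basis" by auto
  have "pderivs (b # bs) E = (\<lambda>x. (pdir b r x + r x * s b x) * E x)"
    unfolding pderivs_Cons_pdir r(2) using s[OF b]
    by (simp add: pdir_mult slow_differentiable r E algebra_simps)
  moreover have "slow (\<lambda>x. pdir b r x + r x * s b x)"
    using s[OF b] r b by (intro slow_add slow_mult slow_pdir) auto
  ultimately show ?case by blast
qed

lemma smooth_exponential_type:
  assumes E: "\<And>x. E differentiable (at x)"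
    and s: "\<And>b. b \<in> Basis \<Longrightarrow> slow (s b) \<and> pdir b E = (\<lambda>x. s b x * E x)"
  shows "smooth E"
proof (rule smoothI)
  fix bs x assume "bs \<in> lists (Basis :: 'a set)"
  then obtain r where "slow r" "pderivs bs E = (\<lambda>x. r x * E x)"
    using pderivs_exponential_type[OF assms] by blast
  then show "pderivs bs E differentiable at x"
    by (simp add: differentiable_mult slow_differentiable E)
qed

lemma slow_exponential_type:
  assumes E: "\<And>x. E differentiable (at x)"
    and s: "\<And>b. b \<in> Basis \<Longrightarrow> slow (s b) \<and> pdir b E = (\<lambda>x. s b x * E x)"
    and le: "\<And>x. norm (E x) \<le> 1"
  shows "slow E"
  unfolding slow_def
proof (intro conjI ballI)
  show "smooth E" by (rule smooth_exponential_type[OF E s])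
next
  fix bs assume "bs \<in> lists (Basis :: 'a set)"
  then obtain r where r: "slow r" "pderivs bs E = (\<lambda>x. r x * E x)"
    using pderivs_exponential_type[OF E s] by blast
  obtain C N where C: "\<And>x. norm (r x) \<le> C * (1 + norm x) ^ N" using slow_bound[OF r(1)] by blast
  have "norm (pderivs bs E x) \<le> C * (1 + norm x) ^ N" for x
    using mult_mono[OF C[of x] le[of x]] C[of x] unfolding r(2)
    by (simp add: norm_mult order_trans[OF norm_ge_zero])
  then show "\<exists>C N. \<forall>x. norm (pderivs bs E x) \<le> C * (1 + norm x) ^ N" by blast
qed

lemma schwartz_exponential_type:
  assumes E: "\<And>x. E differentiable (at x)"
    and s: "\<And>b. b \<in> Basis \<Longrightarrow> slow (s b) \<and> pdir b E = (\<lambda>x. s b x * E x)"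
    and decay: "\<And>N. \<exists>C. \<forall>x. (1 + norm x) ^ N * norm (E x) \<le> C"
  shows "schwartz E"
  unfolding schwartz_def
proof (intro conjI allI ballI)
  show "smooth E" by (rule smooth_exponential_type[OF E s])
next
  fix M bs assume "bs \<in> lists (Basis :: 'a set)"
  then obtain r where r: "slow r" "pderivs bs E = (\<lambda>x. r x * E x)"
    using pderivs_exponential_type[OF E s] by blast
  obtain C N where C: "C \<ge> 0" "\<And>x. norm (r x) \<le> C * (1 + norm x) ^ N" using slow_bound[OF r(1)] by blast
  obtain D where D: "\<And>x. (1 + norm x) ^ (N + M) * norm (E x) \<le> D" using decay by blast
  have "(1 + norm x) ^ M * norm (pderivs bs E x) \<le> C * D" for x
  proof -
    have "norm (r x) * ((1 + norm x) ^ M * norm (E x)) \<le> C * (1 + norm x) ^ N * ((1 + norm x) ^ M * norm (E x))"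
      by (intro mult_right_mono C) auto
    also have "\<dots> = C * ((1 + norm x) ^ (N + M) * norm (E x))" by (simp add: power_add)
    also have "\<dots> \<le> C * D" by (intro mult_left_mono D C)
    finally show ?thesis unfolding r(2) by (simp add: norm_mult algebra_simps)
  qed
  then show "\<exists>C. \<forall>x. (1 + norm x) ^ M * norm (pderivs bs E x) \<le> C" by blast
qed

text \<open>The maximum over \<open>t\<close>, by completing the square.\<close>

lemma exp_linear_gaussian_bound:
  fixes K c t :: real
  assumes "c > 0"
  shows "exp (K * t) * exp (- c * t\<^sup>2) \<le> exp (K\<^sup>2 / (4 * c))"
proof -
  have "K * t - c * t\<^sup>2 = K\<^sup>2 / (4 * c) - c * (t - K / (2 * c))\<^sup>2"
    using assms by (simp add: field_simps power2_eq_square)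
  then have "K * t + - c * t\<^sup>2 \<le> K\<^sup>2 / (4 * c)" using assms by simp
  then show ?thesis by (simp flip: exp_add)
qed

lemma schwartz_gaussian:
  assumes "c > 0"
  shows "schwartz (\<lambda>x :: 'a::euclidean_space. of_real (exp (- c * (x \<bullet> x))))"
proof (rule schwartz_exponential_type)
  have d: "((\<lambda>x :: 'a. complex_of_real (exp (- c * (x \<bullet> x)))) has_derivative
     (\<lambda>v. of_real (- 2 * c) * of_real (x \<bullet> v) * of_real (exp (- c * (x \<bullet> x))))) (at x)" for x
    by (auto intro!: derivative_eq_intros simp: inner_commute)
  show "(\<lambda>x :: 'a. complex_of_real (exp (- c * (x \<bullet> x)))) differentiable at x" for x
    using d differentiable_def by blast
  show "slow (\<lambda>x :: 'a. complex_of_real (- 2 * c) * of_real (x \<bullet> b)) \<and>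
     pdir b (\<lambda>x :: 'a. complex_of_real (exp (- c * (x \<bullet> x)))) =
       (\<lambda>x. of_real (- 2 * c) * of_real (x \<bullet> b) * of_real (exp (- c * (x \<bullet> x))))" for b
    using pdir_eqI[OF d, of b] by (intro conjI slow_cmult slow_inner)
next
  fix N
  have "(1 + norm x) ^ N * norm (complex_of_real (exp (- c * (x \<bullet> x)))) \<le> exp ((real N)\<^sup>2 / (4 * c))" for x :: 'a
  proof -
    have "(1 + norm x) ^ N \<le> exp (norm x) ^ N" by (intro power_mono) auto
    also have "\<dots> = exp (real N * norm x)" by (simp add: exp_of_nat_mult)
    finally have "(1 + norm x) ^ N * exp (- c * (norm x)\<^sup>2) \<le> exp (real N * norm x) * exp (- c * (norm x)\<^sup>2)"
      by (intro mult_right_mono) auto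
    also have "\<dots> \<le> exp ((real N)\<^sup>2 / (4 * c))" by (rule exp_linear_gaussian_bound[OF assms])
    finally show ?thesis by (simp add: power2_norm_eq_inner)
  qed
  then show "\<exists>C. \<forall>x :: 'a. (1 + norm x) ^ N * norm (complex_of_real (exp (- c * (x \<bullet> x)))) \<le> C" by blast
qed

lemma one_plus_norm_le: "(1 + norm p) ^ M \<le> ((1 + norm (fst p)) * (1 + norm (snd p))) ^ M"
proof (rule power_mono)
  have "1 + norm p \<le> 1 + norm (fst p) + norm (snd p)"
    using norm_Pair_le[of "fst p" "snd p"] by simp
  also have "\<dots> \<le> (1 + norm (fst p)) * (1 + norm (snd p))" by (simp add: algebra_simps)
  finally show "1 + norm p \<le> (1 + norm (fst p)) * (1 + norm (snd p))" .
qed simp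

text \<open>The second factor is not kept fixed: differentiation in its variable replaces \<open>g\<close> by a derivative, so
the family ranges over all Schwartz functions \<open>g\<close>.\<close>

lemma scont_tensor:
  fixes g :: "'b::euclidean_space \<Rightarrow> complex"
  assumes "schwartz g"
  shows "scont (\<lambda>f :: 'a::euclidean_space \<Rightarrow> complex. \<lambda>p. f (fst p) * g (snd p))"
proof -
  let ?\<S> = "{\<lambda>(f :: 'a \<Rightarrow> complex) p. f (fst p) * g (snd p) | g :: 'b \<Rightarrow> complex. schwartz g}"
  show ?thesis
  proof (rule scont_family[where \<A> = "?\<S>"])
    fix A :: "('a \<Rightarrow> complex) \<Rightarrow> 'a \<times> 'b \<Rightarrow> complex" and M
    assume "A \<in> ?\<S>"
    then obtain g where g: "schwartz g" "A = (\<lambda>f p. f (fst p) * g (snd p))" by blast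
    have "(1 + norm p) ^ M * norm (f (fst p) * g (snd p)) \<le> schwartz_seminorm M g * schwartz_seminorm M f"
      if "schwartz f" for f :: "'a \<Rightarrow> complex" and p :: "'a \<times> 'b"
    proof -
      have "(1 + norm p) ^ M * norm (f (fst p) * g (snd p))
          \<le> ((1 + norm (fst p)) * (1 + norm (snd p))) ^ M * norm (f (fst p) * g (snd p))"
        by (intro mult_right_mono one_plus_norm_le) auto
      also have "\<dots> = ((1 + norm (snd p)) ^ M * norm (g (snd p))) * ((1 + norm (fst p)) ^ M * norm (f (fst p)))"
        by (simp add: norm_mult power_mult_distrib)
      also have "\<dots> \<le> schwartz_seminorm M g * schwartz_seminorm M f"
        using g that by (intro mult_mono schwartz_seminorm_bound schwartz_seminorm_nonneg) auto
      finally show ?thesis .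
    qed
    then show "seminorm_bounded (\<lambda>x. (1 + norm x) ^ M) A"
      unfolding g(2) by blast
  next
    fix A :: "('a \<Rightarrow> complex) \<Rightarrow> 'a \<times> 'b \<Rightarrow> complex" and \<phi> :: "'a \<Rightarrow> complex" and x
    assume "A \<in> ?\<S>" "schwartz \<phi>"
    then show "A \<phi> differentiable at x"
      using differentiable_affine[OF schwartz_differentiable bounded_linear_fst, of \<phi> 0 x]
        differentiable_affine[OF schwartz_differentiable bounded_linear_snd, of _ 0 x]
      by clarsimp
  next
    fix A :: "('a \<Rightarrow> complex) \<Rightarrow> 'a \<times> 'b \<Rightarrow> complex" and b :: "'a \<times> 'b"
    assume A: "A \<in> ?\<S>" and b: "b \<in> Basis"
    then obtain g where g: "schwartz g" "A = (\<lambda>f p. f (fst p) * g (snd p))" by blast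
    have "(\<lambda>f p. f (fst p) * pdir (snd b) g (snd p)) \<in> ?\<S>"
      using schwartz_pdir_any[OF g(1)] by blast
    moreover have "pdir b (A \<phi>) = (\<lambda>p. A (pdir (fst b) \<phi>) p + \<phi> (fst p) * pdir (snd b) g (snd p))"
      if s: "schwartz \<phi>" for \<phi>
    proof -
      note d1 = differentiable_affine[OF schwartz_differentiable[OF s] bounded_linear_fst, of 0, simplified]
      note d2 = differentiable_affine[OF schwartz_differentiable[OF g(1)] bounded_linear_snd, of 0, simplified]
      note e1 = pdir_affine[OF schwartz_differentiable[OF s] bounded_linear_fst, of b 0, simplified]
      note e2 = pdir_affine[OF schwartz_differentiable[OF g(1)] bounded_linear_snd, of b 0, simplified]
      show ?thesis unfolding g(2) by (simp add: pdir_mult[OF d1 d2] e1 e2)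
    qed
    ultimately show "\<exists>A1\<in>?\<S>.
        \<exists>A2\<in>?\<S>. \<exists>B1 B2. scont B1 \<and> scont B2 \<and>
          (\<forall>\<phi>. schwartz \<phi> \<longrightarrow> pdir b (A \<phi>) = (\<lambda>x. A1 (B1 \<phi>) x + A2 (B2 \<phi>) x))"
      using scont_id scont_pdir_any[of "fst b"]
      by (intro bexI[OF _ A] bexI[of _ "\<lambda>f p. f (fst p) * pdir (snd b) g (snd p)"]
          exI[of _ "\<lambda>\<phi>. \<phi>"] exI[of _ "pdir (fst b)"]) auto
  qed (use assms in blast)
qed

section \<open>Lebesgue integrals on Euclidean spaces\<close>

lemma lborel_eq_distr_PiM: "(lborel :: 'a::euclidean_space measure) =
    distr (\<Pi>\<^sub>M b\<in>Basis. lborel) borel (\<lambda>f. \<Sum>b\<in>Basis. f b *\<^sub>R b)"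
  by (subst lborel_def) (simp only: lborel_eq_real)

text \<open>Lebesgue measure is the image of a product measure under the coordinate map, so products of functions
of single coordinates are integrated factor by factor.\<close>

lemma
  fixes f :: "'a::euclidean_space \<Rightarrow> real \<Rightarrow> 'b::{real_normed_field, banach, second_countable_topology}"
  assumes f: "\<And>b. b \<in> Basis \<Longrightarrow> integrable lborel (f b)"
  shows integrable_lborel_prod: "integrable lborel (\<lambda>x :: 'a. \<Prod>b\<in>Basis. f b (x \<bullet> b))"
    and integral_lborel_prod: "(LINT x|lborel. (\<Prod>b\<in>Basis. f b ((x :: 'a) \<bullet> b))) = (\<Prod>b\<in>Basis. (LINT t|lborel. f b t))"
proof -
  interpret product_sigma_finite "\<lambda>_ :: 'a. lborel :: real measure" by standard
  have [measurable]: "f b \<in> borel_measurable borel" if "b \<in> Basis" for b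
    using borel_measurable_integrable[OF f[OF that]] by simp
  have m: "(\<lambda>f. \<Sum>b\<in>Basis. f b *\<^sub>R b) \<in> (\<Pi>\<^sub>M b\<in>(Basis :: 'a set). lborel) \<rightarrow>\<^sub>M (borel :: 'a measure)"
    by measurable
  have m2: "(\<lambda>x :: 'a. \<Prod>b\<in>Basis. f b (x \<bullet> b)) \<in> borel_measurable borel" by measurable
  have e: "(\<Prod>b\<in>Basis. f b ((\<Sum>c\<in>Basis. g c *\<^sub>R c) \<bullet> b)) = (\<Prod>b\<in>Basis. f b (g b))" for g :: "'a \<Rightarrow> real"
    by (intro prod.cong refl) simp
  show "integrable lborel (\<lambda>x :: 'a. \<Prod>b\<in>Basis. f b (x \<bullet> b))"
    by (subst lborel_eq_distr_PiM, subst integrable_distr_eq[OF m m2], unfold e)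
      (rule product_integrable_prod[OF finite_Basis f])
  show "(LINT x|lborel. (\<Prod>b\<in>Basis. f b ((x :: 'a) \<bullet> b))) = (\<Prod>b\<in>Basis. (LINT t|lborel. f b t))"
    by (subst lborel_eq_distr_PiM, subst integral_distr[OF m m2], unfold e)
      (rule product_integral_prod[OF finite_Basis f])
qed

lemma
  fixes f :: "'a::euclidean_space \<Rightarrow> complex"
  assumes f: "integrable lborel f" and c: "c \<noteq> 0"
  shows integrable_lborel_affine: "integrable lborel (\<lambda>x. f (t + c *\<^sub>R x))"
    and integral_lborel_affine: "(LINT x|lborel. f x) = of_real (\<bar>c\<bar> ^ DIM('a)) * (LINT x|lborel. f (t + c *\<^sub>R x))"
proof -
  have [measurable]: "f \<in> borel_measurable borel" using borel_measurable_integrable[OF f] by simp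
  have m: "(\<lambda>x. t + c *\<^sub>R x) \<in> lborel \<rightarrow>\<^sub>M borel" by measurable
  have d: "integrable (density (distr lborel borel (\<lambda>x. t + c *\<^sub>R x)) (\<lambda>_. \<bar>c\<bar>^DIM('a))) f"
    using f lborel_affine[OF c, of t] by simp
  then have "integrable (distr lborel borel (\<lambda>x. t + c *\<^sub>R x)) (\<lambda>x. \<bar>c\<bar>^DIM('a) *\<^sub>R f x)"
    by (subst (asm) integrable_density) auto
  from integrable_scaleR_right[OF this, of "1 / \<bar>c\<bar>^DIM('a)"]
  have "integrable (distr lborel borel (\<lambda>x. t + c *\<^sub>R x)) f" using c by simp
  then show "integrable lborel (\<lambda>x. f (t + c *\<^sub>R x))"
    by (rule integrable_distr[OF m])
  have "(LINT x|lborel. f x) = (LINT x|density (distr lborel borel (\<lambda>x. t + c *\<^sub>R x)) (\<lambda>_. \<bar>c\<bar>^DIM('a)). f x)"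
    using lborel_affine[OF c, of t] by simp
  also have "\<dots> = (LINT x|distr lborel borel (\<lambda>x. t + c *\<^sub>R x). \<bar>c\<bar>^DIM('a) *\<^sub>R f x)"
    by (subst integral_density) auto
  also have "\<dots> = of_real (\<bar>c\<bar> ^ DIM('a)) * (LINT x|lborel. f (t + c *\<^sub>R x))"
    by (subst integral_distr[OF m]) (auto simp: scaleR_conv_of_real)
  finally show "(LINT x|lborel. f x) = of_real (\<bar>c\<bar> ^ DIM('a)) * (LINT x|lborel. f (t + c *\<^sub>R x))" .
qed

lemma Fubini_lborel:
  fixes F :: "'a::euclidean_space \<Rightarrow> 'b::euclidean_space \<Rightarrow> complex"
  assumes "integrable lborel (\<lambda>p. F (fst p) (snd p))"
  shows "(LINT x|lborel. LINT y|lborel. F x y) = (LINT y|lborel. LINT x|lborel. F x y)"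
  using lborel_pair.Fubini_integral[of F] assms by (simp add: lborel_prod case_prod_unfold)

text \<open>The exponent \<open>2 n\<close> is chosen for the comparison with \<open>\<Prod>b. 1 / (1 + x\<^sub>b\<^sup>2)\<close>, an integrable product.\<close>

definition decay_weight :: "'a::euclidean_space \<Rightarrow> real" where
  "decay_weight x = 1 / (1 + norm x) ^ (2 * DIM('a))"

lemma decay_weight_nonneg: "0 \<le> decay_weight x"
  by (simp add: decay_weight_def)

lemma integrable_decay_weight: "integrable lborel (decay_weight :: 'a::euclidean_space \<Rightarrow> real)"
proof (rule Bochner_Integration.integrable_bound)
  have "integrable lborel (\<lambda>t :: real. inverse (1 + t\<^sup>2))"
    using integrable_inverse_1_plus_square by (simp add: set_integrable_def)
  then show "integrable lborel (\<lambda>x :: 'a. \<Prod>b\<in>Basis. inverse (1 + (x \<bullet> b)\<^sup>2))"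
    by (rule integrable_lborel_prod)
  show "AE x in lborel. norm (decay_weight x) \<le> norm (\<Prod>b\<in>Basis. inverse (1 + ((x :: 'a) \<bullet> b)\<^sup>2))"
  proof (rule AE_I2)
    fix x :: 'a
    have "(\<Prod>b\<in>Basis. 1 + (x \<bullet> b)\<^sup>2) \<le> (\<Prod>b\<in>(Basis :: 'a set). (1 + norm x)\<^sup>2)"
    proof (intro prod_mono conjI)
      fix b :: 'a assume b: "b \<in> Basis"
      have "(x \<bullet> b)\<^sup>2 \<le> (norm x)\<^sup>2"
        using Basis_le_norm[OF b, of x] by (simp add: abs_le_square_iff[symmetric])
      then show "1 + (x \<bullet> b)\<^sup>2 \<le> (1 + norm x)\<^sup>2" using norm_ge_zero[of x] unfolding power2_sum one_power2 mult_1_right by linarith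
      show "0 \<le> 1 + (x \<bullet> b)\<^sup>2" by simp
    qed
    also have "\<dots> = (1 + norm x) ^ (2 * DIM('a))" by (simp add: power_mult)
    finally have "(\<Prod>b\<in>Basis. 1 + (x \<bullet> b)\<^sup>2) \<le> (1 + norm x) ^ (2 * DIM('a))" .
    moreover have "0 < (\<Prod>b\<in>Basis. 1 + (x \<bullet> b)\<^sup>2)"
      by (intro prod_pos) (auto intro: add_pos_nonneg)
    ultimately show "norm (decay_weight x) \<le> norm (\<Prod>b\<in>Basis. inverse (1 + (x \<bullet> b)\<^sup>2))"
      by (simp add: decay_weight_def prod_inversef[unfolded o_def] divide_inverse abs_prod le_imp_inverse_le flip: abs_inverse)
  qed
  show "(decay_weight :: 'a \<Rightarrow> real) \<in> borel_measurable lborel"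
    unfolding decay_weight_def[abs_def] by measurable
qed

lemma le_decay_weight:
  fixes x :: "'a::euclidean_space"
  assumes "(1 + norm x) ^ (2 * DIM('a)) * a \<le> C"
  shows "a \<le> C * decay_weight x"
  using assms by (simp add: decay_weight_def field_simps add_pos_nonneg)

lemma integrable_decay:
  fixes f :: "'a::euclidean_space \<Rightarrow> complex"
  assumes "continuous_on UNIV f" "\<And>x. norm (f x) \<le> C * decay_weight x"
  shows "integrable lborel f"
proof (rule Bochner_Integration.integrable_bound[where f = "\<lambda>x. C * decay_weight x"])
  show "integrable lborel (\<lambda>x. C * decay_weight x)" using integrable_decay_weight by auto
  show "f \<in> borel_measurable lborel" using borel_measurable_continuous_onI[OF assms(1)] by simp
  show "AE x in lborel. norm (f x) \<le> norm (C * decay_weight x)"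
    using assms(2) by (auto intro: order_trans[OF _ abs_ge_self])
qed

lemma norm_integral_decay:
  fixes f :: "'a::euclidean_space \<Rightarrow> complex"
  assumes "continuous_on UNIV f" "\<And>x. norm (f x) \<le> C * decay_weight x"
  shows "norm (LINT x|lborel. f x) \<le> C * (LINT x|lborel. decay_weight (x :: 'a))"
proof -
  have "norm (LINT x|lborel. f x) \<le> (LINT x|lborel. norm (f x))"
    by (rule integral_norm_bound)
  also have "\<dots> \<le> (LINT x|lborel. C * decay_weight (x :: 'a))"
    by (rule integral_mono[OF integrable_norm[OF integrable_decay[OF assms]]
          integrable_mult_right[OF integrable_decay_weight]]) (rule assms)
  finally show ?thesis by simp
qed

lemma schwartz_le_decay_weight:
  fixes f :: "'a::euclidean_space \<Rightarrow> complex"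
  assumes "schwartz f"
  obtains C where "\<And>x. norm (f x) \<le> C * decay_weight x"
  using schwartz_decay[OF assms, of "2 * DIM('a)"] le_decay_weight by metis

lemma schwartz_integrable:
  assumes "schwartz f" shows "integrable lborel f"
  using schwartz_le_decay_weight[OF assms] integrable_decay[OF schwartz_continuous[OF assms]] by metis

text \<open>Differentiation under the integral sign.  The difference quotients converge pointwise, and by the mean
value inequality on the ball they are dominated by \<open>2 g\<close>; dominated convergence does the rest.\<close>

lemma has_derivative_integral:
  fixes f :: "'a::euclidean_space \<Rightarrow> 'b \<Rightarrow> complex"
  assumes e: "e > 0"
    and int: "\<And>x. x \<in> ball p e \<Longrightarrow> integrable M (f x)"
    and D: "\<And>x u. x \<in> ball p e \<Longrightarrow> ((\<lambda>x. f x u) has_derivative D x u) (at x)"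
    and bound: "\<And>x u v. x \<in> ball p e \<Longrightarrow> norm (D x u v) \<le> g u * norm v"
    and g: "integrable M g"
    and meas: "\<And>v. (\<lambda>u. D p u v) \<in> borel_measurable M"
  shows "((\<lambda>x. LINT u|M. f x u) has_derivative (\<lambda>v. LINT u|M. D p u v)) (at p)"
proof -
  have p: "p \<in> ball p e" using e by simp
  have g0: "0 \<le> g u" for u
  proof -
    obtain b :: 'a where "b \<in> Basis" using nonempty_Basis by blast
    then show ?thesis using order_trans[OF norm_ge_zero bound[OF p, of u b]] by simp
  qed
  have intD: "integrable M (\<lambda>u. D p u v)" for v
    by (rule Bochner_Integration.integrable_bound[where f = "\<lambda>u. g u * norm v"])
      (use g meas bound[OF p, of _ v] g0 in auto)
  have lin: "linear (D p u)" for u using D[OF p] has_derivative_linear by blast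
  have bl: "bounded_linear (\<lambda>v. LINT u|M. D p u v)"
  proof (rule bounded_linear_intro[where K = "LINT u|M. g u"])
    show "norm (LINT u|M. D p u v) \<le> norm v * (LINT u|M. g u)" for v
    proof -
      have "norm (LINT u|M. D p u v) \<le> (LINT u|M. norm (D p u v))" by (rule integral_norm_bound)
      also have "\<dots> \<le> (LINT u|M. g u * norm v)"
        using intD g bound[OF p] by (intro integral_mono integrable_norm integrable_mult_left) auto
      finally show ?thesis by (simp add: mult.commute)
    qed
  qed (simp_all add: linear_add[OF lin] linear_cmul[OF lin] intD)
  have mvt: "norm (f (p + h) u - f p u) \<le> g u * norm h" if h: "h \<in> ball 0 e" for h u
  proof -
    have "norm (f (p + h) u - f p u) \<le> g u * norm (p + h - p)"
    proof (rule differentiable_bound[where S = "ball p e" and f' = "\<lambda>x. D x u"])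
      show "((\<lambda>x. f x u) has_derivative D x u) (at x within ball p e)" if "x \<in> ball p e" for x
        using D[OF that] has_derivative_at_withinI by blast
      show "onorm (D x u) \<le> g u" if "x \<in> ball p e" for x
        by (rule onorm_bound[OF g0]) (rule bound[OF that])
      show "p + h \<in> ball p e" using h by (simp add: dist_norm)
    qed (use e in auto)
    then show ?thesis by simp
  qed
  have "((\<lambda>h. norm ((LINT u|M. f (p + h) u) - (LINT u|M. f p u) - (LINT u|M. D p u h)) / norm h) \<longlongrightarrow> 0) (at 0 within ball 0 e)"
    unfolding tendsto_at_iff_sequentially
  proof (intro allI impI)
    fix X :: "nat \<Rightarrow> 'a" assume X: "\<forall>i. X i \<in> ball 0 e - {0}" and X0: "X \<longlonglongrightarrow> 0"
    let ?s = "\<lambda>i u. (f (p + X i) u - f p u - D p u (X i)) /\<^sub>R norm (X i)"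
    have pX: "p + X i \<in> ball p e" for i using X by (simp add: dist_norm)
    have ints: "integrable M (?s i)" for i
      by (intro integrable_scaleR_right Bochner_Integration.integrable_diff int pX p intD)
    have "(\<lambda>i. LINT u|M. ?s i u) \<longlonglongrightarrow> (LINT u|M. 0)"
    proof (rule integral_dominated_convergence[where w = "\<lambda>u. 2 * g u"])
      show "integrable M (\<lambda>u. 2 * g u)" using g by simp
      show "?s i \<in> borel_measurable M" for i using ints borel_measurable_integrable by blast
      show "AE u in M. norm (?s i u) \<le> 2 * g u" for i
      proof (rule AE_I2)
        fix u
        have "norm (f (p + X i) u - f p u - D p u (X i)) \<le> norm (f (p + X i) u - f p u) + norm (D p u (X i))"
          by (rule norm_triangle_ineq4)
        also have "\<dots> \<le> g u * norm (X i) + g u * norm (X i)"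
          using X by (intro add_mono mvt bound p) auto
        finally have "norm (f (p + X i) u - f p u - D p u (X i)) \<le> 2 * g u * norm (X i)" by simp
        moreover have "norm (X i) > 0" using X by simp
        ultimately show "norm (?s i u) \<le> 2 * g u"
          by (simp only: norm_scaleR abs_inverse abs_norm_cancel pos_divide_le_eq divide_inverse_commute[symmetric])
      qed
      show "AE u in M. (\<lambda>i. ?s i u) \<longlonglongrightarrow> 0"
      proof (rule AE_I2)
        fix u
        have "((\<lambda>h. norm (f (p + h) u - f p u - D p u h) / norm h) \<longlongrightarrow> 0) (at 0)"
          using D[OF p] unfolding has_derivative_at by blast
        then have "((\<lambda>h. norm (f (p + h) u - f p u - D p u h) / norm h) \<longlongrightarrow> 0) (at 0 within ball 0 e)"
          by (rule tendsto_within_subset) simp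
        then have "(\<lambda>i. norm (f (p + X i) u - f p u - D p u (X i)) / norm (X i)) \<longlonglongrightarrow> 0"
          using X X0 unfolding tendsto_at_iff_sequentially o_def by blast
        then have "(\<lambda>i. norm (?s i u)) \<longlonglongrightarrow> 0" by (simp add: divide_inverse_commute)
        then show "(\<lambda>i. ?s i u) \<longlonglongrightarrow> 0" by (rule tendsto_norm_zero_cancel)
      qed
    qed auto
    then have "(\<lambda>i. norm (LINT u|M. ?s i u)) \<longlonglongrightarrow> 0" by (intro tendsto_norm_zero) simp
    moreover have "norm (LINT u|M. ?s i u) =
        norm ((LINT u|M. f (p + X i) u) - (LINT u|M. f p u) - (LINT u|M. D p u (X i))) / norm (X i)" for i
      by (subst integral_scaleR_right)
        (simp add: int[OF pX] int[OF p] intD divide_inverse_commute)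
    ultimately show "((\<lambda>h. norm ((LINT u|M. f (p + h) u) - (LINT u|M. f p u) - (LINT u|M. D p u h)) / norm h) \<circ> X) \<longlonglongrightarrow> 0"
      by (simp add: o_def)
  qed
  then have "((\<lambda>h. norm ((LINT u|M. f (p + h) u) - (LINT u|M. f p u) - (LINT u|M. D p u h)) / norm h) \<longlongrightarrow> 0) (at 0)"
    by (subst (asm) at_within_open) (use e in auto)
  with bl show ?thesis unfolding has_derivative_at by blast
qed

lemma has_derivative_pdir:
  assumes "f differentiable (at x)"
  shows "(f has_derivative (\<lambda>v. pdir v f x)) (at x)"
  using assms[unfolded frechet_derivative_works] unfolding pdir_def .

lemma norm_pdir_le:
  assumes "\<And>x. f differentiable (at x)"
  shows "norm (pdir v f x) \<le> norm v * (\<Sum>b\<in>Basis. norm (pdir b f x))"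
proof -
  have "norm (pdir v f x) = norm (\<Sum>b\<in>Basis. of_real (v \<bullet> b) * pdir b f x)"
    by (subst pdir_expand[OF assms]) simp
  also have "\<dots> \<le> (\<Sum>b\<in>Basis. norm v * norm (pdir b f x))"
    by (intro sum_norm_le) (auto simp: norm_mult Basis_le_norm mult_right_mono)
  finally show ?thesis by (simp add: sum_distrib_left)
qed

lemma schwartz_pdir_decay:
  fixes \<phi> :: "'a::euclidean_space \<Rightarrow> complex"
  assumes "schwartz \<phi>"
  obtains C where "C \<ge> 0" "\<And>v x. (1 + norm x) ^ N * norm (pdir v \<phi> x) \<le> C * norm v"
proof -
  have "\<forall>b\<in>Basis. \<exists>C. \<forall>x. (1 + norm x) ^ N * norm (pdir b \<phi> x) \<le> C"
    using schwartz_decay[OF schwartz_pdir[OF assms]] by metis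
  from bchoice[OF this] obtain C
    where C: "\<And>b x. b \<in> Basis \<Longrightarrow> (1 + norm x) ^ N * norm (pdir b \<phi> x) \<le> C b" by blast
  have "(1 + norm x) ^ N * norm (pdir v \<phi> x) \<le> (\<Sum>b\<in>Basis. \<bar>C b\<bar>) * norm v" for v x
  proof -
    have "(1 + norm x) ^ N * norm (pdir v \<phi> x) \<le> (1 + norm x) ^ N * (norm v * (\<Sum>b\<in>Basis. norm (pdir b \<phi> x)))"
      by (intro mult_left_mono norm_pdir_le schwartz_differentiable assms) auto
    also have "\<dots> = norm v * (\<Sum>b\<in>Basis. (1 + norm x) ^ N * norm (pdir b \<phi> x))"
      by (simp add: sum_distrib_left mult_ac)
    also have "\<dots> \<le> norm v * (\<Sum>b\<in>Basis. \<bar>C b\<bar>)"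
      by (intro mult_left_mono sum_mono order_trans[OF C abs_ge_self]) auto
    finally show ?thesis by (simp add: mult.commute)
  qed
  then show ?thesis by (intro that[of "\<Sum>b\<in>Basis. \<bar>C b\<bar>"]) (auto intro: sum_nonneg)
qed

text \<open>By translation invariance the integral of \<open>\<phi> (u + t b)\<close> does not depend on \<open>t\<close>; its derivative at
\<open>t = 0\<close> is the integral of the derivative of \<open>\<phi>\<close>.\<close>

lemma integral_pdir_eq_0:
  fixes \<phi> :: "'a::euclidean_space \<Rightarrow> complex"
  assumes s: "schwartz \<phi>" and b: "b \<in> Basis"
  shows "(LINT u|lborel. pdir b \<phi> u) = 0"
proof -
  obtain C where C: "C \<ge> 0" "\<And>v x. (1 + norm x) ^ (2 * DIM('a)) * norm (pdir v \<phi> x) \<le> C * norm v"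
    using schwartz_pdir_decay[OF s, of "2 * DIM('a)"] by blast
  \<comment> \<open>For \<open>\<bar>t\<bar> < 1\<close> the weight at \<open>u + t b\<close> is comparable to the weight at \<open>u\<close>, with constant \<open>2\<close> before
    raising to the power \<open>2 n\<close>.\<close>
  have d: "((\<lambda>t. LINT u|lborel. \<phi> (u + t *\<^sub>R b)) has_derivative
      (\<lambda>v. LINT u|lborel. pdir (v *\<^sub>R b) \<phi> (u + 0 *\<^sub>R b))) (at 0)"
  proof (rule has_derivative_integral[where e = 1 and g = "\<lambda>u. (2 ^ (2 * DIM('a)) * C) * decay_weight u"
        and D = "\<lambda>t u v. pdir (v *\<^sub>R b) \<phi> (u + t *\<^sub>R b)"])
    show "integrable lborel (\<lambda>u. \<phi> (u + t *\<^sub>R b))" for t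
      using integrable_lborel_affine[OF schwartz_integrable[OF s], of 1 "t *\<^sub>R b"] by (simp add: add.commute)
    show "((\<lambda>t. \<phi> (u + t *\<^sub>R b)) has_derivative (\<lambda>v. pdir (v *\<^sub>R b) \<phi> (u + t *\<^sub>R b))) (at t)" for t u
      by (rule has_derivative_compose[OF _ has_derivative_pdir[OF schwartz_differentiable[OF s]]])
        (auto intro!: derivative_eq_intros)
    show "norm (pdir (v *\<^sub>R b) \<phi> (u + t *\<^sub>R b)) \<le> 2 ^ (2 * DIM('a)) * C * decay_weight u * norm v"
      if "t \<in> ball 0 1" for t u v
    proof -
      have "norm u \<le> norm (u + t *\<^sub>R b) + \<bar>t\<bar>"
        using norm_triangle_ineq[of "u + t *\<^sub>R b" "- (t *\<^sub>R b)"] b by simp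
      moreover have "\<bar>t\<bar> < 1" using that by simp
      moreover have "n \<le> r + s \<Longrightarrow> s < 1 \<Longrightarrow> 0 \<le> r \<Longrightarrow> 1 + n \<le> 2 * (1 + r)" for n r s :: real
        by argo
      ultimately have "1 + norm u \<le> 2 * (1 + norm (u + t *\<^sub>R b))"
        using norm_ge_zero by blast
      then have "(1 + norm u) ^ (2 * DIM('a)) \<le> (2 * (1 + norm (u + t *\<^sub>R b))) ^ (2 * DIM('a))"
        by (intro power_mono) auto
      then have "(1 + norm u) ^ (2 * DIM('a)) * norm (pdir (v *\<^sub>R b) \<phi> (u + t *\<^sub>R b))
          \<le> (2 * (1 + norm (u + t *\<^sub>R b))) ^ (2 * DIM('a)) * norm (pdir (v *\<^sub>R b) \<phi> (u + t *\<^sub>R b))"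
        by (intro mult_right_mono) auto
      also have "\<dots> = 2 ^ (2 * DIM('a)) * ((1 + norm (u + t *\<^sub>R b)) ^ (2 * DIM('a)) * norm (pdir (v *\<^sub>R b) \<phi> (u + t *\<^sub>R b)))"
        by (simp only: power_mult_distrib mult.assoc)
      also have "\<dots> \<le> 2 ^ (2 * DIM('a)) * (C * norm (v *\<^sub>R b))"
        by (intro mult_left_mono C) auto
      also have "\<dots> = 2 ^ (2 * DIM('a)) * C * norm v" using b by simp
      finally show ?thesis using le_decay_weight by (metis mult.commute mult.left_commute)
    qed
    show "integrable lborel (\<lambda>u :: 'a. 2 ^ (2 * DIM('a)) * C * decay_weight u)"
      using integrable_decay_weight by auto
    show "(\<lambda>u. pdir (v *\<^sub>R b) \<phi> (u + 0 *\<^sub>R b)) \<in> borel_measurable lborel" for v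
      using borel_measurable_continuous_onI[OF schwartz_continuous[OF schwartz_pdir_any[OF s]]] by simp
  qed auto
  have "(LINT u|lborel. \<phi> (u + t *\<^sub>R b)) = (LINT u|lborel. \<phi> u)" for t
    using integral_lborel_affine[OF schwartz_integrable[OF s], of 1 "t *\<^sub>R b"] by (simp add: add.commute)
  then have "((\<lambda>t. LINT u|lborel. \<phi> (u + t *\<^sub>R b)) has_derivative (\<lambda>v. 0)) (at 0)"
    by simp
  from has_derivative_unique[OF d this] have "(LINT u|lborel. pdir (1 *\<^sub>R b) \<phi> (u + 0 *\<^sub>R b)) = 0"
    by metis
  then show ?thesis by simp
qed

section \<open>Fourier transforms of Schwartz functions\<close>

text \<open>All oscillating factors below have this form, which leaves only real phases to compare.\<close>

definition unit_exp :: "real \<Rightarrow> complex" where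
  "unit_exp t = exp (2 * pi * \<i> * of_real t)"

lemma unit_exp_add: "unit_exp (s + t) = unit_exp s * unit_exp t"
  by (simp add: unit_exp_def distrib_left exp_add)

lemma unit_exp_0 [simp]: "unit_exp 0 = 1"
  by (simp add: unit_exp_def)

lemma norm_unit_exp [simp]: "norm (unit_exp t) = 1"
proof -
  have "unit_exp t = exp (\<i> * of_real (2 * pi * t))" by (simp add: unit_exp_def mult_ac)
  then show ?thesis by (simp only: norm_exp_i_times)
qed

lemma continuous_on_unit_exp [continuous_intros]:
  "continuous_on S f \<Longrightarrow> continuous_on S (\<lambda>x. unit_exp (f x))"
  unfolding unit_exp_def by (intro continuous_intros)

lemma has_derivative_unit_exp [derivative_intros]:
  assumes "(f has_derivative f') (at x)"
  shows "((\<lambda>x. unit_exp (f x)) has_derivative (\<lambda>v. (2 * pi * \<i>) * of_real (f' v) * unit_exp (f x))) (at x)"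
proof -
  have e: "(exp has_derivative (\<lambda>h. exp z * h)) (at z)" for z :: complex
    using DERIV_exp[of z] by (simp add: has_field_derivative_def)
  have "((\<lambda>x. (2 * pi * \<i>) * of_real (f x)) has_derivative (\<lambda>v. (2 * pi * \<i>) * of_real (f' v))) (at x)"
    by (intro has_derivative_mult_right has_derivative_of_real assms)
  from has_derivative_compose[OF this e] show ?thesis
    unfolding unit_exp_def by (simp add: mult.commute)
qed

lemma fourier_unit_exp: "fourier f k = (LINT x|lborel. unit_exp (- (k \<bullet> x)) * f x)"
  unfolding fourier_def unit_exp_def by (simp add: algebra_simps)

lemma inv_fourier_unit_exp: "inv_fourier f k = (LINT x|lborel. unit_exp (k \<bullet> x) * f x)"
  unfolding inv_fourier_def unit_exp_def by (simp add: inner_commute)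

lemma inv_fourier_eq_fourier: "inv_fourier f k = fourier f (- k)"
  by (simp add: fourier_unit_exp inv_fourier_unit_exp)

lemma slow_unit_exp_form:
  fixes q :: "'a::euclidean_space \<Rightarrow> real"
  assumes q: "\<And>x. (q has_derivative q' x) (at x)"
    and s: "\<And>b. b \<in> Basis \<Longrightarrow> slow (\<lambda>x. of_real (q' x b))"
  shows "slow (\<lambda>x. unit_exp (q x))"
proof (rule slow_exponential_type)
  show "(\<lambda>x. unit_exp (q x)) differentiable at x" for x
    using has_derivative_unit_exp[OF q] differentiable_def by blast
  show "slow (\<lambda>x. (2 * pi * \<i>) * of_real (q' x b)) \<and>
      pdir b (\<lambda>x. unit_exp (q x)) = (\<lambda>x. (2 * pi * \<i>) * of_real (q' x b) * unit_exp (q x))" if "b \<in> Basis" for b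
    using pdir_eqI[OF has_derivative_unit_exp[OF q], of b] s[OF that] by (intro conjI slow_cmult)
qed simp

lemma slow_unit_exp_inner: "slow (\<lambda>x. unit_exp (k \<bullet> x))"
  by (rule slow_unit_exp_form[where q' = "\<lambda>x v. k \<bullet> v"]) (auto intro!: derivative_eq_intros slow_const)

text \<open>The Fourier transform in the first variable only, as a function of pairs.  It also yields the full
transform and integrals over the first variable, by fixing one of the arguments.\<close>

definition pfourier :: "('a::euclidean_space \<times> 'b::euclidean_space \<Rightarrow> complex) \<Rightarrow> 'a \<times> 'b \<Rightarrow> complex" where
  "pfourier \<phi> p = fourier (\<lambda>u. \<phi> (u, snd p)) (fst p)"

lemma pfourier_unit_exp: "pfourier \<phi> p = (LINT u|lborel. unit_exp (- (fst p \<bullet> u)) * \<phi> (u, snd p))"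
  by (simp add: pfourier_def fourier_unit_exp)

lemma schwartz_fst_slice:
  assumes "schwartz \<phi>" shows "schwartz (\<lambda>u. \<phi> (u, k))"
proof -
  have "scont (\<lambda>\<phi> u. \<phi> ((\<lambda>u. (u, 0)) u + (0, k)))"
    by (rule scont_affine[where l' = fst])
      (auto intro: bounded_linear_Pair bounded_linear_zero bounded_linear_ident bounded_linear_fst)
  from scont_schwartz[OF this assms] show ?thesis by simp
qed

lemma map_Pair_0_Basis: "bs \<in> lists Basis \<Longrightarrow> map (Pair 0) bs \<in> lists Basis"
  by (induction bs) (auto simp: Basis_prod_def)

text \<open>One seminorm on the product space controls a weight in one variable and integrability in the other.\<close>

lemma slice_pderivs_decay:
  fixes \<Theta> :: "'a::euclidean_space \<times> 'b::euclidean_space \<Rightarrow> complex"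
  assumes s: "schwartz \<Theta>" and bs: "bs \<in> lists Basis" "length bs \<le> N"
  shows "(1 + norm a) ^ N * norm (pderivs (map (Pair 0) bs) \<Theta> (x, a)) \<le> schwartz_seminorm (N + 2 * DIM('a)) \<Theta> * decay_weight x"
proof (rule le_decay_weight)
  have "(1 + norm x) ^ (2 * DIM('a)) * (1 + norm a) ^ N \<le> (1 + norm (x, a)) ^ (2 * DIM('a)) * (1 + norm (x, a)) ^ N"
    using norm_fst_le[of x a] norm_snd_le[of a x] by (intro mult_mono power_mono) auto
  also have "\<dots> = (1 + norm (x, a)) ^ (N + 2 * DIM('a))" by (simp add: power_add)
  finally have "(1 + norm x) ^ (2 * DIM('a)) * (1 + norm a) ^ N * norm (pderivs (map (Pair 0) bs) \<Theta> (x, a))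
      \<le> (1 + norm (x, a)) ^ (N + 2 * DIM('a)) * norm (pderivs (map (Pair 0) bs) \<Theta> (x, a))"
    by (intro mult_right_mono) auto
  also have "\<dots> \<le> schwartz_seminorm (N + 2 * DIM('a)) \<Theta>"
    using bs by (intro schwartz_seminorm_upper s map_Pair_0_Basis) auto
  finally show "(1 + norm x) ^ (2 * DIM('a)) * ((1 + norm a) ^ N * norm (pderivs (map (Pair 0) bs) \<Theta> (x, a)))
      \<le> schwartz_seminorm (N + 2 * DIM('a)) \<Theta>" by (simp add: mult.assoc)
qed

text \<open>What remains under the integral sign when a partial Fourier transform is differentiated in the
direction \<open>v\<close>: multiplication by a coordinate for the transformed variable, differentiation for the
other one.\<close>

definition pfourier_deriv ::
    "'a \<times> 'b \<Rightarrow> ('a::euclidean_space \<times> 'b::euclidean_space \<Rightarrow> complex) \<Rightarrow> 'a \<times> 'b \<Rightarrow> complex" where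
  "pfourier_deriv v \<phi> q = (- 2 * pi * \<i>) * of_real (q \<bullet> (fst v, 0)) * \<phi> q + pdir (0, snd v) \<phi> q"

lemma scont_pfourier_deriv: "scont (pfourier_deriv v)"
  unfolding pfourier_deriv_def
  by (intro scont_add scont_pdir_any scont_mult_slow slow_cmult slow_inner)

lemma has_derivative_pfourier:
  fixes \<phi> :: "'a::euclidean_space \<times> 'b::euclidean_space \<Rightarrow> complex"
  assumes s: "schwartz \<phi>"
  shows "(pfourier \<phi> has_derivative (\<lambda>v. pfourier (pfourier_deriv v \<phi>) p)) (at p)"
proof -
  obtain C where C: "C \<ge> 0" "\<And>v x. (1 + norm x) ^ (2 * DIM('a)) * norm (pdir v \<phi> x) \<le> C * norm v"
    using schwartz_pdir_decay[OF s, of "2 * DIM('a)"] by blast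
  obtain B where B: "B \<ge> 0" "\<And>x. (1 + norm x) ^ (Suc (2 * DIM('a))) * norm (\<phi> x) \<le> B"
    using schwartz_decay[OF s, of "Suc (2 * DIM('a))"] by blast
  have bd: "norm (pfourier_deriv v \<phi> (u, k)) \<le> ((2 * pi * B + C) * decay_weight u) * norm v" for v u k
  proof -
    let ?w = "(1 + norm (u, k)) ^ (2 * DIM('a))"
    have "\<bar>(u, k) \<bullet> (fst v, 0)\<bar> \<le> norm (u, k) * norm (fst v, 0 :: 'b)" by (rule Cauchy_Schwarz_ineq2)
    also have "\<dots> \<le> (1 + norm (u, k)) * norm v"
      using norm_fst_le[of "fst v" "snd v"] by (intro mult_mono) (auto simp: norm_Pair)
    finally have "?w * (\<bar>(u, k) \<bullet> (fst v, 0)\<bar> * norm (\<phi> (u, k))) \<le> ?w * ((1 + norm (u, k)) * norm v * norm (\<phi> (u, k)))"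
      by (intro mult_left_mono mult_right_mono) auto
    also have "\<dots> = ((1 + norm (u, k)) ^ (Suc (2 * DIM('a))) * norm (\<phi> (u, k))) * norm v" by simp
    also have "\<dots> \<le> B * norm v" by (intro mult_right_mono B) auto
    finally have 1: "?w * (\<bar>(u, k) \<bullet> (fst v, 0)\<bar> * norm (\<phi> (u, k))) \<le> B * norm v" .
    have "?w * norm (pdir (0, snd v) \<phi> (u, k)) \<le> C * norm (0 :: 'a, snd v)" by (rule C)
    also have "\<dots> \<le> C * norm v"
      using norm_snd_le[of "snd v" "fst v"] C by (intro mult_left_mono) (auto simp: norm_Pair)
    finally have 2: "?w * norm (pdir (0, snd v) \<phi> (u, k)) \<le> C * norm v" .
    have "norm (pfourier_deriv v \<phi> (u, k)) \<le> 2 * pi * (\<bar>(u, k) \<bullet> (fst v, 0)\<bar> * norm (\<phi> (u, k))) + norm (pdir (0, snd v) \<phi> (u, k))"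
      unfolding pfourier_deriv_def by (rule order_trans[OF norm_triangle_ineq]) (simp add: norm_mult)
    then have "?w * norm (pfourier_deriv v \<phi> (u, k))
      \<le> ?w * (2 * pi * (\<bar>(u, k) \<bullet> (fst v, 0)\<bar> * norm (\<phi> (u, k))) + norm (pdir (0, snd v) \<phi> (u, k)))"
      by (intro mult_left_mono) auto
    also have "\<dots> = 2 * pi * (?w * (\<bar>(u, k) \<bullet> (fst v, 0)\<bar> * norm (\<phi> (u, k)))) + ?w * norm (pdir (0, snd v) \<phi> (u, k))"
      by (simp only: distrib_left mult_ac)
    also have "\<dots> \<le> 2 * pi * (B * norm v) + C * norm v"
      by (intro add_mono mult_left_mono 1 2) auto
    finally have 3: "?w * norm (pfourier_deriv v \<phi> (u, k)) \<le> (2 * pi * B + C) * norm v"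
      by (simp add: algebra_simps)
    have "(1 + norm u) ^ (2 * DIM('a)) * norm (pfourier_deriv v \<phi> (u, k)) \<le> ?w * norm (pfourier_deriv v \<phi> (u, k))"
      using norm_fst_le[of u k] by (intro mult_right_mono power_mono) auto
    with 3 have "(1 + norm u) ^ (2 * DIM('a)) * norm (pfourier_deriv v \<phi> (u, k)) \<le> (2 * pi * B + C) * norm v"
      by linarith
    from le_decay_weight[OF this] show ?thesis by (simp add: mult_ac)
  qed
  have "((\<lambda>p. LINT u|lborel. unit_exp (- (fst p \<bullet> u)) * \<phi> (u, snd p)) has_derivative
      (\<lambda>v. LINT u|lborel. unit_exp (- (fst p \<bullet> u)) * pfourier_deriv v \<phi> (u, snd p))) (at p)"
  proof (rule has_derivative_integral[where e = 1 and g = "\<lambda>u. (2 * pi * B + C) * decay_weight u"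
        and D = "\<lambda>p u v. unit_exp (- (fst p \<bullet> u)) * pfourier_deriv v \<phi> (u, snd p)"])
    have "schwartz (\<lambda>u. unit_exp (- (fst p \<bullet> u)) * \<phi> (u, snd p))" for p :: "'a \<times> 'b"
      using schwartz_mult_slow[OF slow_unit_exp_inner[of "- fst p"] schwartz_fst_slice[OF s]] by simp
    then show "integrable lborel (\<lambda>u. unit_exp (- (fst p \<bullet> u)) * \<phi> (u, snd p))" for p :: "'a \<times> 'b"
      by (rule schwartz_integrable)
    show "((\<lambda>p. unit_exp (- (fst p \<bullet> u)) * \<phi> (u, snd p)) has_derivative
        (\<lambda>v. unit_exp (- (fst p \<bullet> u)) * pfourier_deriv v \<phi> (u, snd p))) (at p)" for p u
    proof -
      have "((\<lambda>p. \<phi> (u, snd p)) has_derivative (\<lambda>v. pdir (0, snd v) \<phi> (u, snd p))) (at p)"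
        by (rule has_derivative_compose[OF _ has_derivative_pdir[OF schwartz_differentiable[OF s]]])
          (auto intro!: derivative_eq_intros)
      moreover have "((\<lambda>p. unit_exp (- (fst p \<bullet> u))) has_derivative
          (\<lambda>v. (2 * pi * \<i>) * of_real (- (fst v \<bullet> u)) * unit_exp (- (fst p \<bullet> u)))) (at p)"
        by (rule has_derivative_unit_exp) (auto intro!: derivative_eq_intros)
      ultimately have "((\<lambda>p. unit_exp (- (fst p \<bullet> u)) * \<phi> (u, snd p)) has_derivative
        (\<lambda>v. unit_exp (- (fst p \<bullet> u)) * pdir (0, snd v) \<phi> (u, snd p) +
          ((2 * pi * \<i>) * of_real (- (fst v \<bullet> u)) * unit_exp (- (fst p \<bullet> u))) * \<phi> (u, snd p))) (at p)"
        by (rule has_derivative_mult[rotated])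
      then show ?thesis by (simp add: pfourier_deriv_def algebra_simps inner_commute)
    qed
    show "norm (unit_exp (- (fst x \<bullet> u)) * pfourier_deriv v \<phi> (u, snd x)) \<le> (2 * pi * B + C) * decay_weight u * norm v"
      for x u v using bd by (simp add: norm_mult)
    show "integrable lborel (\<lambda>u. (2 * pi * B + C) * decay_weight u)"
      by (rule integrable_mult_right[OF integrable_decay_weight])
    show "(\<lambda>u. unit_exp (- (fst p \<bullet> u)) * pfourier_deriv v \<phi> (u, snd p)) \<in> borel_measurable lborel" for v
      using borel_measurable_integrable[OF schwartz_integrable[OF schwartz_mult_slow[OF slow_unit_exp_inner[of "- fst p"]
        schwartz_fst_slice[OF scont_schwartz[OF scont_pfourier_deriv s]]]]] by simp
  qed simp
  then show ?thesis unfolding pfourier_unit_exp[abs_def] .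
qed

text \<open>Integration by parts.\<close>

lemma pfourier_pdir_fst:
  fixes \<phi> :: "'a::euclidean_space \<times> 'b::euclidean_space \<Rightarrow> complex"
  assumes s: "schwartz \<phi>" and b: "b \<in> Basis"
  shows "pfourier (pdir (b, 0) \<phi>) p = (2 * pi * \<i>) * of_real (fst p \<bullet> b) * pfourier \<phi> p"
proof -
  let ?e = "\<lambda>u. unit_exp (- (fst p \<bullet> u))" and ?f = "\<lambda>u. \<phi> (u, snd p)"
  have se: "slow ?e" using slow_unit_exp_inner[of "- fst p"] by simp
  have sf: "schwartz ?f" by (rule schwartz_fst_slice[OF s])
  have sp: "schwartz (\<lambda>u. pdir (b, 0) \<phi> (u, snd p))" by (rule schwartz_fst_slice[OF schwartz_pdir_any[OF s]])
  have pe: "pdir b ?e = (\<lambda>u. (2 * pi * \<i>) * of_real (- (fst p \<bullet> b)) * ?e u)"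
    by (rule pdir_eqI, rule has_derivative_unit_exp) (auto intro!: derivative_eq_intros)
  have "pdir b (\<lambda>u. \<phi> ((u, 0) + (0, snd p))) = (\<lambda>u. pdir (b, 0) \<phi> ((u, 0) + (0, snd p)))"
    by (rule pdir_affine[where l = "\<lambda>u. (u, 0)"])
      (auto intro: schwartz_differentiable s bounded_linear_Pair bounded_linear_zero bounded_linear_ident)
  then have pf: "pdir b ?f = (\<lambda>u. pdir (b, 0) \<phi> (u, snd p))" by simp
  have "0 = (LINT u|lborel. pdir b (\<lambda>u. ?e u * ?f u) u)"
    by (rule integral_pdir_eq_0[OF schwartz_mult_slow[OF se sf] b, symmetric])
  also have "\<dots> = (LINT u|lborel. ((2 * pi * \<i>) * of_real (- (fst p \<bullet> b))) * (?e u * ?f u) + ?e u * pdir (b, 0) \<phi> (u, snd p))"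
    by (subst pdir_mult) (simp_all add: slow_differentiable se schwartz_differentiable sf pe pf mult.assoc)
  also have "\<dots> = ((2 * pi * \<i>) * of_real (- (fst p \<bullet> b))) * pfourier \<phi> p + pfourier (pdir (b, 0) \<phi>) p"
    unfolding pfourier_unit_exp
    by (subst Bochner_Integration.integral_add)
      (auto intro!: integrable_mult_right schwartz_integrable schwartz_mult_slow slow_const se sf sp)
  finally show ?thesis by (simp add: algebra_simps add_eq_0_iff)
qed

text \<open>The weight in the variable that is not transformed passes under the integral.  Each factor
\<open>1 + norm (fst p)\<close> costs one integration by parts: the coordinates of \<open>fst p\<close> turn into
derivatives of \<open>\<phi>\<close>.\<close>

lemma pfourier_bound_aux:
  "seminorm_bounded (\<lambda>p. ((1 + norm (fst p)) ^ j * (1 + norm (snd p)) ^ M)) (\<lambda>(\<phi> :: 'a::euclidean_space \<times> 'b::euclidean_space \<Rightarrow> complex) p. pfourier \<phi> p)"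
proof (induction j)
  case 0
  let ?C = "LINT x|lborel. decay_weight (x :: 'a)"
  have "(1 + norm (snd p)) ^ M * norm (pfourier \<phi> p) \<le> ?C * schwartz_seminorm (M + 2 * DIM('a)) \<phi>"
    if s: "schwartz \<phi>" for \<phi> :: "'a \<times> 'b \<Rightarrow> complex" and p
  proof -
    let ?F = "\<lambda>u. of_real ((1 + norm (snd p)) ^ M) * (unit_exp (- (fst p \<bullet> u)) * \<phi> (u, snd p))"
    have "schwartz (\<lambda>u. unit_exp (- (fst p \<bullet> u)) * \<phi> (u, snd p))"
      using schwartz_mult_slow[OF slow_unit_exp_inner[of "- fst p"] schwartz_fst_slice[OF s]] by simp
    then have "continuous_on UNIV ?F" by (intro schwartz_continuous schwartz_cmult)
    moreover have "norm (?F u) \<le> schwartz_seminorm (M + 2 * DIM('a)) \<phi> * decay_weight u" for u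
      using slice_pderivs_decay[OF s, of "[]"] by (simp add: norm_mult norm_power del: of_real_power of_real_add)
    ultimately have "norm (LINT u|lborel. ?F u) \<le> schwartz_seminorm (M + 2 * DIM('a)) \<phi> * ?C"
      by (rule norm_integral_decay)
    then show ?thesis
      by (simp add: pfourier_unit_exp norm_mult mult.commute del: of_real_power of_real_add)
  qed
  then show ?case by (intro exI[of _ ?C] exI[of _ "M + 2 * DIM('a)"]) simp
next
  case (Suc j)
  have comp: "seminorm_bounded (\<lambda>p. ((1 + norm (fst p)) ^ j * (1 + norm (snd p)) ^ M)) (\<lambda>(\<phi> :: 'a \<times> 'b \<Rightarrow> complex) p. pfourier (pdir v \<phi>) p)" for v
    by (rule seminorm_bound_compose[OF Suc.IH scont_pdir_any])
  let ?W = "\<lambda>p :: 'a \<times> 'b. (1 + norm (fst p)) ^ j * (1 + norm (snd p)) ^ M"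
  obtain C0 K0 where C0: "\<And>(\<phi> :: 'a \<times> 'b \<Rightarrow> complex) p. schwartz \<phi> \<Longrightarrow> ?W p * norm (pfourier \<phi> p) \<le> C0 * schwartz_seminorm K0 \<phi>"
    using Suc.IH by blast
  have "\<forall>b\<in>(Basis :: 'a set). \<exists>CK. \<forall>\<phi> :: 'a \<times> 'b \<Rightarrow> complex. schwartz \<phi> \<longrightarrow>
    (\<forall>p. ?W p * norm (pfourier (pdir (b, 0) \<phi>) p) \<le> fst CK * schwartz_seminorm (snd CK) \<phi>)"
    using comp by (metis fst_conv snd_conv)
  from bchoice[OF this] obtain CK where CK: "\<And>b (\<phi> :: 'a \<times> 'b \<Rightarrow> complex) p. b \<in> Basis \<Longrightarrow> schwartz \<phi> \<Longrightarrow>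
    ?W p * norm (pfourier (pdir (b, 0) \<phi>) p) \<le> fst (CK b) * schwartz_seminorm (snd (CK b)) \<phi>"
    by blast
  let ?C = "\<bar>C0\<bar> + (\<Sum>b\<in>Basis. \<bar>fst (CK b)\<bar>)" and ?K = "K0 + (\<Sum>b\<in>Basis. snd (CK b))"
  have "((1 + norm (fst p)) ^ Suc j * (1 + norm (snd p)) ^ M) * norm (pfourier \<phi> p) \<le> ?C * schwartz_seminorm ?K \<phi>"
    if s: "schwartz \<phi>" for \<phi> :: "'a \<times> 'b \<Rightarrow> complex" and p
  proof -
    have 0: "?W p * norm (pfourier \<phi> p) \<le> \<bar>C0\<bar> * schwartz_seminorm ?K \<phi>"
      by (rule order_trans[OF C0[OF s]], intro mult_mono schwartz_seminorm_mono s schwartz_seminorm_nonneg) auto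
    have b: "?W p * norm (pfourier (pdir (b, 0) \<phi>) p) \<le> \<bar>fst (CK b)\<bar> * schwartz_seminorm ?K \<phi>" if "b \<in> Basis" for b
    proof -
      have "snd (CK b) \<le> (\<Sum>b\<in>Basis. snd (CK b))" by (rule member_le_sum[OF that]) auto
      then show ?thesis
        by (intro order_trans[OF CK[OF that s]] mult_mono schwartz_seminorm_mono s schwartz_seminorm_nonneg) auto
    qed
    have "norm (fst p) * norm (pfourier \<phi> p) \<le> (\<Sum>b\<in>Basis. \<bar>fst p \<bullet> b\<bar>) * norm (pfourier \<phi> p)"
      by (intro mult_right_mono norm_le_l1) auto
    also have "\<dots> \<le> (\<Sum>b\<in>Basis. norm (pfourier (pdir (b, 0) \<phi>) p))"
      unfolding sum_distrib_right
    proof (rule sum_mono)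
      fix b :: 'a assume b: "b \<in> Basis"
      have "1 * (\<bar>fst p \<bullet> b\<bar> * norm (pfourier \<phi> p)) \<le> (2 * pi) * (\<bar>fst p \<bullet> b\<bar> * norm (pfourier \<phi> p))"
        using pi_gt3 by (intro mult_right_mono) auto
      also have "\<dots> = norm (pfourier (pdir (b, 0) \<phi>) p)"
        by (simp add: pfourier_pdir_fst[OF s b] norm_mult)
      finally show "\<bar>fst p \<bullet> b\<bar> * norm (pfourier \<phi> p) \<le> norm (pfourier (pdir (b, 0) \<phi>) p)" by simp
    qed
    finally have 1: "norm (fst p) * norm (pfourier \<phi> p) \<le> (\<Sum>b\<in>Basis. norm (pfourier (pdir (b, 0) \<phi>) p))" .
    have "((1 + norm (fst p)) ^ Suc j * (1 + norm (snd p)) ^ M) * norm (pfourier \<phi> p)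
        = ?W p * norm (pfourier \<phi> p) + ?W p * (norm (fst p) * norm (pfourier \<phi> p))"
      by (simp add: algebra_simps)
    also have "\<dots> \<le> ?W p * norm (pfourier \<phi> p) + ?W p * (\<Sum>b\<in>Basis. norm (pfourier (pdir (b, 0) \<phi>) p))"
      by (intro add_left_mono mult_left_mono 1) auto
    also have "\<dots> \<le> \<bar>C0\<bar> * schwartz_seminorm ?K \<phi> + (\<Sum>b\<in>Basis. \<bar>fst (CK b)\<bar> * schwartz_seminorm ?K \<phi>)"
      unfolding sum_distrib_left by (intro add_mono 0 sum_mono b)
    finally show ?thesis by (simp add: distrib_right sum_distrib_right)
  qed
  then show ?case by blast
qed

lemma scont_pfourier: "scont (pfourier :: ('a::euclidean_space \<times> 'b::euclidean_space \<Rightarrow> complex) \<Rightarrow> _)"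
proof (rule scont_single)
  fix M
  obtain C K where C: "\<And>(\<phi> :: 'a \<times> 'b \<Rightarrow> complex) p. schwartz \<phi> \<Longrightarrow>
     ((1 + norm (fst p)) ^ M * (1 + norm (snd p)) ^ M) * norm (pfourier \<phi> p) \<le> C * schwartz_seminorm K \<phi>"
    using pfourier_bound_aux by blast
  have "(1 + norm p) ^ M * norm (pfourier \<phi> p) \<le> C * schwartz_seminorm K \<phi>" if "schwartz \<phi>"
    for \<phi> :: "'a \<times> 'b \<Rightarrow> complex" and p
  proof -
    have "(1 + norm p) ^ M * norm (pfourier \<phi> p) \<le> ((1 + norm (fst p)) * (1 + norm (snd p))) ^ M * norm (pfourier \<phi> p)"
      by (intro mult_right_mono one_plus_norm_le) auto
    with C[OF that, of p] show ?thesis by (simp add: power_mult_distrib)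
  qed
  then show "seminorm_bounded (\<lambda>p. (1 + norm p) ^ M) (\<lambda>(\<phi> :: 'a \<times> 'b \<Rightarrow> complex) p. pfourier \<phi> p)" by blast
next
  show "pfourier \<phi> differentiable at p" if "schwartz \<phi>" for \<phi> :: "'a \<times> 'b \<Rightarrow> complex" and p
    using has_derivative_pfourier[OF that] differentiable_def by blast
next
  fix b :: "'a \<times> 'b"
  have "pdir b (pfourier \<phi>) = pfourier (pfourier_deriv b \<phi>)" if "schwartz \<phi>" for \<phi> :: "'a \<times> 'b \<Rightarrow> complex"
    using pdir_eqI[OF has_derivative_pfourier[OF that], of b] by simp
  then show "\<exists>B. scont B \<and> (\<forall>\<phi> :: 'a \<times> 'b \<Rightarrow> complex. schwartz \<phi> \<longrightarrow> pdir b (pfourier \<phi>) = pfourier (B \<phi>))"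
    using scont_pfourier_deriv by blast
qed

text \<open>Restricting the partial transform of \<open>f\<close> times a Gaussian to \<open>snd p = 0\<close>, where the Gaussian is \<open>1\<close>,
gives the transform of \<open>f\<close>.\<close>

lemma schwartz_fourier:
  fixes f :: "'a::euclidean_space \<Rightarrow> complex"
  assumes "schwartz f" shows "schwartz (fourier f)"
proof -
  let ?g = "\<lambda>x :: 'a. complex_of_real (exp (- 1 * (x \<bullet> x)))"
  have "schwartz (pfourier (\<lambda>p. f (fst p) * ?g (snd p)))"
    using scont_schwartz[OF scont_pfourier scont_schwartz[OF scont_tensor[OF schwartz_gaussian[of 1]] assms]] by simp
  from schwartz_fst_slice[OF this, of 0] show ?thesis by (simp add: pfourier_def)
qed

lemma schwartz_reflect: "schwartz f \<Longrightarrow> schwartz (\<lambda>x. f (- x))"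
  using scont_schwartz[OF scont_affine[of uminus uminus 0]]
  by (simp add: bounded_linear_minus bounded_linear_ident)

lemma schwartz_inv_fourier: "schwartz f \<Longrightarrow> schwartz (inv_fourier f)"
  using schwartz_reflect[OF schwartz_fourier] by (simp add: inv_fourier_eq_fourier[abs_def])

section \<open>Fourier inversion\<close>

abbreviation std_gaussian :: "'a::euclidean_space \<Rightarrow> complex" where
  "std_gaussian x \<equiv> of_real (exp (- pi * (x \<bullet> x)))"

text \<open>The characteristic function of the standard normal distribution, rescaled by \<open>sqrt (2 * pi)\<close>.\<close>

lemma fourier_std_gaussian_real:
  "(LINT s|lborel. unit_exp (- (k * s)) * of_real (exp (- pi * s\<^sup>2))) = of_real (exp (- pi * k\<^sup>2))"
proof -
  let ?c = "sqrt (2 * pi)"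
  let ?t = "- ?c * k"
  have c: "?c > 0" by simp
  have "complex_of_real (exp (- (?t\<^sup>2) / 2)) = char std_normal_distribution ?t"
    by (simp add: char_std_normal_distribution)
  also have "\<dots> = (LINT x|lborel. std_normal_density x *\<^sub>R iexp (?t * x))"
    unfolding char_def by (intro integral_density) (simp_all add: normal_density_nonneg)
  also have "\<dots> = \<bar>?c\<bar> *\<^sub>R (LINT s|lborel. std_normal_density (0 + ?c * s) *\<^sub>R iexp (?t * (0 + ?c * s)))"
    using c by (intro lborel_integral_real_affine) simp
  also have "\<dots> = (LINT s|lborel. \<bar>?c\<bar> *\<^sub>R (std_normal_density (0 + ?c * s) *\<^sub>R iexp (?t * (0 + ?c * s))))"
    by (rule integral_scaleR_right[symmetric])
  also have "\<dots> = (LINT s|lborel. unit_exp (- (k * s)) * of_real (exp (- pi * s\<^sup>2)))"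
  proof (rule Bochner_Integration.integral_cong[OF refl])
    fix s :: real
    have "?t * (0 + ?c * s) = - (2 * pi * (k * s))" by (simp add: algebra_simps flip: real_sqrt_mult)
    then have 1: "iexp (?t * (0 + ?c * s)) = unit_exp (- (k * s))"
      by (simp add: unit_exp_def algebra_simps)
    have "(0 + ?c * s)\<^sup>2 = 2 * pi * s\<^sup>2" by (simp add: power_mult_distrib)
    then have 2: "\<bar>?c\<bar> * std_normal_density (0 + ?c * s) = exp (- pi * s\<^sup>2)"
      unfolding std_normal_density_def by simp
    show "\<bar>?c\<bar> *\<^sub>R (std_normal_density (0 + ?c * s) *\<^sub>R iexp (?t * (0 + ?c * s))) = unit_exp (- (k * s)) * of_real (exp (- pi * s\<^sup>2))"
      unfolding scaleR_scaleR 1 2 by (simp add: scaleR_conv_of_real mult.commute)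
  qed
  finally show ?thesis by (simp add: power_mult_distrib)
qed

lemma integrable_std_gaussian_real:
  "integrable lborel (\<lambda>s :: real. unit_exp (- (k * s)) * of_real (exp (- pi * s\<^sup>2)))"
  using schwartz_integrable[OF schwartz_mult_slow[OF slow_unit_exp_inner[of "- k"] schwartz_gaussian[of pi]]]
  by (simp add: power2_eq_square)

lemma schwartz_std_gaussian: "schwartz std_gaussian"
  by (rule schwartz_gaussian) simp

lemma unit_exp_sum: "finite I \<Longrightarrow> unit_exp (\<Sum>i\<in>I. f i) = (\<Prod>i\<in>I. unit_exp (f i))"
  by (induction I rule: finite_induct) (simp_all add: unit_exp_add)

lemma fourier_std_gaussian: "fourier std_gaussian k = std_gaussian (k :: 'a::euclidean_space)"
proof -
  have e: "std_gaussian (x :: 'a) = (\<Prod>b\<in>Basis. of_real (exp (- pi * (x \<bullet> b)\<^sup>2)))" for x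
    by (subst euclidean_inner) (simp add: power2_eq_square sum_distrib_left exp_sum flip: of_real_prod sum_negf)
  have "unit_exp (- (k \<bullet> x)) = (\<Prod>b\<in>Basis. unit_exp (- ((k \<bullet> b) * (x \<bullet> b))))" for x
    by (subst euclidean_inner) (simp add: unit_exp_sum flip: sum_negf)
  then have "fourier std_gaussian k = (LINT x|lborel. (\<Prod>b\<in>Basis. unit_exp (- ((k \<bullet> b) * (x \<bullet> b))) * of_real (exp (- pi * (x \<bullet> b)\<^sup>2))))"
    unfolding fourier_unit_exp e by (simp add: prod.distrib)
  also have "\<dots> = (\<Prod>b\<in>Basis. (LINT s|lborel. unit_exp (- ((k \<bullet> b) * s)) * of_real (exp (- pi * s\<^sup>2))))"
    by (rule integral_lborel_prod) (rule integrable_std_gaussian_real)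
  finally show ?thesis unfolding fourier_std_gaussian_real e .
qed

lemma integral_std_gaussian: "(LINT x|lborel. std_gaussian (x :: 'a::euclidean_space)) = 1"
  using fourier_std_gaussian[of "0 :: 'a"] by (simp add: fourier_unit_exp)

lemma schwartz_bounded:
  assumes "schwartz f" obtains C where "C \<ge> 0" "\<And>x. norm (f x) \<le> C"
  using schwartz_decay[OF assms, of 0] by auto

lemma integrable_tensor:
  fixes f :: "'a::euclidean_space \<Rightarrow> complex" and g :: "'b::euclidean_space \<Rightarrow> complex"
  assumes "schwartz f" "schwartz g" "continuous_on UNIV m" "\<And>p. norm (m p) \<le> 1"
  shows "integrable lborel (\<lambda>p. m p * (f (fst p) * g (snd p)))"
proof (rule Bochner_Integration.integrable_bound)
  have s: "schwartz (\<lambda>p. f (fst p) * g (snd p))" by (rule scont_schwartz[OF scont_tensor]) fact+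
  then show "integrable lborel (\<lambda>p. f (fst p) * g (snd p))" by (rule schwartz_integrable)
  show "(\<lambda>p. m p * (f (fst p) * g (snd p))) \<in> borel_measurable lborel"
    using borel_measurable_continuous_onI[OF continuous_on_mult[OF assms(3) schwartz_continuous[OF s]]] by simp
  show "AE p in lborel. norm (m p * (f (fst p) * g (snd p))) \<le> norm (f (fst p) * g (snd p))"
    using assms(4) by (intro AE_I2) (simp add: norm_mult mult_left_le_one_le)
qed

lemma borel_measurable_lborel_continuous:
  fixes f :: "'a::euclidean_space \<Rightarrow> complex"
  shows "continuous_on UNIV f \<Longrightarrow> f \<in> borel_measurable lborel"
  using borel_measurable_continuous_onI by simp

text \<open>With a Gaussian cutoff the inversion integral converges absolutely as a double integral.  Evaluating
the inner integral after Fubini's theorem gives a Gaussian average of \<open>f\<close> around \<open>x\<close>.\<close>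

lemma inv_fourier_fourier_approx:
  fixes f :: "'a::euclidean_space \<Rightarrow> complex"
  assumes f: "schwartz f" and e: "e > 0"
  shows "(LINT k|lborel. unit_exp (x \<bullet> k) * std_gaussian (e *\<^sub>R k) * fourier f k)
    = (LINT z|lborel. f (x + e *\<^sub>R z) * std_gaussian z)"
proof -
  have sg: "schwartz (\<lambda>k :: 'a. std_gaussian (e *\<^sub>R k))"
    using e schwartz_gaussian[of "pi * e * e"] by (simp add: mult_ac)
  have "(LINT k|lborel. unit_exp (x \<bullet> k) * std_gaussian (e *\<^sub>R k) * fourier f k)
     = (LINT k|lborel. (LINT y|lborel. unit_exp (k \<bullet> (x - y)) * (std_gaussian (e *\<^sub>R k) * f y)))"
    unfolding fourier_unit_exp
    by (subst integral_mult_right_zero[symmetric])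
      (simp add: inner_diff_right unit_exp_add[of _ "- _", simplified] inner_commute mult_ac)
  also have "\<dots> = (LINT y|lborel. (LINT k|lborel. unit_exp (k \<bullet> (x - y)) * (std_gaussian (e *\<^sub>R k) * f y)))"
    by (rule Fubini_lborel, rule integrable_tensor[OF sg f]) (auto intro!: continuous_intros)
  also have "\<dots> = (LINT y|lborel. f y * (of_real (1 / e ^ DIM('a)) * std_gaussian ((1 / e) *\<^sub>R (y - x))))"
  proof (rule Bochner_Integration.integral_cong[OF refl])
    fix y
    have i: "integrable lborel (\<lambda>k. unit_exp (k \<bullet> (x - y)) * std_gaussian (e *\<^sub>R k))"
      using schwartz_integrable[OF schwartz_mult_slow[OF slow_unit_exp_inner[of "x - y"] sg]] by (simp add: inner_commute)
    have "(LINT k|lborel. unit_exp (k \<bullet> (x - y)) * (std_gaussian (e *\<^sub>R k) * f y))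
       = f y * (LINT k|lborel. unit_exp (k \<bullet> (x - y)) * std_gaussian (e *\<^sub>R k))"
      by (subst integral_mult_right_zero[symmetric]) (simp add: mult_ac)
    also have "(LINT k|lborel. unit_exp (k \<bullet> (x - y)) * std_gaussian (e *\<^sub>R k))
        = of_real (\<bar>1 / e\<bar> ^ DIM('a)) * (LINT s|lborel. unit_exp ((0 + (1 / e) *\<^sub>R s) \<bullet> (x - y)) * std_gaussian (e *\<^sub>R (0 + (1 / e) *\<^sub>R s)))"
      using e by (intro integral_lborel_affine[OF i]) simp
    also have "\<dots> = of_real (1 / e ^ DIM('a)) * fourier std_gaussian ((1 / e) *\<^sub>R (y - x))"
      using e by (simp add: fourier_unit_exp power_divide inner_diff_left inner_diff_right inner_commute right_diff_distrib divide_inverse power_inverse)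
    finally show "(LINT k|lborel. unit_exp (k \<bullet> (x - y)) * (std_gaussian (e *\<^sub>R k) * f y))
       = f y * (of_real (1 / e ^ DIM('a)) * std_gaussian ((1 / e) *\<^sub>R (y - x)))"
      unfolding fourier_std_gaussian .
  qed
  also have "\<dots> = of_real (\<bar>e\<bar> ^ DIM('a)) * (LINT z|lborel. f (x + e *\<^sub>R z) * (of_real (1 / e ^ DIM('a)) * std_gaussian ((1 / e) *\<^sub>R (x + e *\<^sub>R z - x))))"
  proof (rule integral_lborel_affine)
    have "schwartz (\<lambda>y. std_gaussian ((1 / e) *\<^sub>R y + (- (1 / e) *\<^sub>R x)))"
      using e by (intro scont_schwartz[OF scont_affine[where l' = "\<lambda>y. e *\<^sub>R y"] schwartz_std_gaussian])
        (auto intro: bounded_linear_scaleR_right)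
    then have "schwartz (\<lambda>y. of_real (1 / e ^ DIM('a)) * std_gaussian ((1 / e) *\<^sub>R (y - x)))"
      by (intro schwartz_cmult) (simp add: scaleR_diff_right)
    then show "integrable lborel (\<lambda>y. f y * (of_real (1 / e ^ DIM('a)) * std_gaussian ((1 / e) *\<^sub>R (y - x))))"
      by (intro schwartz_integrable schwartz_mult_slow[OF schwartz_slow[OF f]])
  qed (use e in simp)
  also have "\<dots> = (LINT z|lborel. f (x + e *\<^sub>R z) * std_gaussian z)"
    using e by (subst integral_mult_right_zero[symmetric]) (simp add: mult_ac)
  finally show ?thesis .
qed

text \<open>Let the cutoff parameter tend to \<open>0\<close>: both sides of the regularized formula converge by dominated
convergence, the right-hand side to \<open>f x\<close> because the Gaussian has integral \<open>1\<close>.\<close>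

theorem inv_fourier_fourier:
  fixes f :: "'a::euclidean_space \<Rightarrow> complex"
  assumes f: "schwartz f"
  shows "inv_fourier (fourier f) x = f x"
proof -
  define e where "e n = inverse (real (Suc n))" for n
  have e0: "e \<longlonglongrightarrow> 0" unfolding e_def by (rule LIMSEQ_inverse_real_of_nat)
  have ep: "e n > 0" for n by (simp add: e_def)
  have sF: "schwartz (fourier f)" by (rule schwartz_fourier[OF f])
  obtain C where C: "C \<ge> 0" "\<And>x. norm (f x) \<le> C" using schwartz_bounded[OF f] by blast
  have fx: "continuous_on UNIV (\<lambda>z. f (x + c *\<^sub>R z))" for c
    by (rule continuous_on_compose2[OF schwartz_continuous[OF f, of UNIV]]) (auto intro!: continuous_intros)
  \<comment> \<open>Integrability of the transform of \<open>f\<close> provides the dominating function.\<close>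
  have 1: "(\<lambda>n. LINT k|lborel. unit_exp (x \<bullet> k) * std_gaussian (e n *\<^sub>R k) * fourier f k)
      \<longlonglongrightarrow> (LINT k|lborel. unit_exp (x \<bullet> k) * fourier f k)"
  proof (rule integral_dominated_convergence[where w = "\<lambda>k. norm (fourier f k)"])
    show "integrable lborel (\<lambda>k. norm (fourier f k))" by (intro integrable_norm schwartz_integrable sF)
    show "(\<lambda>k. unit_exp (x \<bullet> k) * fourier f k) \<in> borel_measurable lborel"
      by (intro borel_measurable_lborel_continuous continuous_intros schwartz_continuous sF)
    show "(\<lambda>k. unit_exp (x \<bullet> k) * std_gaussian (e n *\<^sub>R k) * fourier f k) \<in> borel_measurable lborel" for n
      by (intro borel_measurable_lborel_continuous continuous_intros schwartz_continuous sF)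
    show "AE k in lborel. (\<lambda>n. unit_exp (x \<bullet> k) * std_gaussian (e n *\<^sub>R k) * fourier f k) \<longlonglongrightarrow> unit_exp (x \<bullet> k) * fourier f k"
    proof (rule AE_I2)
      fix k :: 'a
      have "(\<lambda>n. unit_exp (x \<bullet> k) * std_gaussian (e n *\<^sub>R k) * fourier f k) \<longlonglongrightarrow> unit_exp (x \<bullet> k) * std_gaussian (0 *\<^sub>R k) * fourier f k"
        by (intro tendsto_intros e0)
      then show "(\<lambda>n. unit_exp (x \<bullet> k) * std_gaussian (e n *\<^sub>R k) * fourier f k) \<longlonglongrightarrow> unit_exp (x \<bullet> k) * fourier f k" by simp
    qed
    show "AE k in lborel. norm (unit_exp (x \<bullet> k) * std_gaussian (e n *\<^sub>R k) * fourier f k) \<le> norm (fourier f k)" for n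
      by (intro AE_I2) (auto simp: norm_mult intro!: mult_left_le_one_le mult_nonneg_nonneg less_imp_le[OF ep])
  qed
  have 2: "(\<lambda>n. LINT z|lborel. f (x + e n *\<^sub>R z) * std_gaussian z) \<longlonglongrightarrow> (LINT z|lborel. f x * std_gaussian (z :: 'a))"
  proof (rule integral_dominated_convergence[where w = "\<lambda>z :: 'a. C * norm (std_gaussian z)"])
    show "integrable lborel (\<lambda>z :: 'a. C * norm (std_gaussian z))"
      by (intro integrable_mult_right integrable_norm schwartz_integrable schwartz_std_gaussian)
    show "(\<lambda>z :: 'a. f x * std_gaussian z) \<in> borel_measurable lborel"
      by (intro borel_measurable_lborel_continuous continuous_intros)
    show "(\<lambda>z. f (x + e n *\<^sub>R z) * std_gaussian z) \<in> borel_measurable lborel" for n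
      by (intro borel_measurable_lborel_continuous continuous_intros fx)
    show "AE z in lborel. (\<lambda>n. f (x + e n *\<^sub>R z) * std_gaussian z) \<longlonglongrightarrow> f x * std_gaussian z"
    proof (rule AE_I2)
      fix z :: 'a
      have "isCont f (x + 0 *\<^sub>R z)"
        using schwartz_continuous[OF f, of UNIV] by (simp add: continuous_on_eq_continuous_at)
      then have "(\<lambda>n. f (x + e n *\<^sub>R z)) \<longlonglongrightarrow> f (x + 0 *\<^sub>R z)"
        by (rule isCont_tendsto_compose) (intro tendsto_intros e0)
      then have "(\<lambda>n. f (x + e n *\<^sub>R z) * std_gaussian z) \<longlonglongrightarrow> f (x + 0 *\<^sub>R z) * std_gaussian z"
        by (intro tendsto_intros)
      then show "(\<lambda>n. f (x + e n *\<^sub>R z) * std_gaussian z) \<longlonglongrightarrow> f x * std_gaussian z" by simp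
    qed
    show "AE z in lborel. norm (f (x + e n *\<^sub>R z) * std_gaussian z) \<le> C * norm (std_gaussian z)" for n
      using C by (intro AE_I2) (simp add: norm_mult mult_right_mono)
  qed
  have "(LINT z|lborel. f x * std_gaussian (z :: 'a)) = f x"
    using integral_std_gaussian[where 'a = 'a] by simp
  then show ?thesis
    using LIMSEQ_unique[OF 1 2[folded inv_fourier_fourier_approx[OF f ep]]]
    by (simp add: inv_fourier_unit_exp)
qed

text \<open>The two orders of composition differ by reflections of the variable on both sides.\<close>

corollary fourier_inv_fourier:
  assumes f: "schwartz f"
  shows "fourier (inv_fourier f) k = f k"
proof -
  have "fourier (\<lambda>x. fourier f (- x)) k = fourier (fourier f) (- k)"
  proof -
    have "(LINT x|lborel. unit_exp (- (k \<bullet> - x)) * fourier f x)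
        = of_real (\<bar>- 1\<bar> ^ DIM('a)) * (LINT x|lborel. unit_exp (- (k \<bullet> - (0 + (-1) *\<^sub>R x))) * fourier f (0 + (-1) *\<^sub>R x))"
      using schwartz_integrable[OF schwartz_mult_slow[OF slow_unit_exp_inner[of k] schwartz_fourier[OF f]]]
      by (intro integral_lborel_affine) auto
    then show ?thesis by (simp add: fourier_unit_exp)
  qed
  then show ?thesis
    using inv_fourier_fourier[OF f, of k] by (simp add: inv_fourier_eq_fourier[abs_def])
qed

section \<open>Integrals under a tempered distribution\<close>

lemma decay_weight_tail:
  assumes "\<epsilon> > 0"
  obtains n :: nat where
    "(LINT x|lborel. decay_weight (x :: 'a::euclidean_space) * indicator (- cbox (- real n *\<^sub>R One) (real n *\<^sub>R One)) x) < \<epsilon>"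
proof -
  let ?B = "\<lambda>n :: nat. cbox (- real n *\<^sub>R One) (real n *\<^sub>R One) :: 'a set"
  have "(\<lambda>n. LINT x|lborel. decay_weight x * indicator (- ?B n) x) \<longlonglongrightarrow> (LINT x|lborel. 0 * decay_weight (x :: 'a))"
  proof (rule integral_dominated_convergence[where w = decay_weight])
    show "integrable lborel (decay_weight :: 'a \<Rightarrow> real)" by (rule integrable_decay_weight)
    have [measurable]: "(decay_weight :: 'a \<Rightarrow> real) \<in> borel_measurable borel"
      using borel_measurable_integrable[OF integrable_decay_weight] by simp
    show "(\<lambda>x. decay_weight x * indicator (- ?B n) x) \<in> borel_measurable lborel" for n
      by measurable
    show "AE x in lborel. norm (decay_weight x * indicator (- ?B n) x) \<le> decay_weight x" for n
      by (auto simp: decay_weight_nonneg split: split_indicator)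
    show "AE x in lborel. (\<lambda>n. decay_weight x * indicator (- ?B n) x) \<longlonglongrightarrow> 0 * decay_weight x"
    proof (rule AE_I2)
      fix x :: 'a
      obtain m :: nat where m: "norm x \<le> real m" using real_arch_simple by blast
      have "x \<in> ?B n" if "n \<ge> m" for n
      proof -
        have "\<bar>x \<bullet> b\<bar> \<le> real n" if "b \<in> Basis" for b
          using Basis_le_norm[OF that, of x] m \<open>n \<ge> m\<close> by simp
        then show ?thesis by (force simp: mem_box abs_le_iff)
      qed
      then have "eventually (\<lambda>n. decay_weight x * indicator (- ?B n) x = (0 :: real)) sequentially"
        unfolding eventually_sequentially by (intro exI[of _ m]) auto
      then show "(\<lambda>n. decay_weight x * indicator (- ?B n) x) \<longlonglongrightarrow> 0 * decay_weight x"
        by (intro tendsto_eventually) simp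
    qed
  qed auto
  then have "eventually (\<lambda>n. (LINT x|lborel. decay_weight x * indicator (- ?B n) x) < \<epsilon>) sequentially"
    using assms by (auto dest: order_tendstoD(2))
  then show ?thesis using that unfolding eventually_sequentially by blast
qed

text \<open>A single Riemann sum approximates the integrals of all functions with the given Lipschitz constant and
decay rate.  The uniformity over \<open>F\<close> is the point: the same nodes then serve all the finitely many
derivatives, and all parameters, that enter a seminorm.\<close>

lemma uniform_quadrature:
  fixes \<alpha> \<beta> \<epsilon> :: real
  assumes \<epsilon>: "\<epsilon> > 0" and \<alpha>: "\<alpha> \<ge> 0" and \<beta>: "\<beta> \<ge> 0"
  obtains p :: "('a::euclidean_space \<times> 'a set) set" where "finite p"
    "\<And>F :: 'a \<Rightarrow> complex. (\<And>x y. norm (F x - F y) \<le> \<beta> * norm (x - y)) \<Longrightarrow>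
       (\<And>x. norm (F x) \<le> \<alpha> * decay_weight x) \<Longrightarrow>
       norm ((LINT x|lborel. F x) - (\<Sum>(x, K)\<in>p. of_real (measure lborel K) * F x)) \<le> \<epsilon>"
proof -
  have "\<epsilon> / (2 * (\<alpha> + 1)) > 0" using \<epsilon> \<alpha> by simp
  then obtain n :: nat where
    n: "(LINT x|lborel. decay_weight (x :: 'a) * indicator (- cbox (- real n *\<^sub>R One) (real n *\<^sub>R One)) x) < \<epsilon> / (2 * (\<alpha> + 1))"
    by (rule decay_weight_tail)
  define a b where "a = - real n *\<^sub>R (One :: 'a)" and "b = real n *\<^sub>R (One :: 'a)"
  define V where "V = measure lborel (cbox a b)"
  have V: "V \<ge> 0" by (simp add: V_def)
  \<comment> \<open>The mesh makes the error on the box at most \<open>\<epsilon> / 2\<close>; the summands \<open>1\<close> only keep the denominator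
    positive when \<open>\<beta>\<close> or \<open>V\<close> vanishes.\<close>
  define \<delta> where "\<delta> = \<epsilon> / (2 * (\<beta> + 1) * (V + 1))"
  have \<delta>: "\<delta> > 0" using \<epsilon> \<beta> V by (simp add: \<delta>_def)
  have \<delta>le: "\<beta> * \<delta> * V \<le> \<epsilon> / 2"
  proof -
    have "\<beta> * V \<le> (\<beta> + 1) * (V + 1)" using \<beta> V by (intro mult_mono) auto
    moreover have "0 < (\<beta> + 1) * (V + 1)" using \<beta> V by simp
    ultimately have "\<beta> * V / ((\<beta> + 1) * (V + 1)) \<le> 1" by (simp only: divide_le_eq_1_pos)
    then have "(\<epsilon> / 2) * (\<beta> * V / ((\<beta> + 1) * (V + 1))) \<le> (\<epsilon> / 2) * 1"
      using \<epsilon> by (intro mult_left_mono) auto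
    then show ?thesis by (simp only: \<delta>_def times_divide_eq_left times_divide_eq_right divide_divide_eq_left mult_ac mult_1_right)
  qed
  obtain p where p: "p tagged_division_of cbox a b" "(\<lambda>x. ball x \<delta>) fine p"
    using fine_division_exists[OF gauge_ball[OF \<delta>]] by blast
  show ?thesis
  proof (rule that[of p])
    show "finite p" using p by blast
  next
    fix F :: "'a \<Rightarrow> complex"
    assume lip: "\<And>x y. norm (F x - F y) \<le> \<beta> * norm (x - y)"
      and dec: "\<And>x. norm (F x) \<le> \<alpha> * decay_weight x"
    have "\<beta>-lipschitz_on UNIV F"
      using lip \<beta> by (intro lipschitz_onI) (auto simp: dist_norm)
    then have cont: "continuous_on UNIV F" by (rule lipschitz_on_continuous_on)
    have intF: "integrable lborel F" by (rule integrable_decay[OF cont dec])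
    have intS: "set_integrable lborel (cbox a b) F" "set_integrable lborel (- cbox a b) F"
      unfolding set_integrable_def by (intro integrable_mult_indicator intF; simp)+
    have "(LINT x|lborel. F x) = (LINT x:cbox a b|lborel. F x) + (LINT x:- cbox a b|lborel. F x)"
      using set_integral_Un[OF _ intS] by (simp add: set_lebesgue_integral_def Un_commute)
    then have split: "(LINT x|lborel. F x) = integral (cbox a b) F + (LINT x:- cbox a b|lborel. F x)"
      using set_borel_integral_eq_integral(2)[OF intS(1)] by simp
    have tail: "norm (LINT x:- cbox a b|lborel. F x) \<le> \<epsilon> / 2"
    proof -
      have mw: "integrable lborel (\<lambda>x. \<alpha> * (decay_weight x * indicator (- cbox a b) x))"
        using integrable_mult_indicator[OF _ integrable_decay_weight, of "- cbox a b"]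
        by (intro integrable_mult_right) (simp add: mult.commute)
      have "norm (LINT x:- cbox a b|lborel. F x) \<le> (LINT x|lborel. norm (indicator (- cbox a b) x *\<^sub>R F x))"
        unfolding set_lebesgue_integral_def by (rule integral_norm_bound)
      also have "\<dots> \<le> (LINT x|lborel. \<alpha> * (decay_weight x * indicator (- cbox a b) x))"
        using intS(2) dec unfolding set_integrable_def
        by (intro integral_mono mw integrable_norm) (auto split: split_indicator)
      also have "\<dots> = \<alpha> * (LINT x|lborel. decay_weight x * indicator (- cbox a b) x)" by simp
      also have "\<dots> \<le> \<alpha> * (\<epsilon> / (2 * (\<alpha> + 1)))"
        using n \<alpha> unfolding a_def b_def by (intro mult_left_mono) auto
      also have "\<dots> \<le> \<epsilon> / 2" using \<alpha> \<epsilon> by (simp add: field_simps)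
      finally show ?thesis .
    qed
    have "norm (integral (cbox a b) F - (\<Sum>(x, K)\<in>p. of_real (measure lborel K) * F x)) \<le> \<epsilon> / 2"
    proof -
      have contK: "continuous_on S F" for S by (rule continuous_on_subset[OF cont]) simp
      have "integral (cbox a b) F - (\<Sum>(x, K)\<in>p. of_real (measure lborel K) * F x)
          = (\<Sum>(x, K)\<in>p. integral K F - of_real (measure lborel K) * F x)"
        using integral_combine_tagged_division_topdown[OF integrable_continuous[OF contK] p(1)]
        by (simp add: sum_subtractf case_prod_unfold)
      also have "norm \<dots> \<le> (\<Sum>(x, K)\<in>p. (\<beta> * \<delta>) * measure lborel K)"
      proof (rule sum_norm_le)
        fix q assume q: "q \<in> p"
        obtain x K where xK: "q = (x, K)" by force
        obtain c d where K: "K = cbox c d" using tagged_division_ofD(4)[OF p(1)] q xK by blast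
        have sub: "K \<subseteq> ball x \<delta>" using p(2) q xK by blast
        have "((\<lambda>y. F y - F x) has_integral (integral K F - measure lborel K *\<^sub>R F x)) (cbox c d)"
          unfolding K by (intro has_integral_diff integrable_integral integrable_continuous contK has_integral_const)
        then have "norm (integral K F - measure lborel K *\<^sub>R F x) \<le> (\<beta> * \<delta>) * measure lborel (cbox c d)"
        proof (rule has_integral_bound[rotated])
          fix y assume "y \<in> cbox c d"
          then have "norm (y - x) \<le> \<delta>" using sub K by (auto simp: dist_norm norm_minus_commute)
          then have "\<beta> * norm (y - x) \<le> \<beta> * \<delta>" using \<beta> by (intro mult_left_mono)
          with lip[of y x] show "norm (F y - F x) \<le> \<beta> * \<delta>" by linarith
        qed (use \<beta> \<delta> in simp)
        then show "norm (case q of (x, K) \<Rightarrow> integral K F - of_real (measure lborel K) * F x) \<le> (case q of (x, K) \<Rightarrow> (\<beta> * \<delta>) * measure lborel K)"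
          by (simp add: xK K scaleR_conv_of_real)
      qed
      also have "\<dots> = (\<beta> * \<delta>) * (\<Sum>(x, K)\<in>p. measure lborel K)"
        by (simp add: sum_distrib_left case_prod_unfold)
      also have "\<dots> = \<beta> * \<delta> * V" unfolding V_def additive_content_tagged_division[OF p(1)] ..
      finally show ?thesis using \<delta>le by linarith
    qed
    then have "norm ((integral (cbox a b) F - (\<Sum>(x, K)\<in>p. of_real (measure lborel K) * F x)) + (LINT x:- cbox a b|lborel. F x)) \<le> \<epsilon> / 2 + \<epsilon> / 2"
      using tail by (intro norm_triangle_le add_mono)
    then show "norm ((LINT x|lborel. F x) - (\<Sum>(x, K)\<in>p. of_real (measure lborel K) * F x)) \<le> \<epsilon>"
      unfolding split by (simp add: algebra_simps)
  qed
qed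

lemma tempered_add: "tempered_distribution T \<Longrightarrow> schwartz \<phi> \<Longrightarrow> schwartz \<psi> \<Longrightarrow> T (\<lambda>x. \<phi> x + \<psi> x) = T \<phi> + T \<psi>"
  and tempered_cmult: "tempered_distribution T \<Longrightarrow> schwartz \<phi> \<Longrightarrow> T (\<lambda>x. c * \<phi> x) = c * T \<phi>"
  unfolding tempered_distribution_def by blast+

lemma tempered_diff:
  assumes T: "tempered_distribution T" and "schwartz \<phi>" "schwartz \<psi>"
  shows "T (\<lambda>x. \<phi> x - \<psi> x) = T \<phi> - T \<psi>"
  using tempered_add[OF T assms(2) schwartz_cmult[OF assms(3)], of "-1"] tempered_cmult[OF T assms(3), of "-1"]
  by simp

lemma tempered_sum:
  assumes T: "tempered_distribution T" and "finite I" "\<And>i. i \<in> I \<Longrightarrow> schwartz (\<phi> i)"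
  shows "T (\<lambda>x. \<Sum>i\<in>I. c i * \<phi> i x) = (\<Sum>i\<in>I. c i * T (\<phi> i))"
  using assms(2,3)
proof (induction I rule: finite_induct)
  case empty
  show ?case using tempered_cmult[OF T schwartz_zero, of 0] by simp
next
  case (insert i I)
  have "T (\<lambda>x. c i * \<phi> i x + (\<Sum>i\<in>I. c i * \<phi> i x)) = T (\<lambda>x. c i * \<phi> i x) + T (\<lambda>x. \<Sum>i\<in>I. c i * \<phi> i x)"
    using insert by (intro tempered_add[OF T] schwartz_cmult schwartz_sum) auto
  then show ?case using insert by (simp add: tempered_cmult[OF T])
qed

lemma pderivs_sum:
  assumes "finite I" "\<And>i. i \<in> I \<Longrightarrow> smooth (f i)" "bs \<in> lists Basis"
  shows "pderivs bs (\<lambda>x. \<Sum>i\<in>I. f i x) = (\<lambda>x. \<Sum>i\<in>I. pderivs bs (f i) x) \<and> smooth (\<lambda>x. \<Sum>i\<in>I. f i x)"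
  using assms(1,2)
proof (induction I rule: finite_induct)
  case (insert i I)
  then show ?case using assms(3) by (simp add: pderivs_add smooth_add)
qed (simp add: pderivs_const smooth_const)

lemma pderivs_diff:
  assumes "smooth f" "smooth g" "bs \<in> lists Basis"
  shows "pderivs bs (\<lambda>x. f x - g x) = (\<lambda>x. pderivs bs f x - pderivs bs g x)"
  using pderivs_add[OF assms(1) smooth_cmult[OF assms(2)] assms(3), of "-1"] pderivs_cmult[OF assms(2,3), of "-1"] by simp

lemma pderivs_pfourier_snd:
  assumes s: "schwartz \<Theta>" and bs: "bs \<in> lists Basis"
  shows "pderivs (map (Pair 0) bs) (pfourier \<Theta>) = pfourier (pderivs (map (Pair 0) bs) \<Theta>)"
  using bs
proof (induction bs)
  case (Cons b bs)
  then have "bs \<in> lists Basis" by auto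
  then have "map (Pair 0) bs \<in> lists Basis" by (rule map_Pair_0_Basis)
  then have s': "schwartz (pderivs (map (Pair 0) bs) \<Theta>)" by (rule schwartz_pderivs[OF s])
  have "pdir (0, b) (pfourier (pderivs (map (Pair 0) bs) \<Theta>)) = pfourier (pdir (0, b) (pderivs (map (Pair 0) bs) \<Theta>))"
    using pdir_eqI[OF has_derivative_pfourier[OF s'], of "(0, b)"]
    by (simp add: pfourier_deriv_def[abs_def] flip: zero_prod_def)
  with Cons show ?case unfolding list.map pderivs_Cons_pdir by auto
qed simp

lemma marginal_eq_pfourier: "(LINT x|lborel. \<Theta> (x, a)) = pfourier \<Theta> (0, a)"
  by (simp add: pfourier_unit_exp)

text \<open>An integral over the first variable is the partial Fourier transform at frequency \<open>0\<close>, so that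
continuity and the rule for derivatives carry over.\<close>

lemma schwartz_marginal: "schwartz \<Theta> \<Longrightarrow> schwartz (\<lambda>a. LINT x|lborel. \<Theta> (x, a))"
  unfolding marginal_eq_pfourier using scont_schwartz[OF scont_slice scont_schwartz[OF scont_pfourier]] .

lemma pderivs_marginal:
  assumes "schwartz \<Theta>" "bs \<in> lists Basis"
  shows "pderivs bs (\<lambda>a. LINT x|lborel. \<Theta> (x, a)) = (\<lambda>a. LINT x|lborel. pderivs (map (Pair 0) bs) \<Theta> (x, a))"
  unfolding marginal_eq_pfourier
  using pderivs_slice[OF scont_schwartz[OF scont_pfourier assms(1)] assms(2), of 0] pderivs_pfourier_snd[OF assms]
  by simp

text \<open>The mean value inequality in the first variable, which costs one derivative, that is one order of the
seminorm.\<close>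

lemma slice_pderivs_lipschitz:
  fixes \<Theta> :: "'a::euclidean_space \<times> 'b::euclidean_space \<Rightarrow> complex"
  assumes s: "schwartz \<Theta>" and bs: "bs \<in> lists Basis" "length bs \<le> N"
  shows "(1 + norm a) ^ N * norm (pderivs (map (Pair 0) bs) \<Theta> (x, a) - pderivs (map (Pair 0) bs) \<Theta> (y, a))
    \<le> (DIM('a \<times> 'b) * schwartz_seminorm (Suc N) \<Theta>) * norm (x - y)"
proof -
  let ?P = "pderivs (map (Pair 0) bs) \<Theta>" and ?w = "(1 + norm a) ^ N"
  let ?B = "DIM('a \<times> 'b) * schwartz_seminorm (Suc N) \<Theta>"
  note bs' = map_Pair_0_Basis[OF bs(1)]
  have sP: "schwartz ?P" by (rule schwartz_pderivs[OF s bs'])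
  have "norm (of_real ?w * ?P (x, a) - of_real ?w * ?P (y, a)) \<le> ?B * norm (x - y)"
  proof (rule differentiable_bound[where S = UNIV and f' = "\<lambda>x v. of_real ?w * pdir (v, 0) ?P (x, a)"])
    show "((\<lambda>x. of_real ?w * ?P (x, a)) has_derivative (\<lambda>v. of_real ?w * pdir (v, 0) ?P (x, a))) (at x within UNIV)" for x
      by (intro has_derivative_mult_right has_derivative_compose[OF _ has_derivative_pdir[OF schwartz_differentiable[OF sP]]])
        (auto intro!: derivative_eq_intros)
    show "onorm (\<lambda>v. of_real ?w * pdir (v, 0) ?P (x, a)) \<le> ?B" for x
    proof (rule onorm_bound)
      show "0 \<le> ?B" by (simp add: schwartz_seminorm_nonneg[OF s])
      fix v :: 'a
      have "?w * norm (pdir (v, 0) ?P (x, a)) \<le> ?w * (norm (v, 0 :: 'b) * (\<Sum>b\<in>Basis. norm (pdir b ?P (x, a))))"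
        by (intro mult_left_mono norm_pdir_le schwartz_differentiable sP) auto
      also have "\<dots> = norm v * (\<Sum>b\<in>Basis. ?w * norm (pdir b ?P (x, a)))"
        by (simp add: norm_Pair sum_distrib_left mult_ac)
      also have "\<dots> \<le> norm v * (\<Sum>b\<in>(Basis :: ('a \<times> 'b) set). schwartz_seminorm (Suc N) \<Theta>)"
      proof (intro mult_left_mono sum_mono)
        fix b :: "'a \<times> 'b" assume b: "b \<in> Basis"
        have "?w \<le> (1 + norm (x, a)) ^ N" using norm_snd_le[of a x] by (intro power_mono) auto
        also have "\<dots> \<le> (1 + norm (x, a)) ^ Suc N" by (intro power_increasing) auto
        finally have "?w * norm (pdir b ?P (x, a)) \<le> (1 + norm (x, a)) ^ Suc N * norm (pderivs (b # map (Pair 0) bs) \<Theta> (x, a))"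
          unfolding pderivs_Cons_pdir by (intro mult_right_mono) auto
        also have "\<dots> \<le> schwartz_seminorm (Suc N) \<Theta>"
          using b bs bs' by (intro schwartz_seminorm_upper s) auto
        finally show "?w * norm (pdir b ?P (x, a)) \<le> schwartz_seminorm (Suc N) \<Theta>" .
      qed auto
      also have "\<dots> = ?B * norm v" by (simp add: mult.commute)
      finally show "norm (of_real ?w * pdir (v, 0) ?P (x, a)) \<le> ?B * norm v"
        by (simp add: norm_mult norm_power del: of_real_power of_real_add)
    qed
  qed auto
  then show ?thesis
    by (simp add: norm_mult norm_power del: of_real_power of_real_add flip: right_diff_distrib)
qed

text \<open>A tempered distribution may be applied under an integral over a parameter.  It is bounded by one
seminorm, and in this seminorm the Riemann sums of a uniform quadrature converge to the integral; on
finite sums the claim is linearity.  The same quadrature is accurate for the scalar function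
\<open>x \<mapsto> T (\<Theta> (x, \<cdot>))\<close>, which inherits a Lipschitz bound and decay from \<open>\<Theta>\<close>.\<close>

theorem tempered_distribution_integral:
  fixes T :: "('b::euclidean_space \<Rightarrow> complex) \<Rightarrow> complex"
    and \<Theta> :: "'a::euclidean_space \<times> 'b \<Rightarrow> complex"
  assumes T: "tempered_distribution T" and s: "schwartz \<Theta>"
  shows "continuous_on UNIV (\<lambda>x. T (\<lambda>a. \<Theta> (x, a)))"
    and "integrable lborel (\<lambda>x. T (\<lambda>a. \<Theta> (x, a)))"
    and "T (\<lambda>a. LINT x|lborel. \<Theta> (x, a)) = (LINT x|lborel. T (\<lambda>a. \<Theta> (x, a)))"
proof -
  obtain C0 N where "\<And>\<phi>. schwartz \<phi> \<Longrightarrow> norm (T \<phi>) \<le> C0 * schwartz_seminorm N \<phi>"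
    using T unfolding tempered_distribution_def by blast
  then have C: "norm (T \<phi>) \<le> \<bar>C0\<bar> * schwartz_seminorm N \<phi>" if "schwartz \<phi>" for \<phi>
    using that by (meson abs_ge_self mult_right_mono order_trans schwartz_seminorm_nonneg)
  let ?A = "schwartz_seminorm (N + 2 * DIM('a)) \<Theta>"
  let ?B = "DIM('a \<times> 'b) * schwartz_seminorm (Suc N) \<Theta>"
  let ?H = "\<lambda>x. T (\<lambda>a. \<Theta> (x, a))"
  have A: "?A \<ge> 0" and B: "?B \<ge> 0" by (simp_all add: schwartz_seminorm_nonneg[OF s])
  have sl: "schwartz (\<lambda>a. \<Theta> (x, a))" for x by (rule scont_schwartz[OF scont_slice s])
  have "schwartz_seminorm N (\<lambda>a. \<Theta> (x, a)) \<le> ?A * decay_weight x" for x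
    by (rule schwartz_seminorm_least) (simp add: pderivs_slice[OF s] slice_pderivs_decay[OF s])
  then have Hdec: "norm (?H x) \<le> (\<bar>C0\<bar> * ?A) * decay_weight x" for x
    using order_trans[OF C[OF sl] mult_left_mono] by (simp add: mult.assoc)
  have "schwartz_seminorm N (\<lambda>a. \<Theta> (x, a) - \<Theta> (y, a)) \<le> ?B * norm (x - y)" for x y
    by (rule schwartz_seminorm_least)
      (simp add: pderivs_diff schwartz_smooth sl pderivs_slice[OF s] slice_pderivs_lipschitz[OF s] del: DIM_prod)
  then have Hlip: "norm (?H x - ?H y) \<le> (\<bar>C0\<bar> * ?B) * norm (x - y)" for x y
    unfolding tempered_diff[OF T sl sl, symmetric]
    using order_trans[OF C[OF schwartz_diff[OF sl sl]] mult_left_mono] by (simp add: mult.assoc)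
  have "(\<bar>C0\<bar> * ?B)-lipschitz_on UNIV ?H"
    using Hlip B by (intro lipschitz_onI) (auto simp: dist_norm)
  then show cont: "continuous_on UNIV ?H" by (rule lipschitz_on_continuous_on)
  show "integrable lborel ?H" by (rule integrable_decay[OF cont Hdec])
  let ?J = "\<lambda>a. LINT x|lborel. \<Theta> (x, a)"
  have sJ: "schwartz ?J" by (rule schwartz_marginal[OF s])
  have main: "norm (T ?J - (LINT x|lborel. ?H x)) \<le> (\<bar>C0\<bar> + 1) * \<epsilon>" if \<epsilon>: "\<epsilon> > 0" for \<epsilon>
  proof -
    obtain p :: "('a \<times> 'a set) set" where p: "finite p"
      "\<And>F :: 'a \<Rightarrow> complex. (\<And>x y. norm (F x - F y) \<le> ((\<bar>C0\<bar> + 1) * ?B) * norm (x - y)) \<Longrightarrow>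
       (\<And>x. norm (F x) \<le> ((\<bar>C0\<bar> + 1) * ?A) * decay_weight x) \<Longrightarrow>
       norm ((LINT x|lborel. F x) - (\<Sum>(x, K)\<in>p. of_real (measure lborel K) * F x)) \<le> \<epsilon>"
      by (rule uniform_quadrature[OF \<epsilon>, of "(\<bar>C0\<bar> + 1) * ?A" "(\<bar>C0\<bar> + 1) * ?B"]) (use A B in auto)
    have le1: "r * t \<le> ((\<bar>C0\<bar> + 1) * r) * t" "(\<bar>C0\<bar> * r) * t \<le> ((\<bar>C0\<bar> + 1) * r) * t" if "0 \<le> r" "0 \<le> t" for r t
      using that by (auto simp: algebra_simps intro!: mult_nonneg_nonneg)
    \<comment> \<open>The Riemann sum, now with values in Schwartz space.\<close>
    let ?S = "\<lambda>a. \<Sum>q\<in>p. of_real (measure lborel (snd q)) * \<Theta> (fst q, a)"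
    have sS: "schwartz ?S" by (intro schwartz_sum schwartz_cmult sl)
    have TS: "T ?S = (\<Sum>q\<in>p. of_real (measure lborel (snd q)) * ?H (fst q))"
      by (rule tempered_sum[OF T p(1) sl])
    have 1: "norm ((LINT x|lborel. ?H x) - T ?S) \<le> \<epsilon>"
      unfolding TS using p(2)[of ?H] order_trans[OF Hlip le1(2)[OF B]] order_trans[OF Hdec le1(2)[OF A]]
      by (simp add: case_prod_unfold decay_weight_nonneg del: DIM_prod)
    have "schwartz_seminorm N (\<lambda>a. ?J a - ?S a) \<le> \<epsilon>"
    proof (rule schwartz_seminorm_least)
      fix bs and a :: 'b assume bs: "bs \<in> lists (Basis :: 'b set)" "length bs \<le> N"
      let ?P = "pderivs (map (Pair 0) bs) \<Theta>" and ?w = "(1 + norm a) ^ N"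
      let ?F = "\<lambda>x. of_real ?w * ?P (x, a)"
      have "pderivs bs ?S a = (\<Sum>q\<in>p. of_real (measure lborel (snd q)) * ?P (fst q, a))"
        using pderivs_sum[OF p(1) smooth_cmult[OF schwartz_smooth[OF sl]] bs(1)]
        by (simp add: pderivs_cmult[OF schwartz_smooth[OF sl] bs(1)] pderivs_slice[OF s bs(1)])
      then have "pderivs bs (\<lambda>a. ?J a - ?S a) a = (LINT x|lborel. ?P (x, a)) - (\<Sum>q\<in>p. of_real (measure lborel (snd q)) * ?P (fst q, a))"
        using pderivs_diff[OF schwartz_smooth[OF sJ] schwartz_smooth[OF sS] bs(1)]
        by (simp add: pderivs_marginal[OF s bs(1)])
      then have "of_real ?w * pderivs bs (\<lambda>a. ?J a - ?S a) a = (LINT x|lborel. ?F x) - (\<Sum>q\<in>p. of_real (measure lborel (snd q)) * ?F (fst q))"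
        by (simp add: right_diff_distrib sum_distrib_left mult_ac del: of_real_power of_real_add)
      moreover have "norm ((LINT x|lborel. ?F x) - (\<Sum>(x, K)\<in>p. of_real (measure lborel K) * ?F x)) \<le> \<epsilon>"
      proof (rule p(2))
        fix x y
        have "norm (?F x - ?F y) = ?w * norm (?P (x, a) - ?P (y, a))"
          by (simp add: norm_mult norm_power del: of_real_power of_real_add flip: right_diff_distrib)
        also have "\<dots> \<le> ?B * norm (x - y)" by (rule slice_pderivs_lipschitz[OF s bs])
        also have "\<dots> \<le> ((\<bar>C0\<bar> + 1) * ?B) * norm (x - y)" by (rule le1(1)[OF B]) simp
        finally show "norm (?F x - ?F y) \<le> ((\<bar>C0\<bar> + 1) * ?B) * norm (x - y)" .
      next
        fix x
        have "norm (?F x) = ?w * norm (?P (x, a))"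
          by (simp add: norm_mult norm_power del: of_real_power of_real_add)
        also have "\<dots> \<le> ?A * decay_weight x" by (rule slice_pderivs_decay[OF s bs])
        also have "\<dots> \<le> ((\<bar>C0\<bar> + 1) * ?A) * decay_weight x" by (rule le1(1)[OF A decay_weight_nonneg])
        finally show "norm (?F x) \<le> ((\<bar>C0\<bar> + 1) * ?A) * decay_weight x" .
      qed
      ultimately have "norm (of_real ?w * pderivs bs (\<lambda>a. ?J a - ?S a) a) \<le> \<epsilon>"
        by (simp add: case_prod_unfold del: of_real_power of_real_add)
      then show "?w * norm (pderivs bs (\<lambda>a. ?J a - ?S a) a) \<le> \<epsilon>"
        by (simp add: norm_mult norm_power del: of_real_power of_real_add)
    qed
    then have "\<bar>C0\<bar> * schwartz_seminorm N (\<lambda>a. ?J a - ?S a) \<le> \<bar>C0\<bar> * \<epsilon>" by (intro mult_left_mono) auto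
    then have 2: "norm (T ?J - T ?S) \<le> \<bar>C0\<bar> * \<epsilon>"
      using C[OF schwartz_diff[OF sJ sS]] unfolding tempered_diff[OF T sJ sS, symmetric] by linarith
    have "norm (T ?J - (LINT x|lborel. ?H x)) \<le> norm (T ?J - T ?S) + norm ((LINT x|lborel. ?H x) - T ?S)"
      using norm_triangle_ineq4[of "T ?J - T ?S" "(LINT x|lborel. ?H x) - T ?S"] by simp
    with 1 2 show ?thesis by (simp add: algebra_simps)
  qed
  have "norm (T ?J - (LINT x|lborel. ?H x)) \<le> 0 + e" if "e > 0" for e
  proof -
    have C1: "\<bar>C0\<bar> + 1 > 0" by simp
    from main[OF divide_pos_pos[OF that C1]] show ?thesis
      unfolding nonzero_mult_div_cancel_left[OF less_imp_neq[OF C1, symmetric]] times_divide_eq_right by simp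
  qed
  then have "norm (T ?J - (LINT x|lborel. ?H x)) \<le> 0" by (rule field_le_epsilon)
  then show "T ?J = (LINT x|lborel. ?H x)" by (simp only: norm_le_zero_iff right_minus_eq)
qed

section \<open>Weyl operators and the Wigner transform\<close>

lemma pfourier_add:
  fixes \<phi> \<psi> :: "'a::euclidean_space \<times> 'b::euclidean_space \<Rightarrow> complex"
  assumes "schwartz \<phi>" "schwartz \<psi>"
  shows "pfourier (\<lambda>p. \<phi> p + \<psi> p) = (\<lambda>p. pfourier \<phi> p + pfourier \<psi> p)"
proof
  fix p :: "'a \<times> 'b"
  have "schwartz (\<lambda>u. unit_exp (- (fst p \<bullet> u)) * \<theta> (u, snd p))" if "schwartz \<theta>"
    for \<theta> :: "'a \<times> 'b \<Rightarrow> complex"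
    using schwartz_mult_slow[OF slow_unit_exp_inner[of "- fst p"] schwartz_fst_slice[OF that]] by simp
  then show "pfourier (\<lambda>p. \<phi> p + \<psi> p) p = pfourier \<phi> p + pfourier \<psi> p"
    unfolding pfourier_unit_exp distrib_left
    using assms by (intro Bochner_Integration.integral_add schwartz_integrable)
qed

lemma pfourier_cmult: "pfourier (\<lambda>p. c * \<phi> p) = (\<lambda>p. c * pfourier \<phi> p)"
  unfolding pfourier_unit_exp[abs_def]
  by (subst integral_mult_right_zero[symmetric]) (simp add: mult.left_commute)

text \<open>For \<open>g\<close> the Fourier transform of \<open>f\<close>, this is the cross-Wigner transform of \<open>f\<close> and the Fourier
transform of \<open>\<eta>\<close>, written on the Fourier side; see lemma \<open>wigner_fourier\<close>.\<close>

definition wigner :: "('a::euclidean_space \<Rightarrow> complex) \<Rightarrow> ('a \<Rightarrow> complex) \<Rightarrow> 'a \<times> 'a \<Rightarrow> complex" where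
  "wigner g \<eta> = pfourier (\<lambda>(u, k). \<eta> (k + (1/2) *\<^sub>R u) * g (k - (1/2) *\<^sub>R u))"

lemma wigner_unit_exp:
  "wigner g \<eta> (m, k) = (LINT u|lborel. unit_exp (- (m \<bullet> u)) * (\<eta> (k + (1/2) *\<^sub>R u) * g (k - (1/2) *\<^sub>R u)))"
  by (simp add: wigner_def pfourier_unit_exp)

text \<open>The map \<open>(u, k) \<mapsto> (k + r u, k - r u)\<close> is invertible.  The value \<open>r = 1/2\<close> occurs in the Wigner
transform, \<open>r = 1\<close> in the first formula for the smoothed operator.\<close>

lemma scont_rotated_tensor:
  fixes g :: "'a::euclidean_space \<Rightarrow> complex"
  assumes "schwartz g" "r \<noteq> 0"
  shows "scont (\<lambda>\<eta> (u, k). \<eta> (k + r *\<^sub>R u) * g (k - r *\<^sub>R u))"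
proof -
  have "scont (\<lambda>(\<phi> :: 'a \<times> 'a \<Rightarrow> complex) p. \<phi> ((snd p + r *\<^sub>R fst p, snd p - r *\<^sub>R fst p) + 0))"
  proof (rule scont_affine[where l' = "\<lambda>q. ((1 / (2 * r)) *\<^sub>R (fst q - snd q), (1/2) *\<^sub>R (fst q + snd q))"])
    show "bounded_linear (\<lambda>p :: 'a \<times> 'a. (snd p + r *\<^sub>R fst p, snd p - r *\<^sub>R fst p))"
      by (intro bounded_linear_Pair bounded_linear_add bounded_linear_sub bounded_linear_fst bounded_linear_snd
          bounded_linear_const_scaleR)
    show "bounded_linear (\<lambda>q :: 'a \<times> 'a. ((1 / (2 * r)) *\<^sub>R (fst q - snd q), (1/2) *\<^sub>R (fst q + snd q)))"
      by (intro bounded_linear_Pair bounded_linear_add bounded_linear_sub bounded_linear_fst bounded_linear_snd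
          bounded_linear_const_scaleR)
    show "(\<lambda>q. ((1 / (2 * r)) *\<^sub>R (fst q - snd q), (1/2) *\<^sub>R (fst q + snd q))) (snd p + r *\<^sub>R fst p, snd p - r *\<^sub>R fst p) = p"
      for p :: "'a \<times> 'a"
      using assms(2) by (cases p) (auto simp: algebra_simps simp flip: scaleR_add_left)
  qed
  from scont_compose[OF this scont_tensor[OF assms(1)]] show ?thesis by (simp add: case_prod_unfold)
qed

lemma scont_wigner: "schwartz g \<Longrightarrow> scont (wigner g)"
  unfolding wigner_def[abs_def] by (intro scont_compose[OF scont_pfourier] scont_rotated_tensor) auto

lemma tempered_wigner:
  assumes L: "tempered_distribution L" and g: "schwartz g"
  shows "tempered_distribution (\<lambda>\<eta>. L (wigner g \<eta>))"
proof (rule tempered_distribution_compose[OF L scont_wigner[OF g]])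
  note R = scont_schwartz[OF scont_rotated_tensor[OF g, of "1/2"]]
  show "wigner g (\<lambda>x. \<phi> x + \<psi> x) = (\<lambda>p. wigner g \<phi> p + wigner g \<psi> p)" if "schwartz \<phi>" "schwartz \<psi>" for \<phi> \<psi>
    using pfourier_add[OF R[OF _ that(1)] R[OF _ that(2)]]
    by (simp add: wigner_def distrib_right case_prod_unfold)
  show "wigner g (\<lambda>x. c * \<phi> x) = (\<lambda>p. c * wigner g \<phi> p)" for c \<phi>
    unfolding wigner_def pfourier_cmult[symmetric] by (simp add: case_prod_unfold mult.assoc)
qed

text \<open>The left-hand side is the function with which a Weyl symbol is paired.  After inserting the integral
for \<open>fourier \<eta>\<close> and exchanging the integrals, the integral over \<open>z\<close> is a Fourier transform of \<open>f\<close> at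
\<open>2 k - a\<close>; the substitution \<open>a = k + u/2\<close> makes the result symmetric.\<close>

lemma wigner_fourier:
  fixes f \<eta> :: "'a::euclidean_space \<Rightarrow> complex"
  assumes f: "schwartz f" and \<eta>: "schwartz \<eta>"
  shows "(LINT z|lborel. unit_exp (k \<bullet> z) * f (m - (1/2) *\<^sub>R z) * fourier \<eta> (m + (1/2) *\<^sub>R z)) = wigner (fourier f) \<eta> (m, k)"
proof -
  have "scont (\<lambda>(f :: 'a \<Rightarrow> complex) z. f ((- (1/2)) *\<^sub>R z + m))"
    by (rule scont_affine[OF bounded_linear_scaleR_right bounded_linear_scaleR_right[of "- 2"]]) simp
  from scont_schwartz[OF this f] have sf: "schwartz (\<lambda>z. f (m - (1/2) *\<^sub>R z))" by simp
  have sF: "schwartz (\<lambda>a. fourier f (2 *\<^sub>R k - a))"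
    using scont_schwartz[OF scont_affine[of "\<lambda>a. - a" "\<lambda>a. - a" "2 *\<^sub>R k"] schwartz_fourier[OF f]]
    by (simp add: bounded_linear_minus bounded_linear_ident add.commute)
  let ?S = "\<lambda>a. unit_exp ((2 *\<^sub>R (k - a)) \<bullet> m) * (\<eta> a * fourier f (2 *\<^sub>R k - a))"
  have "(LINT z|lborel. unit_exp (k \<bullet> z) * f (m - (1/2) *\<^sub>R z) * fourier \<eta> (m + (1/2) *\<^sub>R z))
     = (LINT z|lborel. (LINT a|lborel. unit_exp (k \<bullet> z - (m + (1/2) *\<^sub>R z) \<bullet> a) * (f (m - (1/2) *\<^sub>R z) * \<eta> a)))"
    unfolding fourier_unit_exp
    by (subst integral_mult_right_zero[symmetric]) (simp add: unit_exp_add[of _ "- _", simplified] mult_ac)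
  also have "\<dots> = (LINT a|lborel. (LINT z|lborel. unit_exp (k \<bullet> z - (m + (1/2) *\<^sub>R z) \<bullet> a) * (f (m - (1/2) *\<^sub>R z) * \<eta> a)))"
    by (rule Fubini_lborel, rule integrable_tensor[OF sf \<eta>]) (auto intro!: continuous_intros)
  also have "\<dots> = (LINT a|lborel. of_real (2 ^ DIM('a)) * ?S a)"
  proof (rule Bochner_Integration.integral_cong[OF refl])
    fix a
    let ?R = "\<lambda>y. unit_exp (- ((2 *\<^sub>R k - a) \<bullet> y)) * f y"
    have "integrable lborel ?R"
      using schwartz_integrable[OF schwartz_mult_slow[OF slow_unit_exp_inner[of "- (2 *\<^sub>R k - a)"] f]]
      by (simp only: inner_minus_left)
    from integral_lborel_affine[OF this, of "- (1/2)" m]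
    have 1: "of_real (2 ^ DIM('a)) * fourier f (2 *\<^sub>R k - a) = (LINT z|lborel. ?R (m + (- (1/2)) *\<^sub>R z))"
      by (simp add: fourier_unit_exp power_divide)
    have 2: "unit_exp (k \<bullet> z - (m + (1/2) *\<^sub>R z) \<bullet> a) * (f (m - (1/2) *\<^sub>R z) * \<eta> a)
        = (unit_exp ((2 *\<^sub>R (k - a)) \<bullet> m) * \<eta> a) * ?R (m + (- (1/2)) *\<^sub>R z)" for z
    proof -
      have "k \<bullet> z - (m + (1/2) *\<^sub>R z) \<bullet> a = (2 *\<^sub>R (k - a)) \<bullet> m + - ((2 *\<^sub>R k - a) \<bullet> (m + (- (1/2)) *\<^sub>R z))"
        by (simp add: inner_diff_left inner_diff_right inner_add_left inner_add_right inner_commute algebra_simps)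
      then show ?thesis by (simp add: unit_exp_add[symmetric] mult_ac)
    qed
    show "(LINT z|lborel. unit_exp (k \<bullet> z - (m + (1/2) *\<^sub>R z) \<bullet> a) * (f (m - (1/2) *\<^sub>R z) * \<eta> a)) = of_real (2 ^ DIM('a)) * ?S a"
      unfolding 2 integral_mult_right_zero 1[symmetric] by (simp only: mult_ac)
  qed
  also have "\<dots> = of_real (2 ^ DIM('a)) * (LINT a|lborel. ?S a)" by (rule integral_mult_right_zero)
  also have "(LINT a|lborel. ?S a) = of_real (\<bar>1/2\<bar> ^ DIM('a)) * (LINT u|lborel. ?S (k + (1/2) *\<^sub>R u))"
  proof (rule integral_lborel_affine)
    have "slow (\<lambda>a. unit_exp ((2 *\<^sub>R (k - a)) \<bullet> m))"
      by (rule slow_unit_exp_form[where q' = "\<lambda>a v. (2 *\<^sub>R (- v)) \<bullet> m"])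
        (auto intro!: derivative_eq_intros slow_const)
    then show "integrable lborel ?S"
      by (rule schwartz_integrable[OF schwartz_mult_slow[OF _ schwartz_mult_slow[OF schwartz_slow[OF \<eta>] sF]]])
  qed simp
  also have "of_real (2 ^ DIM('a)) * (of_real (\<bar>1/2\<bar> ^ DIM('a)) * (LINT u|lborel. ?S (k + (1/2) *\<^sub>R u)))
      = (LINT u|lborel. ?S (k + (1/2) *\<^sub>R u))"
    by (simp add: power_divide)
  also have "\<dots> = wigner (fourier f) \<eta> (m, k)"
    unfolding wigner_unit_exp
    by (intro Bochner_Integration.integral_cong[OF refl])
      (simp add: inner_diff_left inner_add_left inner_commute scaleR_2 algebra_simps)
  finally show ?thesis .
qed

lemma schwartz_gauss_mult: "\<sigma> > 0 \<Longrightarrow> schwartz (gauss_mult \<sigma>)"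
  unfolding gauss_mult_def[abs_def] using schwartz_gaussian[of "(pi / 2) * \<sigma>\<^sup>2"] by simp

lemma schwartz_gauss_mult_mult: "\<sigma> > 0 \<Longrightarrow> schwartz f \<Longrightarrow> schwartz (\<lambda>X. gauss_mult \<sigma> X * f X)"
  by (intro schwartz_mult_slow schwartz_slow schwartz_gauss_mult)

lemma fourier_Phi:
  assumes "\<sigma> > 0" "schwartz f"
  shows "fourier (Phi \<sigma> f) k = gauss_mult \<sigma> k * fourier f k"
  unfolding Phi_def using assms by (intro fourier_inv_fourier schwartz_gauss_mult_mult schwartz_fourier)

lemma Phi_inj:
  assumes "\<sigma> > 0"
  shows "inj_on (Phi \<sigma>) (Collect schwartz)"
proof (rule inj_onI)
  fix f g :: "'a \<Rightarrow> complex"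
  assume f: "f \<in> Collect schwartz" and g: "g \<in> Collect schwartz" and e: "Phi \<sigma> f = Phi \<sigma> g"
  have "gauss_mult \<sigma> k * fourier f k = gauss_mult \<sigma> k * fourier g k" for k
    using fourier_Phi[OF assms, of f k] fourier_Phi[OF assms, of g k] f g e by (metis mem_Collect_eq)
  then have "fourier f = fourier g" by (auto simp: gauss_mult_def)
  then show "f = g" using inv_fourier_fourier f g by (metis ext mem_Collect_eq)
qed

lemma inv_into_Phi: "\<sigma> > 0 \<Longrightarrow> schwartz f \<Longrightarrow> inv_into (Collect schwartz) (Phi \<sigma>) (Phi \<sigma> f) = f"
  using inv_into_f_f[OF Phi_inj, of \<sigma> f] by simp

text \<open>Transposing \<open>\<Phi>\<close> turns the test function \<open>g\<close> into the Fourier transform of \<open>G\<close> times the inverse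
transform of \<open>g\<close>, which is the form that lemma \<open>wigner_fourier\<close> asks for.\<close>

lemma smoothed_op_Phi:
  assumes "\<sigma> > 0" "schwartz f" "schwartz g"
  shows "smoothed_op \<sigma> L (Phi \<sigma> f) g = L (wigner (fourier f) (\<lambda>a. gauss_mult \<sigma> a * inv_fourier g a))"
proof -
  have "schwartz (\<lambda>a. gauss_mult \<sigma> a * inv_fourier g a)"
    by (intro schwartz_gauss_mult_mult schwartz_inv_fourier assms)
  note W = wigner_fourier[OF assms(2) this]
  have "(\<lambda>(m, k). LINT z|lborel. exp (2 * pi * \<i> * of_real (k \<bullet> z)) * f (m - (1/2) *\<^sub>R z) *
      fourier (\<lambda>a. gauss_mult \<sigma> a * inv_fourier g a) (m + (1/2) *\<^sub>R z))
     = wigner (fourier f) (\<lambda>a. gauss_mult \<sigma> a * inv_fourier g a)"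
    by (simp only: fun_eq_iff split_paired_All prod.case W[unfolded unit_exp_def] simp_thms)
  then show ?thesis
    by (simp add: smoothed_op_def inv_into_Phi assms Phi_dist_def inv_fourier_dist_def mult_dist_def
        fourier_dist_def weyl_op_def)
qed

text \<open>The Schwartz function whose pairing with the symbol is the value of the smoothed operator at \<open>x\<close>.  It
is the function paired with the symbol for the test function \<open>\<Phi> \<delta>\<^sub>x\<close>, a Gaussian centred at \<open>x\<close>.\<close>

definition weyl_kernel :: "real \<Rightarrow> ('a::euclidean_space \<Rightarrow> complex) \<Rightarrow> 'a \<Rightarrow> 'a \<times> 'a \<Rightarrow> complex" where
  "weyl_kernel \<sigma> f x = wigner (fourier f) (\<lambda>a. unit_exp (x \<bullet> a) * gauss_mult \<sigma> a)"

lemma schwartz_unit_exp_gauss: "\<sigma> > 0 \<Longrightarrow> schwartz (\<lambda>a. unit_exp (x \<bullet> a) * gauss_mult \<sigma> a)"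
  by (intro schwartz_mult_slow slow_unit_exp_inner schwartz_gauss_mult)

lemma schwartz_weyl_kernel: "\<sigma> > 0 \<Longrightarrow> schwartz f \<Longrightarrow> schwartz (weyl_kernel \<sigma> f x)"
  unfolding weyl_kernel_def
  by (intro scont_schwartz[OF scont_wigner] schwartz_fourier schwartz_unit_exp_gauss)

lemma schwartz_oscillating_tensor:
  fixes g G :: "'a::euclidean_space \<Rightarrow> complex"
  assumes "schwartz g" "schwartz G"
  shows "schwartz (\<lambda>p. unit_exp (fst p \<bullet> snd p) * (g (fst p) * G (snd p)))"
proof (rule schwartz_mult_slow)
  show "schwartz (\<lambda>p. g (fst p) * G (snd p))" by (rule scont_schwartz[OF scont_tensor]) fact+
  show "slow (\<lambda>p :: 'a \<times> 'a. unit_exp (fst p \<bullet> snd p))"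
  proof (rule slow_unit_exp_form[where q' = "\<lambda>p v. fst p \<bullet> snd v + fst v \<bullet> snd p"])
    show "((\<lambda>p :: 'a \<times> 'a. fst p \<bullet> snd p) has_derivative (\<lambda>v. fst p \<bullet> snd v + fst v \<bullet> snd p)) (at p)" for p
      by (auto intro!: derivative_eq_intros)
    show "slow (\<lambda>p :: 'a \<times> 'a. complex_of_real (fst p \<bullet> snd b + fst b \<bullet> snd p))" for b
      using slow_inner[of "(snd b, fst b)"] by (simp add: inner_Pair_0 inner_prod_def inner_commute)
  qed
qed

text \<open>The inverse Fourier transform of a test function \<open>g\<close> is the integral of \<open>unit_exp (x \<bullet> a) * g x\<close> over
\<open>x\<close>.  Taking this integral out of the pairing turns the distribution into the function
\<open>x \<mapsto> L (weyl_kernel \<sigma> f x)\<close>.\<close>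

theorem smoothed_op_represented:
  fixes f :: "'a::euclidean_space \<Rightarrow> complex"
  assumes \<sigma>: "\<sigma> > 0" and f: "schwartz f" and L: "tempered_distribution L"
  shows "continuous_on UNIV (\<lambda>x. L (weyl_kernel \<sigma> f x))"
    and "represented_by (smoothed_op \<sigma> L (Phi \<sigma> f)) (\<lambda>x. L (weyl_kernel \<sigma> f x))"
proof -
  let ?T = "\<lambda>\<eta>. L (wigner (fourier f) \<eta>)"
  have T: "tempered_distribution ?T" by (rule tempered_wigner[OF L schwartz_fourier[OF f]])
  have slice: "?T (\<lambda>a. unit_exp (x \<bullet> a) * (g x * gauss_mult \<sigma> a)) = L (weyl_kernel \<sigma> f x) * g x" for g x
    using tempered_cmult[OF T schwartz_unit_exp_gauss[OF \<sigma>], of "g x" x]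
    by (simp add: weyl_kernel_def mult_ac)
  have \<Theta>: "schwartz (\<lambda>p. unit_exp (fst p \<bullet> snd p) * (g (fst p) * gauss_mult \<sigma> (snd p)))" if "schwartz g" for g :: "'a \<Rightarrow> complex"
    by (rule schwartz_oscillating_tensor[OF that schwartz_gauss_mult[OF \<sigma>]])
  note D = tempered_distribution_integral[OF T \<Theta>, simplified, unfolded slice]
  \<comment> \<open>Only products with Schwartz functions are known to be continuous; the Gauss function has no
    zeros, so one can divide by it again.\<close>
  have "continuous_on UNIV (\<lambda>x. L (weyl_kernel \<sigma> f x) * gauss_mult \<sigma> x / gauss_mult \<sigma> x)"
    by (intro continuous_on_divide D(1) schwartz_continuous schwartz_gauss_mult \<sigma>) (auto simp: gauss_mult_def)
  then show "continuous_on UNIV (\<lambda>x. L (weyl_kernel \<sigma> f x))" by (simp add: gauss_mult_def)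
  show "represented_by (smoothed_op \<sigma> L (Phi \<sigma> f)) (\<lambda>x. L (weyl_kernel \<sigma> f x))"
    unfolding represented_by_def
  proof (intro allI impI conjI)
    fix g :: "'a \<Rightarrow> complex" assume g: "schwartz g"
    show "integrable lborel (\<lambda>x. L (weyl_kernel \<sigma> f x) * g x)" by (rule D(2)[OF g])
    have "(\<lambda>a. LINT x|lborel. unit_exp (x \<bullet> a) * (g x * gauss_mult \<sigma> a)) = (\<lambda>a. gauss_mult \<sigma> a * inv_fourier g a)"
      unfolding inv_fourier_unit_exp
      by (subst integral_mult_right_zero[symmetric]) (simp add: inner_commute mult_ac)
    then show "smoothed_op \<sigma> L (Phi \<sigma> f) g = (LINT x|lborel. L (weyl_kernel \<sigma> f x) * g x)"
      using D(3)[OF g] by (simp add: smoothed_op_Phi[OF \<sigma> f g])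
  qed
qed

section \<open>The Fourier side formula\<close>

text \<open>The real exponential in the first formula compensates exactly the change of the argument of the Gauss
function from \<open>k - u\<close> to \<open>k + u\<close>; without it the integrand would contain \<open>gauss_mult \<sigma> (k - u)\<close>, which
comes from the Fourier transform of \<open>\<Phi> f\<close>.\<close>

lemma gauss_mult_add_eq: "gauss_mult \<sigma> (k + u) = exp (- of_real (2 * pi * \<sigma>\<^sup>2 * (k \<bullet> u))) * gauss_mult \<sigma> (k - u)"
proof -
  have "- (pi / 2) * \<sigma>\<^sup>2 * ((k + u) \<bullet> (k + u)) = - (2 * pi * \<sigma>\<^sup>2 * (k \<bullet> u)) + - (pi / 2) * \<sigma>\<^sup>2 * ((k - u) \<bullet> (k - u))"
    by (simp add: inner_add_left inner_add_right inner_diff_left inner_diff_right inner_commute field_simps)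
  moreover have "exp (- complex_of_real (2 * pi * \<sigma>\<^sup>2 * (k \<bullet> u))) = of_real (exp (- (2 * pi * \<sigma>\<^sup>2 * (k \<bullet> u))))"
    by (simp only: exp_of_real flip: of_real_minus)
  ultimately show ?thesis unfolding gauss_mult_def by (simp only: exp_add of_real_mult)
qed

lemma fourier_kernel_eq:
  assumes \<sigma>: "\<sigma> > 0" and f: "schwartz f"
  shows "exp (2 * pi * ((\<i> * of_real (x \<bullet> u)) - of_real (\<sigma>\<^sup>2 * (k \<bullet> u))) + 2 * pi * \<i> * of_real (k \<bullet> x)) * fourier (Phi \<sigma> f) (k - u)
    = (unit_exp (x \<bullet> (k + u)) * gauss_mult \<sigma> (k + u)) * fourier f (k - u)"
proof -
  have "2 * pi * ((\<i> * of_real (x \<bullet> u)) - of_real (\<sigma>\<^sup>2 * (k \<bullet> u))) + 2 * pi * \<i> * of_real (k \<bullet> x)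
     = 2 * pi * \<i> * of_real (x \<bullet> (k + u)) + - complex_of_real (2 * pi * \<sigma>\<^sup>2 * (k \<bullet> u))"
    by (simp add: inner_add_right inner_commute algebra_simps)
  then have "exp (2 * pi * ((\<i> * of_real (x \<bullet> u)) - of_real (\<sigma>\<^sup>2 * (k \<bullet> u))) + 2 * pi * \<i> * of_real (k \<bullet> x))
     = unit_exp (x \<bullet> (k + u)) * exp (- complex_of_real (2 * pi * \<sigma>\<^sup>2 * (k \<bullet> u)))"
    unfolding unit_exp_def by (simp only: exp_add)
  then show ?thesis by (simp add: fourier_Phi[OF \<sigma> f] gauss_mult_add_eq mult.assoc)
qed

text \<open>Once the real exponential is absorbed, \<open>\<phi>\<close> is a tensor product in the variables \<open>k + u\<close> and \<open>k - u\<close>.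
Replacing \<open>u\<close> by \<open>u / 2\<close> and transforming in \<open>u\<close> gives the Weyl kernel; the Jacobian cancels the factor
\<open>2 ^ n\<close>.\<close>

lemma fourier_side:
  fixes f :: "'a::euclidean_space \<Rightarrow> complex" and x :: 'a
  assumes \<sigma>: "\<sigma> > 0" and f: "schwartz f"
  defines "\<phi> \<equiv> \<lambda>(u, k). exp (2 * pi * ((\<i> * of_real (x \<bullet> u)) - of_real (\<sigma>\<^sup>2 * (k \<bullet> u)))
               + 2 * pi * \<i> * of_real (k \<bullet> x)) * fourier (Phi \<sigma> f) (k - u)"
  shows "schwartz \<phi>" and "L (weyl_kernel \<sigma> f x) = 2 ^ DIM('a) * affine_fst_dist 2 0 (fourier_fst_dist L) \<phi>"
proof -
  have \<phi>: "\<phi> = (\<lambda>(u, k). (unit_exp (x \<bullet> (k + u)) * gauss_mult \<sigma> (k + u)) * fourier f (k - u))"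
    unfolding \<phi>_def by (simp only: fourier_kernel_eq[OF \<sigma> f])
  show "schwartz \<phi>"
    unfolding \<phi>
    using scont_schwartz[OF scont_rotated_tensor[OF schwartz_fourier[OF f], of 1] schwartz_unit_exp_gauss[OF \<sigma>, of x]]
    by simp
  have "affine_fst_dist 2 0 (fourier_fst_dist L) \<phi> = L (weyl_kernel \<sigma> f x) / 2 ^ DIM('a)"
    unfolding affine_fst_dist_def fourier_fst_dist_def \<phi> weyl_kernel_def wigner_def pfourier_def[abs_def]
    by (simp add: case_prod_unfold)
  then show "L (weyl_kernel \<sigma> f x) = 2 ^ DIM('a) * affine_fst_dist 2 0 (fourier_fst_dist L) \<phi>" by simp
qed

section \<open>The entire extension\<close>

definition cvec :: "real ^ 'n \<Rightarrow> complex ^ 'n" where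
  "cvec x = (\<chi> j. of_real (x $ j))"

text \<open>The complex bilinear extension of the inner product in its second argument.\<close>

definition cdot :: "real ^ 'n \<Rightarrow> complex ^ 'n \<Rightarrow> complex" where
  "cdot X z = (\<Sum>j\<in>UNIV. of_real (X $ j) * z $ j)"

lemma norm_cdot_le: "norm (cdot X z) \<le> real CARD('n) * (norm (X :: real ^ 'n) * norm z)"
proof -
  have "norm (cdot X z) \<le> (\<Sum>j\<in>(UNIV :: 'n set). norm X * norm z)"
    unfolding cdot_def
  proof (rule sum_norm_le)
    fix j
    have "\<bar>X $ j\<bar> * norm (z $ j) \<le> norm X * norm z"
      using component_le_norm_cart[of X j] Finite_Cartesian_Product.norm_nth_le[of z j] by (intro mult_mono) auto
    then show "norm (of_real (X $ j) * z $ j) \<le> norm X * norm z" by (simp add: norm_mult)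
  qed
  then show ?thesis by simp
qed

lemma cdot_cvec: "cdot X (cvec y) = of_real (X \<bullet> y)"
  by (simp add: cdot_def cvec_def inner_vec_def)

lemma cdot_add: "cdot X (z + w) = cdot X z + cdot X w"
  by (simp add: cdot_def distrib_left sum.distrib)

lemma cdot_smult: "cdot X (c *s z) = c * cdot X z"
  by (simp add: cdot_def sum_distrib_left mult_ac)

lemma bounded_linear_cdot: "bounded_linear (cdot X)"
  by (rule linear_conv_bounded_linear[THEN iffD1], rule linearI)
    (simp_all add: cdot_add, simp add: cdot_def scaleR_sum_right)

lemma continuous_on_cdot: "continuous_on UNIV (\<lambda>X. cdot X z)"
  unfolding cdot_def by (intro continuous_intros)

text \<open>The Fourier inversion formula for \<open>\<Phi> f\<close> at a complex point; the Gauss function outweighs the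
exponential growth of the kernel.\<close>

definition phi_entire :: "real \<Rightarrow> (real ^ 'n \<Rightarrow> complex) \<Rightarrow> complex ^ 'n \<Rightarrow> complex" where
  "phi_entire \<sigma> f z = (LINT X|lborel. exp (2 * pi * \<i> * cdot X z) * (gauss_mult \<sigma> X * fourier f X))"

text \<open>The term with \<open>v\<close> is there to bound the integrand and its derivative in the direction \<open>v\<close> at once.  All
factors that grow are at most exponentials of multiples of \<open>norm X\<close>.\<close>

lemma phi_entire_bound:
  fixes X :: "real ^ 'n"
  assumes "\<sigma> > 0" "norm z \<le> R"
  shows "(1 + norm (2 * pi * \<i> * cdot X v)) * norm (exp (2 * pi * \<i> * cdot X z) * gauss_mult \<sigma> X)
     \<le> exp ((2 * pi * CARD('n) * (R + norm v))\<^sup>2 / (4 * ((pi / 2) * \<sigma>\<^sup>2)))"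
proof -
  let ?N = "2 * pi * real CARD('n)"
  have "norm (2 * pi * \<i> * cdot X v) \<le> ?N * norm v * norm X"
    using mult_left_mono[OF norm_cdot_le[of X v], of "2 * pi"] by (simp add: norm_mult mult_ac)
  then have 1: "1 + norm (2 * pi * \<i> * cdot X v) \<le> exp (?N * norm v * norm X)"
    using exp_ge_add_one_self[of "?N * norm v * norm X"] by linarith
  have "norm (2 * pi * \<i> * cdot X z) \<le> ?N * (norm X * norm z)"
    using mult_left_mono[OF norm_cdot_le[of X z], of "2 * pi"] by (simp add: norm_mult mult_ac)
  also have "\<dots> \<le> ?N * (norm X * R)" using assms(2) by (intro mult_left_mono) auto
  also have "\<dots> = ?N * R * norm X" by simp
  finally have "norm (exp (2 * pi * \<i> * cdot X z)) \<le> exp (?N * R * norm X)"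
    by (intro order_trans[OF norm_exp]) (simp only: exp_le_cancel_iff)
  then have "(1 + norm (2 * pi * \<i> * cdot X v)) * norm (exp (2 * pi * \<i> * cdot X z) * gauss_mult \<sigma> X)
     \<le> exp (?N * norm v * norm X) * (exp (?N * R * norm X) * norm (gauss_mult \<sigma> X))"
    by (subst norm_mult[of "exp (2 * pi * \<i> * cdot X z)"], intro mult_mono 1 mult_right_mono) auto
  also have "\<dots> = exp ((?N * (R + norm v)) * norm X) * exp (- ((pi / 2) * \<sigma>\<^sup>2) * (norm X)\<^sup>2)"
    by (simp add: gauss_mult_def power2_norm_eq_inner distrib_left distrib_right exp_add mult_ac)
  also have "\<dots> \<le> exp ((?N * (R + norm v))\<^sup>2 / (4 * ((pi / 2) * \<sigma>\<^sup>2)))"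
    by (rule exp_linear_gaussian_bound) (use assms in simp)
  finally show ?thesis .
qed

lemma integrable_phi_entire:
  fixes f :: "real ^ 'n \<Rightarrow> complex"
  assumes \<sigma>: "\<sigma> > 0" and f: "schwartz f"
  shows "integrable lborel (\<lambda>X. exp (2 * pi * \<i> * cdot X z) * (gauss_mult \<sigma> X * fourier f X))"
proof (rule Bochner_Integration.integrable_bound)
  let ?C = "exp ((2 * pi * CARD('n) * (norm z + norm (0 :: complex ^ 'n)))\<^sup>2 / (4 * ((pi / 2) * \<sigma>\<^sup>2)))"
  show "integrable lborel (\<lambda>X. ?C * norm (fourier f X))"
    by (intro integrable_mult_right integrable_norm schwartz_integrable schwartz_fourier f)
  show "(\<lambda>X. exp (2 * pi * \<i> * cdot X z) * (gauss_mult \<sigma> X * fourier f X)) \<in> borel_measurable lborel"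
    by (intro borel_measurable_lborel_continuous continuous_intros continuous_on_cdot schwartz_continuous schwartz_fourier
        schwartz_gauss_mult f \<sigma>)
  show "AE X in lborel. norm (exp (2 * pi * \<i> * cdot X z) * (gauss_mult \<sigma> X * fourier f X)) \<le> norm (?C * norm (fourier f X))"
  proof (rule AE_I2)
    fix X
    have "norm (exp (2 * pi * \<i> * cdot X z) * gauss_mult \<sigma> X) \<le> ?C"
      using phi_entire_bound[OF \<sigma> order_refl, of X 0 z] by (simp add: cdot_def)
    from mult_right_mono[OF this norm_ge_zero[of "fourier f X"]]
    show "norm (exp (2 * pi * \<i> * cdot X z) * (gauss_mult \<sigma> X * fourier f X)) \<le> norm (?C * norm (fourier f X))"
      by (simp add: norm_mult mult.assoc)
  qed
qed

lemma entire_phi_entire: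
  fixes f :: "real ^ 'n \<Rightarrow> complex"
  assumes \<sigma>: "\<sigma> > 0" and f: "schwartz f"
  shows "entire (phi_entire \<sigma> f)"
  unfolding entire_def
proof
  fix z :: "complex ^ 'n"
  let ?I = "\<lambda>z X. exp (2 * pi * \<i> * cdot X z) * (gauss_mult \<sigma> X * fourier f X)"
  let ?D = "\<lambda>z X v. (2 * pi * \<i> * cdot X v) * ?I z X"
  let ?K = "2 * pi * CARD('n) * (norm z + 1 + 1)"
  let ?C = "exp (?K\<^sup>2 / (4 * ((pi / 2) * \<sigma>\<^sup>2)))"
  have "((\<lambda>z. LINT X|lborel. ?I z X) has_derivative (\<lambda>v. LINT X|lborel. ?D z X v)) (at z)"
  proof (rule has_derivative_integral[where e = 1 and g = "\<lambda>X. ?C * norm (fourier f X)"])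
    show "integrable lborel (?I z)" for z by (rule integrable_phi_entire[OF \<sigma> f])
    show "((\<lambda>z. ?I z X) has_derivative ?D z X) (at z)" for z X
    proof -
      have e: "(exp has_derivative (\<lambda>h. exp w * h)) (at w)" for w :: complex
        using DERIV_exp[of w] by (simp add: has_field_derivative_def)
      have "((\<lambda>z. 2 * pi * \<i> * cdot X z) has_derivative (\<lambda>v. 2 * pi * \<i> * cdot X v)) (at z)"
        by (intro has_derivative_mult_right bounded_linear_imp_has_derivative bounded_linear_cdot)
      from has_derivative_mult_left[OF has_derivative_compose[OF this e], of "gauss_mult \<sigma> X * fourier f X"]
      show ?thesis by (simp add: mult_ac)
    qed
    show "norm (?D z' X v) \<le> ?C * norm (fourier f X) * norm v" if z': "z' \<in> ball z 1" for z' X v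
    proof (cases "v = 0")
      case True then show ?thesis by (simp add: cdot_def)
    next
      case False
      \<comment> \<open>The bound is not homogeneous in the direction, so it is applied to a unit vector.\<close>
      define v' where "v' = (1 / norm v) *\<^sub>R v"
      have v': "norm v' = 1" "v = of_real (norm v) *s v'"
        using False by (simp_all add: v'_def) (simp add: vec_eq_iff scaleR_conv_of_real[where 'a = complex])
      have "norm z' \<le> norm z + 1"
        using z' norm_triangle_ineq2[of z' z] by (simp add: dist_norm norm_minus_commute)
      from phi_entire_bound[OF \<sigma> this, of X v']
      have "(1 + norm (2 * pi * \<i> * cdot X v')) * norm (exp (2 * pi * \<i> * cdot X z') * gauss_mult \<sigma> X) \<le> ?C"
        by (simp add: v' add.assoc)
      then have "norm (2 * pi * \<i> * cdot X v') * norm (exp (2 * pi * \<i> * cdot X z') * gauss_mult \<sigma> X) \<le> ?C"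
        by (rule order_trans[rotated]) (simp add: distrib_right)
      then have "(norm (2 * pi * \<i> * cdot X v') * norm (exp (2 * pi * \<i> * cdot X z') * gauss_mult \<sigma> X)) * (norm (fourier f X) * norm v)
          \<le> ?C * (norm (fourier f X) * norm v)"
        by (rule mult_right_mono) auto
      moreover have "norm (cdot X v) = norm v * norm (cdot X v')"
        by (subst v'(2)) (simp add: cdot_smult norm_mult)
      ultimately show ?thesis by (simp add: norm_mult mult_ac)
    qed
    show "integrable lborel (\<lambda>X. ?C * norm (fourier f X))"
      by (intro integrable_mult_right integrable_norm schwartz_integrable schwartz_fourier f)
    show "(\<lambda>X. ?D z X v) \<in> borel_measurable lborel" for v
      by (intro borel_measurable_lborel_continuous continuous_intros continuous_on_cdot schwartz_continuous schwartz_fourier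
        schwartz_gauss_mult f \<sigma>)
  qed simp
  moreover have "(LINT X|lborel. ?D z X (c *s v)) = c * (LINT X|lborel. ?D z X v)" for c v
    by (subst integral_mult_right_zero[symmetric]) (simp add: cdot_smult mult_ac)
  ultimately show "\<exists>D. (phi_entire \<sigma> f has_derivative D) (at z) \<and> (\<forall>c v. D (c *s v) = c * D v)"
    unfolding phi_entire_def[abs_def] by blast
qed

lemma phi_entire_extension:
  assumes "\<sigma> > 0" "schwartz f"
  shows "entire_extension (phi_entire \<sigma> f) (Phi \<sigma> f)"
  unfolding entire_extension_def
proof (intro conjI allI)
  show "entire (phi_entire \<sigma> f)" by (rule entire_phi_entire[OF assms])
  show "phi_entire \<sigma> f (\<chi> j. of_real (x $ j)) = Phi \<sigma> f x" for x
    unfolding phi_entire_def cvec_def[symmetric] cdot_cvec Phi_def inv_fourier_def by (simp add: inner_commute)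
qed

lemma entire_line_holomorphic:
  assumes "entire W"
  shows "(\<lambda>c. W (X + c *s Y)) holomorphic_on UNIV"
proof (rule holomorphic_onI)
  fix c
  obtain D where D: "(W has_derivative D) (at (X + c *s Y))" "\<And>c v. D (c *s v) = c * D v"
    using assms unfolding entire_def by blast
  have bl: "bounded_linear (\<lambda>c. c *s Y)"
    by (rule linear_conv_bounded_linear[THEN iffD1], rule linearI)
      (simp_all add: vec_eq_iff distrib_right)
  have "((\<lambda>c. X + c *s Y) has_derivative (\<lambda>h. h *s Y)) (at c)"
    using has_derivative_add[OF has_derivative_const bounded_linear_imp_has_derivative[OF bl]] by simp
  from has_derivative_compose[OF this D(1)]
  moreover have "(\<lambda>h. D (h *s Y)) = (\<lambda>h. D Y * h)" by (simp add: fun_eq_iff D(2) mult.commute)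
  ultimately have "((\<lambda>c. W (X + c *s Y)) has_field_derivative D Y) (at c)"
    by (simp add: has_field_derivative_def)
  then show "(\<lambda>c. W (X + c *s Y)) field_differentiable at c within UNIV"
    using field_differentiable_def by blast
qed

lemma zero_islimpt_Reals: "(0 :: complex) islimpt \<real>"
  unfolding islimpt_approachable
proof (intro allI impI)
  fix e :: real assume "e > 0"
  then show "\<exists>x'\<in>\<real>. x' \<noteq> 0 \<and> dist x' (0 :: complex) < e"
    by (intro bexI[of _ "of_real (e / 2)"]) auto
qed

text \<open>Every point of \<open>\<complex>\<^sup>n\<close> is \<open>X + \<i> Y\<close> with real vectors \<open>X\<close> and \<open>Y\<close>.  On the complex line \<open>c \<mapsto> X + c Y\<close> two
extensions agree for real \<open>c\<close>, hence for all \<open>c\<close> by the identity theorem in one variable.\<close>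

lemma entire_extension_unique:
  fixes W W' :: "complex ^ 'n \<Rightarrow> complex"
  assumes "entire_extension W w" "entire_extension W' w"
  shows "W = W'"
proof
  fix z :: "complex ^ 'n"
  define X where "X = cvec (\<chi> j. Re (z $ j))"
  define Y where "Y = cvec (\<chi> j. Im (z $ j))"
  have z: "z = X + \<i> *s Y"
    by (simp add: X_def Y_def cvec_def vec_eq_iff complex_eq)
  let ?F = "\<lambda>c. W (X + c *s Y) - W' (X + c *s Y)"
  have "?F \<i> = 0"
  proof (rule analytic_continuation[of ?F UNIV \<real> 0])
    show "?F holomorphic_on UNIV"
      using assms unfolding entire_extension_def by (intro holomorphic_on_diff entire_line_holomorphic) auto
    show "?F c = 0" if c: "c \<in> \<real>" for c
    proof -
      obtain r where r: "c = of_real r" using c by (rule Reals_cases)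
      let ?x = "\<chi> j. Re (z $ j) + r * Im (z $ j)"
      have "X + c *s Y = (\<chi> j. of_real (?x $ j))"
        by (simp add: X_def Y_def cvec_def vec_eq_iff r)
      then have "W (X + c *s Y) = w ?x" "W' (X + c *s Y) = w ?x"
        using assms unfolding entire_extension_def by metis+
      then show ?thesis by simp
    qed
  qed (auto intro: zero_islimpt_Reals)
  then show "W z = W' z" by (simp add: z)
qed

section \<open>The space side formula\<close>

text \<open>At \<open>z = y - \<i> \<sigma>\<^sup>2 k\<close> the real exponents \<open>- 2 \<pi> \<sigma>\<^sup>2 k\<^sup>2\<close>, \<open>2 \<pi> \<sigma>\<^sup>2 p \<bullet> k\<close> and \<open>- (\<pi> / 2) \<sigma>\<^sup>2 p\<^sup>2\<close> add up to the
complete square \<open>- (\<pi> / 2) \<sigma>\<^sup>2 (2 k - p)\<^sup>2\<close>.  The substitution \<open>p = k - u / 2\<close> then identifies \<open>\<psi>\<close> with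
the Weyl kernel at \<open>m = (y + x) / 2\<close>, up to the Jacobian.\<close>

lemma space_side:
  fixes f :: "real ^ 'n \<Rightarrow> complex" and x :: "real ^ 'n"
  assumes \<sigma>: "\<sigma> > 0" and f: "schwartz f" and L: "tempered_distribution L"
  defines "\<psi> \<equiv> \<lambda>(y, k). exp (2 * pi * \<i> * of_real ((x - y) \<bullet> k) - of_real (2 * pi * \<sigma>\<^sup>2 * (k \<bullet> k)))
          * phi_entire \<sigma> f (\<chi> j. of_real (y $ j) - \<i> * of_real (\<sigma>\<^sup>2 * (k $ j)))"
  shows "schwartz \<psi>" and "L (weyl_kernel \<sigma> f x) = affine_fst_dist (1/2) ((1/2) *\<^sub>R x) L \<psi>"
proof -
  let ?n = "CARD('n)"
  have \<psi>: "\<psi> (y, k) = of_real ((1/2) ^ ?n) * weyl_kernel \<sigma> f x ((1/2) *\<^sub>R (y + x), k)" for y k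
  proof -
    let ?z = "(\<chi> j. of_real (y $ j) - \<i> * of_real (\<sigma>\<^sup>2 * (k $ j))) :: complex ^ 'n"
    \<comment> \<open>The integrand of \<open>phi_entire\<close> with the prefactor of \<open>\<psi>\<close> moved under the integral.\<close>
    let ?E = "exp (2 * pi * \<i> * of_real ((x - y) \<bullet> k) - of_real (2 * pi * \<sigma>\<^sup>2 * (k \<bullet> k)))"
    let ?R = "\<lambda>p. ?E * (exp (2 * pi * \<i> * cdot p ?z) * (gauss_mult \<sigma> p * fourier f p))"
    have cz: "cdot p ?z = of_real (p \<bullet> y) - \<i> * of_real (\<sigma>\<^sup>2 * (p \<bullet> k))" for p
      by (simp add: cdot_def inner_vec_def right_diff_distrib sum_subtractf sum_distrib_left mult_ac)
    have "\<psi> (y, k) = (LINT p|lborel. ?R p)" by (simp add: \<psi>_def phi_entire_def)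
    also have "\<dots> = of_real (\<bar>- (1/2)\<bar> ^ DIM(real ^ 'n)) * (LINT u|lborel. ?R (k + (- (1/2)) *\<^sub>R u))"
      by (intro integral_lborel_affine integrable_mult_right integrable_phi_entire \<sigma> f) simp
    also have "\<dots> = of_real ((1/2) ^ ?n) * (LINT u|lborel. ?R (k - (1/2) *\<^sub>R u))" by simp
    also have "(LINT u|lborel. ?R (k - (1/2) *\<^sub>R u)) = weyl_kernel \<sigma> f x ((1/2) *\<^sub>R (y + x), k)"
      unfolding weyl_kernel_def wigner_unit_exp
    proof (rule Bochner_Integration.integral_cong[OF refl])
      fix u
      let ?p = "k - (1/2) *\<^sub>R u" and ?q = "k + (1/2) *\<^sub>R u"
      have g: "gauss_mult \<sigma> r = exp (of_real (- (pi / 2) * \<sigma>\<^sup>2 * (r \<bullet> r)))" for r :: "real ^ 'n"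
        by (simp only: gauss_mult_def exp_of_real)
      have re: "- (2 * pi * \<sigma>\<^sup>2 * (k \<bullet> k)) + 2 * pi * \<sigma>\<^sup>2 * (?p \<bullet> k) + - (pi / 2) * \<sigma>\<^sup>2 * (?p \<bullet> ?p)
          = - (pi / 2) * \<sigma>\<^sup>2 * (?q \<bullet> ?q)"
        by (simp add: inner_add_left inner_add_right inner_diff_left inner_diff_right inner_commute algebra_simps)
      have im: "(x - y) \<bullet> k + ?p \<bullet> y = - ((1/2) *\<^sub>R (y + x) \<bullet> u) + x \<bullet> ?q"
        by (simp add: inner_add_left inner_add_right inner_diff_left inner_diff_right inner_commute algebra_simps)
      have "?E * exp (2 * pi * \<i> * cdot ?p ?z) * gauss_mult \<sigma> ?p
          = exp (2 * pi * \<i> * of_real ((x - y) \<bullet> k + ?p \<bullet> y) +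
              of_real (- (2 * pi * \<sigma>\<^sup>2 * (k \<bullet> k)) + 2 * pi * \<sigma>\<^sup>2 * (?p \<bullet> k) + - (pi / 2) * \<sigma>\<^sup>2 * (?p \<bullet> ?p)))"
        unfolding cz g exp_add[symmetric]
        by (rule arg_cong[of _ _ exp]) (simp add: algebra_simps)
      also have "\<dots> = unit_exp (- ((1/2) *\<^sub>R (y + x) \<bullet> u) + x \<bullet> ?q) * gauss_mult \<sigma> ?q"
        unfolding re im g unit_exp_def by (simp only: exp_add)
      finally show "?R ?p = unit_exp (- ((1/2) *\<^sub>R (y + x) \<bullet> u)) * (unit_exp (x \<bullet> ?q) * gauss_mult \<sigma> ?q * fourier f ?p)"
        unfolding unit_exp_add by (simp only: mult.assoc[symmetric])
    qed
    finally show ?thesis .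
  qed
  note sK = schwartz_weyl_kernel[OF \<sigma> f, of x]
  have "scont (\<lambda>(\<phi> :: (real ^ 'n) \<times> (real ^ 'n) \<Rightarrow> complex) p. \<phi> (((1/2) *\<^sub>R fst p, snd p) + ((1/2) *\<^sub>R x, 0)))"
    by (rule scont_affine[where l' = "\<lambda>p. (2 *\<^sub>R fst p, snd p)"])
      (auto intro!: bounded_linear_Pair bounded_linear_fst bounded_linear_snd bounded_linear_const_scaleR)
  from schwartz_cmult[OF scont_schwartz[OF this sK], of "of_real ((1/2) ^ ?n)"]
  show "schwartz \<psi>"
    by (rule back_subst[of schwartz]) (auto simp: fun_eq_iff \<psi> scaleR_add_right)
  have "affine_fst_dist (1/2) ((1/2) *\<^sub>R x) L \<psi> = L (\<lambda>p. of_real ((1/2) ^ ?n) * weyl_kernel \<sigma> f x p) / of_real ((1/2) ^ ?n)"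
    unfolding affine_fst_dist_def by (simp add: case_prod_unfold \<psi> scaleR_diff_right)
  also have "\<dots> = L (weyl_kernel \<sigma> f x)"
    unfolding tempered_cmult[OF L sK] by simp
  finally show "L (weyl_kernel \<sigma> f x) = affine_fst_dist (1/2) ((1/2) *\<^sub>R x) L \<psi>" by simp
qed

section \<open>Conjugation of Weyl operators by the smoothing operator\<close>

theorem theorem1p1:
  fixes \<sigma> :: real
    and f w :: "real ^ 'n \<Rightarrow> complex"
    and L :: "((real ^ 'n) \<times> (real ^ 'n) \<Rightarrow> complex) \<Rightarrow> complex"
  assumes "\<sigma> > 0"
    and "schwartz f"
    and "tempered_distribution L"
    and "w = Phi \<sigma> f"
  shows "(\<exists>W. entire_extension W w) \<and>
    (\<exists>h. continuous_on UNIV h \<and> represented_by (smoothed_op \<sigma> L w) h \<and>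
      (\<forall>x.
        let \<phi> = (\<lambda>(u, k).
          exp (2 * pi * ((\<i> * of_real (x \<bullet> u)) - of_real (\<sigma>\<^sup>2 * (k \<bullet> u)))
               + 2 * pi * \<i> * of_real (k \<bullet> x)) * fourier w (k - u))
        in schwartz \<phi> \<and>
           h x = 2 ^ CARD('n) * affine_fst_dist 2 0 (fourier_fst_dist L) \<phi>) \<and>
      (\<forall>W. entire_extension W w \<longrightarrow> (\<forall>x.
        let \<psi> = (\<lambda>(y, k).
          exp (2 * pi * \<i> * of_real ((x - y) \<bullet> k) - of_real (2 * pi * \<sigma>\<^sup>2 * (k \<bullet> k)))
          * W (\<chi> j. of_real (y $ j) - \<i> * of_real (\<sigma>\<^sup>2 * (k $ j))))
        in schwartz \<psi> \<and>
           h x = affine_fst_dist (1/2) ((1/2) *\<^sub>R x) L \<psi>)))"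
proof -
  note \<sigma> = assms(1) and f = assms(2) and L = assms(3)
  have ext: "entire_extension (phi_entire \<sigma> f) w"
    unfolding assms(4) by (rule phi_entire_extension[OF \<sigma> f])
  have W: "W = phi_entire \<sigma> f" if "entire_extension W w" for W
    by (rule entire_extension_unique[OF that ext])
  note fourier_side = fourier_side(1)[OF \<sigma> f, folded assms(4)]
    fourier_side(2)[OF \<sigma> f, of L, folded assms(4), unfolded DIM_cart DIM_real mult_1_right]
  show ?thesis
    unfolding Let_def
  proof (intro conjI exI[of _ "phi_entire \<sigma> f"] exI[of _ "\<lambda>x. L (weyl_kernel \<sigma> f x)"] allI impI)
    show "entire_extension (phi_entire \<sigma> f) w" by (rule ext)
    show "continuous_on UNIV (\<lambda>x. L (weyl_kernel \<sigma> f x))"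
      "represented_by (smoothed_op \<sigma> L w) (\<lambda>x. L (weyl_kernel \<sigma> f x))"
      unfolding assms(4) by (rule smoothed_op_represented[OF \<sigma> f L])+
  qed (rule fourier_side | (drule W, erule ssubst, rule space_side[OF \<sigma> f L]))+
qed

end
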